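(* For every integer $n \geq 26$, $$\log\Bigl(1+\frac{\pi}{2\sqrt{n}}\Bigr) < \Delta \log \overline{p}(n) < \log\Bigl(1+\frac{\pi}{2\sqrt{n}}+\frac{\pi^2}{40n}\Bigr).$$
   Context: An overpartition of a positive integer $n$ is a nonincreasing sequence of positive integers with sum $n$ in which the first occurrence of each number may be overlined. $\overline{p}(n)$ denotes the number of overpartitions of $n$, with $\overline{p}(0)=1$ (e.g. $\overline{p}(3)=8$). $\Delta$ is the forward difference operator $\Delta f(n)=f(n+1)-f(n)$, so $\Delta\log\overline{p}(n)=\log\overline{p}(n+1)-\log\overline{p}(n)$. $\log$ is the natural logarithm. *)

theory Defs
  imports Complex_Main
begin

(* A part is a pair (size, overlined?). *)
definition is_overpartition :: "nat \<Rightarrow> (nat \<times> bool) list \<Rightarrow> bool" where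
  "is_overpartition n xs \<longleftrightarrow>
     sorted_wrt (\<ge>) (map fst xs) \<and>
     (\<forall>x \<in> set xs. fst x > 0) \<and>
     sum_list (map fst xs) = n \<and>
     (\<forall>i < length xs. snd (xs ! i) \<longrightarrow> (\<forall>j < i. fst (xs ! j) \<noteq> fst (xs ! i)))"

(* For n = 0 the only overpartition is the empty list, so the value is 1. *)
definition overpartitions :: "nat \<Rightarrow> nat" where
  "overpartitions n = card {xs. is_overpartition n xs}"

definition forward_diff :: "(nat \<Rightarrow> real) \<Rightarrow> nat \<Rightarrow> real" where
  "forward_diff f n = f (n + 1) - f n"

(* So the cardinality above is never the junk value of an infinite set. *)
lemma finite_overpartitions: "finite {xs. is_overpartition n xs}"
proof (rule finite_subset)
  have len: "length xs \<le> sum_list (map fst xs)"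
    if "\<forall>x \<in> set xs. fst x > 0" for xs :: "(nat \<times> bool) list"
    using that by (induction xs) auto
  show "{xs. is_overpartition n xs} \<subseteq>
      {xs. set xs \<subseteq> {0..n} \<times> UNIV \<and> length xs \<le> n}"
  proof (rule subsetI, rule CollectI, rule conjI)
    fix xs assume "xs \<in> {xs. is_overpartition n xs}"
    then have pos: "\<forall>x \<in> set xs. fst x > 0" and s: "sum_list (map fst xs) = n"
      by (auto simp: is_overpartition_def)
    show "length xs \<le> n" using len[OF pos] s by simp
    have "fst x \<le> n" if "x \<in> set xs" for x
      using member_le_sum_list[of "fst x" "map fst xs"] that s by auto
    then show "set xs \<subseteq> {0..n} \<times> UNIV" by fastforce
  qed
  show "finite {xs :: (nat \<times> bool) list. set xs \<subseteq> {0..n} \<times> UNIV \<and> length xs \<le> n}"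
    by (rule finite_lists_length_le) simp
qed

lemma overpartitions_0: "overpartitions 0 = 1"
proof -
  have "{xs. is_overpartition 0 xs} = {[]}"
  proof (rule set_eqI)
    fix xs show "xs \<in> {xs. is_overpartition 0 xs} \<longleftrightarrow> xs \<in> {[]}"
      by (cases xs) (auto simp: is_overpartition_def)
  qed
  then show ?thesis by (simp add: overpartitions_def)
qed

end

theory Submission
  imports Defs "HOL-Complex_Analysis.Complex_Analysis" "HOL-Probability.Distributions"
    "HOL-Real_Asymp.Real_Asymp"
begin

text \<open>
  The generating function of \<open>overpartitions\<close> is the product of \<open>(1 + q ^ i) / (1 - q ^ i)\<close>, which by
  Gauss is the reciprocal of \<open>theta4 q\<close>, the sum of \<open>(-1) ^ k * q ^ k\<^sup>2\<close> over all integers \<open>k\<close>.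
  The transformation formula of \<open>theta4\<close>, obtained for real arguments as a limit of an identity of
  Polya between binomial and trigonometric sums and extended by the identity theorem, shows that at
  \<open>q = exp (- t)\<close> the generating function equals \<open>sqrt t * exp (pi\<^sup>2 / (4 * t)) / (2 * sqrt pi)\<close> up to a
  bounded error near \<open>t = 0\<close>. In Cauchy's coefficient integral the main term lives on a segment that can
  be bent into an arc of the circle through the saddle point, where it becomes a Gaussian integral.
  This gives \<open>exp (pi * x) / (8 * x\<^sup>2) * (1 - 1 / (pi * x))\<close> with \<open>x = sqrt n\<close>, up to an error
  \<open>2 * exp (2 * pi * x / 3)\<close>, and decides the inequalities for \<open>n \<ge> 400\<close>. Smaller \<open>n\<close> are checked with
  the recurrence that expresses that \<open>theta4\<close> is the reciprocal.
\<close>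

section \<open>The generating function\<close>

unbundle no vec_syntax

text \<open>The obstacle is the upper bound. With v = 1 / sqrt n and p = pi / 2, the quotient of
  consecutive values is 1 + p v + (p^2/2 - 1) v^2 + O(v^3), while the claim puts p^2/10 in place of
  p^2/2 - 1, which is larger by only about 0.013. Two consecutive values enter, so each must be
  known up to a relative error clearly below 0.0065 / n. Hence the factor 1 - 1 / (pi sqrt n) has to
  be part of the main term and the rest has to be exponentially small.

  An error of order exp (2 pi sqrt n / 3) is modest enough that singularities at other roots of
  unity need no separate study: away from q = 1 it suffices to compare the product with its value at
  the modulus of q, using only the linear Taylor coefficient of each logarithmic factor. The line of
  integration has half the saddle point as abscissa. It therefore meets the circle through the
  saddle point at angles pi / 3 and - pi / 3, where the main integrand has dropped from exp (pi sqrt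
  n) to exp (pi sqrt n / 2) up to algebraic factors. The threshold n = 400, that is sqrt n = 20,
  makes the numerical margin on the remaining range just large enough.\<close>

definition overpartitions_le :: "nat \<Rightarrow> nat \<Rightarrow> (nat \<times> bool) list set" where
  "overpartitions_le m n = {xs. is_overpartition n xs \<and> (\<forall>x\<in>set xs. fst x \<le> m)}"

text \<open>Once \<open>k\<close> is put in front, the copies of \<open>k\<close> in the tail are no
  longer first occurrences, so none of them may be overlined; first occurrences of other sizes are
  unaffected.\<close>

lemma is_overpartition_Cons:
  "is_overpartition n ((k, b) # ys) \<longleftrightarrow>
     0 < k \<and> k \<le> n \<and> is_overpartition (n - k) ys \<and> (\<forall>y\<in>set ys. fst y \<le> k) \<and> (k, True) \<notin> set ys"
  (is "?L \<longleftrightarrow> ?R")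
proof
  assume L: ?L
  have nm: "\<forall>i<length ((k, b) # ys). snd (((k, b) # ys) ! i) \<longrightarrow>
              (\<forall>j<i. fst (((k, b) # ys) ! j) \<noteq> fst (((k, b) # ys) ! i))"
    using L unfolding is_overpartition_def by blast
  have ys: "\<forall>i<length ys. snd (ys ! i) \<longrightarrow> (\<forall>j<i. fst (ys ! j) \<noteq> fst (ys ! i))"
    and k: "\<forall>i<length ys. snd (ys ! i) \<longrightarrow> fst (ys ! i) \<noteq> k"
  proof -
    have "snd (ys ! i) \<longrightarrow> (\<forall>j<i. fst (ys ! j) \<noteq> fst (ys ! i)) \<and> fst (ys ! i) \<noteq> k" if "i < length ys" for i
    proof (intro impI conjI allI)
      assume s: "snd (ys ! i)"
      have *: "fst (((k, b) # ys) ! j) \<noteq> fst (ys ! i)" if "j < Suc i" for j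
        using nm[rule_format, of "Suc i" j] s that \<open>i < length ys\<close> by simp
      show "fst (ys ! j) \<noteq> fst (ys ! i)" if "j < i" for j using *[of "Suc j"] that by simp
      show "fst (ys ! i) \<noteq> k" using *[of 0] by simp
    qed
    then show "\<forall>i<length ys. snd (ys ! i) \<longrightarrow> (\<forall>j<i. fst (ys ! j) \<noteq> fst (ys ! i))"
      "\<forall>i<length ys. snd (ys ! i) \<longrightarrow> fst (ys ! i) \<noteq> k" by blast+
  qed
  have "(k, True) \<notin> set ys"
    using k by (auto simp: in_set_conv_nth)
  then show ?R using L ys by (auto simp: is_overpartition_def)
next
  assume R: ?R
  have k: "snd (ys ! i) \<longrightarrow> k \<noteq> fst (ys ! i)" if "i < length ys" for i
    using R nth_mem[OF that] by (metis prod.collapse)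
  have nm: "snd (((k, b) # ys) ! i) \<longrightarrow> (\<forall>j<i. fst (((k, b) # ys) ! j) \<noteq> fst (((k, b) # ys) ! i))"
    if "i < length ((k, b) # ys)" for i
    using that R k by (cases i) (auto simp: is_overpartition_def less_Suc_eq_0_disj)
  show ?L unfolding is_overpartition_def
  proof (intro conjI)
    show "\<forall>i<length ((k, b) # ys). snd (((k, b) # ys) ! i) \<longrightarrow>
            (\<forall>j<i. fst (((k, b) # ys) ! j) \<noteq> fst (((k, b) # ys) ! i))"
      using nm by blast
  qed (use R in \<open>auto simp: is_overpartition_def\<close>)
qed

lemma finite_overpartitions_le: "finite (overpartitions_le m n)"
  unfolding overpartitions_le_def
  by (rule finite_subset[OF _ finite_overpartitions[of n]]) auto

lemma overpartitions_le_0: "overpartitions_le 0 n = (if n = 0 then {[]} else {})"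
proof -
  have "xs \<in> overpartitions_le 0 n \<longleftrightarrow> xs = [] \<and> n = 0" for xs
    by (cases xs) (auto simp: overpartitions_le_def is_overpartition_def)
  then show ?thesis by auto
qed

lemma overpartitions_le_eq:
  assumes "n \<le> m"
  shows "overpartitions_le m n = {xs. is_overpartition n xs}"
proof -
  have "fst x \<le> m" if "is_overpartition n xs" "x \<in> set xs" for x xs
    using member_le_sum_list[of "fst x" "map fst xs"] that assms
    by (auto simp: is_overpartition_def)
  then show ?thesis by (auto simp: overpartitions_le_def)
qed

lemma overpartitions_eq: "n \<le> m \<Longrightarrow> overpartitions n = card (overpartitions_le m n)"
  by (simp add: overpartitions_def overpartitions_le_eq)

lemma card_overpartitions_le_le: "card (overpartitions_le m n) \<le> overpartitions n"
  unfolding overpartitions_def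
  by (rule card_mono[OF finite_overpartitions]) (auto simp: overpartitions_le_def)

text \<open>With bound \<open>m\<close>, these are the tails that may follow a leading part
  \<open>m\<close>. The recursion on the largest part does not close without this second
  family.\<close>

definition unmarked_le :: "nat \<Rightarrow> nat \<Rightarrow> (nat \<times> bool) list set" where
  "unmarked_le m n = {xs \<in> overpartitions_le m n. (m, True) \<notin> set xs}"

lemma finite_unmarked_le: "finite (unmarked_le m n)"
  unfolding unmarked_le_def using finite_overpartitions_le by simp

lemma overpartitions_le_head:
  "xs \<in> overpartitions_le (Suc m) n \<longleftrightarrow> xs \<in> overpartitions_le m n \<or>
     Suc m \<le> n \<and> (\<exists>b. \<exists>ys \<in> unmarked_le (Suc m) (n - Suc m). xs = (Suc m, b) # ys)"
proof (cases xs)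
  case Nil
  then show ?thesis by (auto simp: overpartitions_le_def)
next
  case (Cons x ys)
  obtain k b where x: "x = (k, b)" by force
  show ?thesis
    unfolding Cons x overpartitions_le_def unmarked_le_def mem_Collect_eq is_overpartition_Cons
    by (cases "k = Suc m") auto
qed

text \<open>The factor 2 is the choice of the mark on a leading \<open>Suc m\<close>. In
  \<open>card_unmarked_le_Suc\<close> that mark is forced to be absent, so no factor appears
  there.\<close>

lemma card_overpartitions_le_Suc:
  "card (overpartitions_le (Suc m) n) = card (overpartitions_le m n) +
     (if Suc m \<le> n then 2 * card (unmarked_le (Suc m) (n - Suc m)) else 0)"
proof -
  define C where "C = (\<lambda>(b, ys). (Suc m, b) # ys) ` ((UNIV :: bool set) \<times> unmarked_le (Suc m) (n - Suc m))"
  have "card C = 2 * card (unmarked_le (Suc m) (n - Suc m))"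
    unfolding C_def by (subst card_image) (auto simp: inj_on_def card_cartesian_product)
  moreover have "overpartitions_le (Suc m) n = overpartitions_le m n \<union> (if Suc m \<le> n then C else {})"
    using overpartitions_le_head[of _ m n] by (auto simp: C_def image_iff)
  moreover have "overpartitions_le m n \<inter> C = {}"
    by (auto simp: C_def overpartitions_le_def)
  moreover have "finite C" by (auto simp: C_def finite_unmarked_le)
  ultimately show ?thesis
    by (simp add: card_Un_disjoint finite_overpartitions_le)
qed

lemma card_unmarked_le_Suc:
  "card (unmarked_le (Suc m) n) = card (overpartitions_le m n) +
     (if Suc m \<le> n then card (unmarked_le (Suc m) (n - Suc m)) else 0)"
proof -
  define C where "C = (#) (Suc m, False) ` unmarked_le (Suc m) (n - Suc m)"
  have "card C = card (unmarked_le (Suc m) (n - Suc m))"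
    unfolding C_def by (subst card_image) auto
  moreover have "unmarked_le (Suc m) n = overpartitions_le m n \<union> (if Suc m \<le> n then C else {})"
  proof -
    have "xs \<in> unmarked_le (Suc m) n \<longleftrightarrow> xs \<in> overpartitions_le m n \<or> Suc m \<le> n \<and> xs \<in> C" for xs
    proof -
      have "(Suc m, True) \<notin> set xs" if "xs \<in> overpartitions_le m n"
        using that by (force simp: overpartitions_le_def)
      moreover have "(Suc m, True) \<notin> set ys" if "ys \<in> unmarked_le (Suc m) (n - Suc m)" for ys
        using that by (simp add: unmarked_le_def)
      ultimately show ?thesis
        unfolding unmarked_le_def[of "Suc m" n] mem_Collect_eq overpartitions_le_head C_def by auto
    qed
    then show ?thesis by auto
  qed
  moreover have "overpartitions_le m n \<inter> C = {}"
    by (auto simp: C_def overpartitions_le_def)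
  moreover have "finite C" by (auto simp: C_def finite_unmarked_le)
  ultimately show ?thesis
    by (simp add: card_Un_disjoint finite_overpartitions_le)
qed

section \<open>Formal power series and finite products\<close>

definition op_fps :: "complex fps" where
  "op_fps = Abs_fps (\<lambda>n. of_nat (overpartitions n))"

definition op_le_fps :: "nat \<Rightarrow> complex fps" where
  "op_le_fps m = Abs_fps (\<lambda>n. of_nat (card (overpartitions_le m n)))"

text \<open>The inverse of 1 - X^k, given by its coefficients: since they are 0 or 1, comparison
  with the geometric series bounds the radius of convergence at once.\<close>

definition geom_fps :: "nat \<Rightarrow> complex fps" where
  "geom_fps k = Abs_fps (\<lambda>n. if k dvd n then 1 else 0)"

lemma fps_X_power_mult_nth':
  "(fps_X ^ k * f) $ n = (if k \<le> n then f $ (n - k) else (0::'a::comm_ring_1))"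
  by (simp add: fps_X_power_mult_nth)

lemma geom_fps_mult: "k > 0 \<Longrightarrow> (1 - fps_X ^ k) * geom_fps k = 1"
  by (rule fps_ext)
     (auto simp: left_diff_distrib fps_X_power_mult_nth' geom_fps_def dvd_imp_le dvd_diff_nat
       dest: dvd_diffD)

text \<open>Write a and a' for the series with bounds m and m + 1, b for the series of
  \<open>unmarked_le (Suc m)\<close>, and x = X^(m+1). The two counting recursions say a' = a + 2 x
  b and b = a + x b; eliminating b gives the claim.\<close>

lemma op_le_fps_Suc:
  "(1 - fps_X ^ Suc m) * op_le_fps (Suc m) = (1 + fps_X ^ Suc m) * op_le_fps m"
proof -
  define B where "B = Abs_fps (\<lambda>n. of_nat (card (unmarked_le (Suc m) n)) :: complex)"
  have 1: "op_le_fps (Suc m) = op_le_fps m + 2 * (fps_X ^ Suc m * B)"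
    by (rule fps_ext)
      (simp add: op_le_fps_def B_def card_overpartitions_le_Suc fps_X_power_mult_nth' numeral_fps_const
        del: power_Suc)
  have 2: "B = op_le_fps m + fps_X ^ Suc m * B"
    by (rule fps_ext, subst B_def)
      (simp add: op_le_fps_def B_def card_unmarked_le_Suc fps_X_power_mult_nth' del: power_Suc)
  have "a' = a + 2 * (x * b) \<Longrightarrow> b = a + x * b \<Longrightarrow> (1 - x) * a' = (1 + x) * a" for a a' b x :: "complex fps"
    by algebra
  from this[OF 1 2] show ?thesis .
qed

lemma op_le_fps_Suc': "op_le_fps (Suc m) = (1 + fps_X ^ Suc m) * (geom_fps (Suc m) * op_le_fps m)"
proof -
  have "op_le_fps (Suc m) = ((1 - fps_X ^ Suc m) * geom_fps (Suc m)) * op_le_fps (Suc m)"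
    using geom_fps_mult[of "Suc m"] by (simp del: power_Suc)
  also have "\<dots> = geom_fps (Suc m) * ((1 - fps_X ^ Suc m) * op_le_fps (Suc m))"
    by (simp only: mult_ac)
  finally show ?thesis by (simp only: op_le_fps_Suc) (simp only: mult_ac)
qed

lemma fps_conv_radius_ge_1:
  fixes f :: "complex fps"
  assumes "\<And>n. norm (f $ n) \<le> 1"
  shows "fps_conv_radius f \<ge> 1"
  unfolding fps_conv_radius_def
proof (rule conv_radius_geI_ex')
  fix r :: real assume r: "0 < r" "ereal r < 1"
  show "summable (\<lambda>n. f $ n * of_real r ^ n)"
  proof (rule summable_comparison_test)
    show "\<exists>N. \<forall>n\<ge>N. norm (f $ n * of_real r ^ n) \<le> r ^ n"
      using assms r by (auto simp: norm_mult norm_power intro!: mult_left_le_one_le)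
    show "summable (\<lambda>n. r ^ n)" using r by (simp add: summable_geometric)
  qed
qed

lemma fps_conv_radius_geom: "fps_conv_radius (geom_fps k) \<ge> 1"
  by (rule fps_conv_radius_ge_1) (simp add: geom_fps_def)

lemma eval_geom_fps:
  assumes "k > 0" "norm q < 1"
  shows "eval_fps (geom_fps k) q = 1 / (1 - q ^ k)"
proof -
  have r: "ereal (norm q) < fps_conv_radius (geom_fps k)"
    using fps_conv_radius_geom[of k] assms(2)
    by (metis ereal_less(3) less_le_trans)
  have x: "fps_conv_radius (1 - fps_X ^ k :: complex fps) = \<infinity>"
    using fps_conv_radius_diff[of "1 :: complex fps" "fps_X ^ k"] by simp
  have "(1 - q ^ k) * eval_fps (geom_fps k) q = eval_fps ((1 - fps_X ^ k) * geom_fps k) q"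
    by (subst eval_fps_mult) (use r x in \<open>auto simp: eval_fps_diff eval_fps_power\<close>)
  also have "\<dots> = 1" by (simp add: geom_fps_mult assms)
  finally have e: "(1 - q ^ k) * eval_fps (geom_fps k) q = 1" .
  then show ?thesis by (metis mult_zero_left nonzero_eq_divide_eq zero_neq_one mult.commute)
qed

lemma op_le_fps_eval:
  shows "fps_conv_radius (op_le_fps m) \<ge> 1"
    and "norm q < 1 \<Longrightarrow> eval_fps (op_le_fps m) q = (\<Prod>i=1..m. (1 + q ^ i) / (1 - q ^ i))"
proof (induction m)
  case 0
  have "op_le_fps 0 = 1"
    by (rule fps_ext) (simp add: op_le_fps_def overpartitions_le_0)
  then show "fps_conv_radius (op_le_fps 0) \<ge> 1"
    and "norm q < 1 \<Longrightarrow> eval_fps (op_le_fps 0) q = (\<Prod>i=1..0. (1 + q ^ i) / (1 - q ^ i))"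
    by simp_all
next
  case (Suc m)
  have g: "fps_conv_radius (geom_fps (Suc m) * op_le_fps m) \<ge> 1"
    using fps_conv_radius_mult[of "geom_fps (Suc m)" "op_le_fps m"] fps_conv_radius_geom[of "Suc m"] Suc(1)
    by (meson min.boundedI order_trans)
  have x: "fps_conv_radius (1 + fps_X ^ Suc m :: complex fps) = \<infinity>"
    using fps_conv_radius_add[of "1 :: complex fps" "fps_X ^ Suc m"] fps_conv_radius_power[of "fps_X :: complex fps" "Suc m"]
    by (simp del: power_Suc)
  show "fps_conv_radius (op_le_fps (Suc m)) \<ge> 1"
    unfolding op_le_fps_Suc'
    using fps_conv_radius_mult[of "1 + fps_X ^ Suc m" "geom_fps (Suc m) * op_le_fps m"] g x
    by (metis min_def order_trans ereal_infty_less_eq(1))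
  assume q: "norm q < 1"
  then have lt: "ereal (norm q) < R" if "1 \<le> R" for R using that
    by (metis ereal_less(3) less_le_trans)
  have "eval_fps (op_le_fps (Suc m)) q = (1 + q ^ Suc m) * (eval_fps (geom_fps (Suc m)) q * eval_fps (op_le_fps m) q)"
    unfolding op_le_fps_Suc'
    by (subst eval_fps_mult, use x lt[OF g] in \<open>auto simp del: power_Suc\<close>)
       (subst eval_fps_mult, use lt[OF Suc(1)] lt[OF fps_conv_radius_geom[of "Suc m"]] in
         \<open>auto simp: eval_fps_add eval_fps_power simp del: power_Suc\<close>)
  then show "eval_fps (op_le_fps (Suc m)) q = (\<Prod>i=1..Suc m. (1 + q ^ i) / (1 - q ^ i))"
    using q Suc(2) by (simp add: eval_geom_fps del: power_Suc)
qed

text \<open>Tannery's theorem, dominated convergence for series: the majorant makes the partial sums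
  converge uniformly in \<open>n\<close>, so the two limits may be exchanged.\<close>

lemma tannery:
  fixes f :: "nat \<Rightarrow> nat \<Rightarrow> 'a::banach"
  assumes "\<And>k. (\<lambda>n. f n k) \<longlonglongrightarrow> g k"
    and bound: "\<And>n k. norm (f n k) \<le> M k" and "summable M"
  shows "(\<lambda>n. \<Sum>k. f n k) \<longlonglongrightarrow> (\<Sum>k. g k)"
proof -
  have u: "uniform_limit UNIV (\<lambda>N n. \<Sum>k<N. f n k) (\<lambda>n. \<Sum>k. f n k) sequentially"
    using assms by (intro Weierstrass_m_test) auto
  have "norm (g k) \<le> M k" for k
    using assms(1) by (rule Lim_bounded[OF tendsto_norm]) (use bound in auto)
  then have "summable g"
    using assms(3) by (intro summable_comparison_test[of g M]) auto
  then have "(\<lambda>N. \<Sum>k<N. g k) \<longlonglongrightarrow> (\<Sum>k. g k)"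
    by (rule summable_LIMSEQ)
  moreover have "((\<lambda>n. \<Sum>k<N. f n k) \<longlongrightarrow> (\<Sum>k<N. g k)) sequentially" for N
    by (intro tendsto_sum assms(1))
  ultimately show ?thesis
    by (intro swap_uniform_limit'[where f="\<lambda>N n. \<Sum>k<N. f n k" and F = sequentially, OF _ _ u]) auto
qed

text \<open>Each factor is 1 + 2 r^i / (1 - r^i), hence at most exp (2 r^i / (1 - r)), and the
  exponents are summed as a geometric series. The bound is uniform in \<open>s\<close> and
  \<open>m\<close>.\<close>

lemma prod_quotient_le:
  fixes r :: real
  assumes "0 \<le> r" "r < 1" "s \<ge> 1"
  shows "(\<Prod>i=s..m. (1 + r ^ i) / (1 - r ^ i)) \<le> exp (2 * r / (1 - r)\<^sup>2)"
proof -
  have p: "r ^ i \<le> r" if "i \<ge> 1" for i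
    using that assms power_decreasing[of 1 i r] by simp
  have "(1 + r ^ i) / (1 - r ^ i) \<le> exp (2 * r ^ i / (1 - r))" if "i \<in> {s..m}" for i
  proof -
    have i: "i \<ge> 1" using that assms by auto
    have "(1 + r ^ i) / (1 - r ^ i) = 1 + 2 * r ^ i / (1 - r ^ i)"
      using p[OF i] assms by (simp add: field_simps)
    also have "\<dots> \<le> 1 + 2 * r ^ i / (1 - r)"
      using p[OF i] assms by (intro add_left_mono divide_left_mono) auto
    also have "\<dots> \<le> exp (2 * r ^ i / (1 - r))" by (rule exp_ge_add_one_self)
    finally show ?thesis .
  qed
  then have "(\<Prod>i=s..m. (1 + r ^ i) / (1 - r ^ i)) \<le> (\<Prod>i=s..m. exp (2 * r ^ i / (1 - r)))"
    using p assms by (intro prod_mono) (auto intro!: divide_nonneg_nonneg simp: power_le_one)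
  also have "\<dots> = exp (2 / (1 - r) * (\<Sum>i=s..m. r ^ i))"
    by (simp add: exp_sum sum_distrib_left)
  also have "(\<Sum>i=s..m. r ^ i) \<le> (\<Sum>i. r ^ Suc i)"
  proof -
    have "(\<Sum>i=s..m. r ^ i) \<le> (\<Sum>i=1..m. r ^ i)"
      using assms by (intro sum_mono2) auto
    also have "\<dots> = (\<Sum>i<m. r ^ Suc i)"
      by (simp add: sum.atLeast1_atMost_eq)
    also have "\<dots> \<le> (\<Sum>i. r ^ Suc i)"
      using assms by (intro sum_le_suminf) (auto intro: summable_mult summable_geometric)
    finally show ?thesis .
  qed
  then have "exp (2 / (1 - r) * (\<Sum>i=s..m. r ^ i)) \<le> exp (2 / (1 - r) * (\<Sum>i. r ^ Suc i))"
    unfolding exp_le_cancel_iff using assms by (intro mult_left_mono) auto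
  also have "(\<Sum>i. r ^ Suc i) = r / (1 - r)"
    using assms suminf_mult[of "\<lambda>i. r ^ i" r] by (simp add: suminf_geometric summable_geometric)
  finally show ?thesis by (simp add: power2_eq_square)
qed

section \<open>Convergence to the infinite product\<close>

lemma op_le_sums:
  fixes q :: complex
  assumes "norm q < 1"
  shows "(\<lambda>n. of_nat (card (overpartitions_le m n)) * q ^ n) sums (\<Prod>i=1..m. (1 + q ^ i) / (1 - q ^ i))"
proof -
  have "ereal (norm q) < fps_conv_radius (op_le_fps m)"
    using op_le_fps_eval(1)[of m] assms by (metis ereal_less(3) less_le_trans)
  from sums_eval_fps[OF this] show ?thesis
    using op_le_fps_eval(2)[OF assms, of m] by (simp add: op_le_fps_def)
qed

lemma op_le_sums_real:
  fixes r :: real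
  assumes "0 \<le> r" "r < 1"
  shows "(\<lambda>n. real (card (overpartitions_le m n)) * r ^ n) sums (\<Prod>i=1..m. (1 + r ^ i) / (1 - r ^ i))"
proof -
  have "(\<lambda>n. complex_of_real (real (card (overpartitions_le m n)) * r ^ n))
          sums complex_of_real (\<Prod>i=1..m. (1 + r ^ i) / (1 - r ^ i))"
    using op_le_sums[of "complex_of_real r" m] assms by simp
  then show ?thesis by (simp only: sums_of_real_iff)
qed

text \<open>Below index m the bound m on the parts is no restriction, so a partial sum of this
  series is dominated by a finite product, and the products are bounded uniformly in m.\<close>

lemma summable_overpartitions:
  fixes r :: real
  assumes "0 \<le> r" "r < 1"
  shows "summable (\<lambda>n. real (overpartitions n) * r ^ n)"
proof (rule summableI_nonneg_bounded)
  fix m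
  have "(\<Sum>n<m. real (overpartitions n) * r ^ n) = (\<Sum>n<m. real (card (overpartitions_le m n)) * r ^ n)"
    by (intro sum.cong) (auto simp: overpartitions_eq[of _ m])
  also have "\<dots> \<le> (\<Sum>n. real (card (overpartitions_le m n)) * r ^ n)"
    using op_le_sums_real[OF assms] assms by (intro sum_le_suminf) (auto simp: sums_iff)
  also have "\<dots> \<le> exp (2 * r / (1 - r)\<^sup>2)"
    using op_le_sums_real[OF assms] prod_quotient_le[OF assms, of 1 m] by (simp add: sums_iff)
  finally show "(\<Sum>n<m. real (overpartitions n) * r ^ n) \<le> exp (2 * r / (1 - r)\<^sup>2)" .
qed (use assms in auto)

definition op_gf :: "complex \<Rightarrow> complex" where
  "op_gf q = (\<Sum>n. of_nat (overpartitions n) * q ^ n)"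

lemma summable_norm_op_gf:
  "norm (q :: complex) < 1 \<Longrightarrow> summable (\<lambda>n. norm (of_nat (overpartitions n) * q ^ n))"
  using summable_overpartitions[of "norm q"] by (simp add: norm_mult norm_power)

lemma op_gf_product:
  assumes "norm q < 1"
  shows "(\<lambda>m. \<Prod>i=1..m. (1 + q ^ i) / (1 - q ^ i)) \<longlonglongrightarrow> op_gf q"
proof -
  have "(\<lambda>m. \<Sum>n. of_nat (card (overpartitions_le m n)) * q ^ n) \<longlonglongrightarrow> op_gf q"
    unfolding op_gf_def
  proof (rule tannery)
    fix n
    have "eventually (\<lambda>m. of_nat (overpartitions n) * q ^ n = of_nat (card (overpartitions_le m n)) * q ^ n) sequentially"
      using eventually_ge_at_top[of n] by eventually_elim (simp add: overpartitions_eq)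
    then show "(\<lambda>m. of_nat (card (overpartitions_le m n)) * q ^ n) \<longlonglongrightarrow> of_nat (overpartitions n) * q ^ n"
      by (rule Lim_transform_eventually[OF tendsto_const])
    show "norm (of_nat (card (overpartitions_le m n)) * q ^ n) \<le> norm (of_nat (overpartitions n) * q ^ n)" for m
      by (simp add: norm_mult mult_right_mono card_overpartitions_le_le)
  qed (rule summable_norm_op_gf[OF assms])
  then show ?thesis using op_le_sums[OF assms] by (simp add: sums_iff)
qed

text \<open>A finite form of Gauss's identity in the style of Shanks: for consecutive \<open>n\<close> the right-hand
  sides differ by a telescoping sum.\<close>

lemma gauss_finite:
  fixes q :: "'a::field"
  assumes nz: "\<And>i. i \<ge> 1 \<Longrightarrow> 1 + q ^ i \<noteq> 0" and two: "(2::'a) \<noteq> 0"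
  shows "1 + 2 * (\<Sum>k=1..n. (-1) ^ k * q ^ k\<^sup>2) =
    2 * (\<Sum>s\<le>n. (-1) ^ s * (\<Prod>i=Suc s..n. (1 - q ^ i) / (1 + q ^ i)) * q ^ (s * Suc n) / (1 + q ^ s))"
proof (induction n)
  case 0
  then show ?case using two by (simp add: field_simps)
next
  case (Suc n)
  define m where "m = Suc n"
  define R where "R = (\<lambda>n s. \<Prod>i=Suc s..n. (1 - q ^ i) / (1 + q ^ i))"
  \<comment> \<open>\<open>V\<close> and \<open>W\<close> split the change of the s-th term when n
    is replaced by m = n + 1. Because \<open>W (Suc s) = V s\<close>, and \<open>W 0 = 0\<close>
    from the factor 1 - q^0, the alternating sum collapses to \<open>V n\<close>, which is
    q^(m^2).\<close>
  define V where "V = (\<lambda>s. q ^ (Suc s * m) * R n s)"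
  define W where "W = (\<lambda>s. q ^ (s * m) * R n s * ((1 - q ^ s) / (1 + q ^ s)))"
  have nz0: "1 + q ^ s \<noteq> 0" for s using nz[of s] two by (cases s) auto
  have m: "1 + q ^ m \<noteq> 0" by (rule nz0)
  have R1: "R m s = R n s * ((1 - q ^ m) / (1 + q ^ m))" if "s \<le> n" for s
    using that unfolding R_def m_def by (subst prod.nat_ivl_Suc') (auto simp: mult.commute)
  have R2: "R n s = R n (Suc s) * ((1 - q ^ Suc s) / (1 + q ^ Suc s))" if "Suc s \<le> n" for s
    using that unfolding R_def by (subst prod.atLeast_Suc_atMost) (auto simp: mult.commute)
  have WV: "W (Suc s) = V s" if "Suc s \<le> n" for s
    unfolding W_def V_def R2[OF that] by (simp only: mult_ac)
  have tele: "(\<Sum>s\<le>k. (-1) ^ s * (W s + V s)) = (-1) ^ k * V k" if "k \<le> n" for k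
    using that
  proof (induction k)
    case 0
    then show ?case by (simp add: W_def)
  next
    case (Suc k)
    then show ?case using WV[of k] by (simp add: algebra_simps)
  qed
  have step: "(-1) ^ s * R m s * q ^ (s * Suc m) / (1 + q ^ s) - (-1) ^ s * R n s * q ^ (s * m) / (1 + q ^ s)
      = - ((-1) ^ s * (W s + V s)) / (1 + q ^ m)" if "s \<le> n" for s
    unfolding R1[OF that] W_def V_def using nz0[of s] m
    by (simp add: divide_simps) (simp add: algebra_simps power_add)
  have "(\<Sum>s\<le>n. (-1) ^ s * R m s * q ^ (s * Suc m) / (1 + q ^ s))
      - (\<Sum>s\<le>n. (-1) ^ s * R n s * q ^ (s * m) / (1 + q ^ s))
      = (\<Sum>s\<le>n. - ((-1) ^ s * (W s + V s)) / (1 + q ^ m))"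
    unfolding sum_subtractf[symmetric] by (intro sum.cong refl step) simp
  also have "\<dots> = - ((-1) ^ n * V n) / (1 + q ^ m)"
    by (simp add: tele[of n, symmetric] sum_divide_distrib sum_negf)
  also have "V n = q ^ m\<^sup>2" by (simp add: V_def R_def m_def power2_eq_square)
  finally have *: "(\<Sum>s\<le>n. (-1) ^ s * R m s * q ^ (s * Suc m) / (1 + q ^ s)) =
    (\<Sum>s\<le>n. (-1) ^ s * R n s * q ^ (s * m) / (1 + q ^ s)) - ((-1) ^ n * q ^ m\<^sup>2) / (1 + q ^ m)"
    by (simp add: algebra_simps)
  have R0: "R m m = 1" by (simp add: R_def)
  have e: "m * Suc m = m\<^sup>2 + m" by (simp add: power2_eq_square)
  have "2 * (\<Sum>s\<le>m. (-1) ^ s * R m s * q ^ (s * Suc m) / (1 + q ^ s)) =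
     2 * (\<Sum>s\<le>n. (-1) ^ s * R n s * q ^ (s * m) / (1 + q ^ s))
       + 2 * (((-1) ^ m * q ^ m\<^sup>2 + (-1) ^ m * q ^ (m * Suc m)) / (1 + q ^ m))"
    unfolding m_def sum.atMost_Suc unfolding m_def[symmetric] * R0
    by (simp add: m_def[symmetric] add_divide_distrib) (simp add: m_def algebra_simps)
  also have "((-1) ^ m * q ^ m\<^sup>2 + (-1) ^ m * q ^ (m * Suc m)) / (1 + q ^ m) = (-1) ^ m * q ^ m\<^sup>2"
    unfolding e using m by (simp add: field_simps power_add)
  also have "2 * (\<Sum>s\<le>n. (-1) ^ s * R n s * q ^ (s * m) / (1 + q ^ s)) + 2 * ((-1) ^ m * q ^ m\<^sup>2)
     = 1 + 2 * (\<Sum>k=1..m. (-1) ^ k * q ^ k\<^sup>2)"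
  proof -
    have IH: "1 + 2 * (\<Sum>k=1..n. (-1) ^ k * q ^ k\<^sup>2) = 2 * (\<Sum>s\<le>n. (-1) ^ s * R n s * q ^ (s * m) / (1 + q ^ s))"
      using Suc by (simp only: R_def m_def)
    have S: "(\<Sum>k=1..m. (-1) ^ k * q ^ k\<^sup>2) = (\<Sum>k=1..n. (-1) ^ k * q ^ k\<^sup>2) + (-1) ^ m * q ^ m\<^sup>2"
      by (simp add: m_def)
    show ?thesis unfolding S IH[symmetric] by (simp only: distrib_left add.assoc)
  qed
  finally show ?case by (simp only: R_def m_def)
qed

section \<open>Gauss's identity for the theta function\<close>

definition theta4 :: "complex \<Rightarrow> complex" where
  "theta4 q = 1 + 2 * (\<Sum>k. (-1) ^ Suc k * q ^ (Suc k)\<^sup>2)"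

lemma summable_norm_theta4:
  fixes q :: complex
  assumes "norm q < 1"
  shows "summable (\<lambda>k. norm ((-1) ^ Suc k * q ^ (Suc k)\<^sup>2))"
proof (rule summable_comparison_test)
  show "\<exists>N. \<forall>n\<ge>N. norm (norm ((-1) ^ Suc n * q ^ (Suc n)\<^sup>2)) \<le> norm q ^ n"
  proof (intro exI allI impI)
    fix n :: nat
    have "norm q ^ (Suc n)\<^sup>2 \<le> norm q ^ n"
      using assms by (intro power_decreasing) (auto simp: power2_eq_square)
    then show "norm (norm ((-1) ^ Suc n * q ^ (Suc n)\<^sup>2)) \<le> norm q ^ n"
      by (simp add: norm_mult norm_power del: power_Suc)
  qed
  show "summable (\<lambda>n. norm q ^ n)" using assms by (simp add: summable_geometric)
qed

text \<open>In \<open>gauss_finite\<close> the term s = 0 is exactly the partial product, because 2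
  / (1 + q^0) = 1. Each of the other n terms is bounded by a constant times r^n with r =
  \<open>norm q\<close>, so together they vanish like n r^n.\<close>

lemma theta4_product:
  assumes q: "norm q < 1"
  shows "(\<lambda>n. \<Prod>i=1..n. (1 - q ^ i) / (1 + q ^ i)) \<longlonglongrightarrow> theta4 q"
proof -
  define r where "r = norm q"
  define C where "C = exp (2 * r / (1 - r)\<^sup>2)"
  define f where "f = (\<lambda>n s. (-1) ^ s * (\<Prod>i=Suc s..n. (1 - q ^ i) / (1 + q ^ i)) * q ^ (s * Suc n) / (1 + q ^ s))"
  have r: "0 \<le> r" "r < 1" using q by (auto simp: r_def)
  have ri: "r ^ i \<le> r" if "i \<ge> 1" for i
    using that r power_decreasing[of 1 i r] by simp
  have low: "1 - r ^ i \<le> norm (1 + q ^ i)" for i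
    using norm_diff_ineq[of 1 "q ^ i"] by (simp add: r_def norm_power)
  have up: "norm (1 - q ^ i) \<le> 1 + r ^ i" for i
    using norm_triangle_ineq4[of 1 "q ^ i"] by (simp add: r_def norm_power)
  have nz: "1 + q ^ i \<noteq> 0" if "i \<ge> 1" for i
    using low[of i] ri[OF that] r by auto
  have "norm (\<Prod>i=Suc s..n. (1 - q ^ i) / (1 + q ^ i)) \<le> C" for n s
  proof -
    have "norm (\<Prod>i=Suc s..n. (1 - q ^ i) / (1 + q ^ i)) \<le> (\<Prod>i=Suc s..n. (1 + r ^ i) / (1 - r ^ i))"
      unfolding prod_norm[symmetric] norm_divide
      using low up r by (intro prod_mono conjI frac_le) (auto simp: power_less_one_iff)
    also have "\<dots> \<le> C" unfolding C_def by (rule prod_quotient_le) (use r in auto)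
    finally show ?thesis .
  qed note R = this
  have fb: "norm (f n s) \<le> C / (1 - r) * r ^ n" if "s \<ge> 1" for n s
  proof -
    have "norm (f n s) = norm (\<Prod>i=Suc s..n. (1 - q ^ i) / (1 + q ^ i)) * r ^ (s * Suc n) / norm (1 + q ^ s)"
      by (simp add: f_def norm_mult norm_divide norm_power r_def del: power_Suc)
    also have "\<dots> \<le> C * r ^ n / (1 - r)"
    proof (intro frac_le mult_mono R)
      show "r ^ (s * Suc n) \<le> r ^ n" using r mult_le_mono[OF that, of n "Suc n"] by (intro power_decreasing) simp_all
      show "1 - r \<le> norm (1 + q ^ s)" using low[of s] ri[OF that] by linarith
    qed (use r in \<open>auto simp: C_def\<close>)
    finally show ?thesis by (simp add: algebra_simps)
  qed
  have "(\<lambda>n. \<Sum>s=1..n. f n s) \<longlonglongrightarrow> 0"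
  proof (rule Lim_null_comparison)
    show "eventually (\<lambda>n. norm (\<Sum>s=1..n. f n s) \<le> C / (1 - r) * (real n * r ^ n)) sequentially"
    proof (rule always_eventually, rule allI)
      fix n
      have "norm (\<Sum>s=1..n. f n s) \<le> (\<Sum>s=1..n. C / (1 - r) * r ^ n)"
        by (intro sum_norm_le fb) auto
      also have "\<dots> = C / (1 - r) * (real n * r ^ n)" by simp
      finally show "norm (\<Sum>s=1..n. f n s) \<le> C / (1 - r) * (real n * r ^ n)" .
    qed
    show "(\<lambda>n. C / (1 - r) * (real n * r ^ n)) \<longlonglongrightarrow> 0"
      by (rule tendsto_mult_right_zero) (use powser_times_n_limit_0[of r] r in auto)
  qed
  moreover have "(\<lambda>n. 1 + 2 * (\<Sum>k=1..n. (-1) ^ k * q ^ k\<^sup>2)) \<longlonglongrightarrow> theta4 q"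
  proof -
    have "(\<lambda>n. \<Sum>k<n. (-1) ^ Suc k * q ^ (Suc k)\<^sup>2) \<longlonglongrightarrow> (\<Sum>k. (-1) ^ Suc k * q ^ (Suc k)\<^sup>2)"
      by (rule summable_LIMSEQ[OF summable_norm_cancel[OF summable_norm_theta4[OF q]]])
    moreover have "(\<Sum>k=1..n. (-1) ^ k * q ^ k\<^sup>2) = (\<Sum>k<n. (-1) ^ Suc k * q ^ (Suc k)\<^sup>2)" for n
      by (rule sum.reindex_bij_witness[of _ Suc "\<lambda>k. k - 1"]) auto
    ultimately show ?thesis unfolding theta4_def by (simp only:) (intro tendsto_intros)
  qed
  ultimately have "(\<lambda>n. 1 + 2 * (\<Sum>k=1..n. (-1) ^ k * q ^ k\<^sup>2) - 2 * (\<Sum>s=1..n. f n s)) \<longlonglongrightarrow> theta4 q - 2 * 0"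
    by (intro tendsto_intros)
  moreover have "1 + 2 * (\<Sum>k=1..n. (-1) ^ k * q ^ k\<^sup>2) - 2 * (\<Sum>s=1..n. f n s)
      = (\<Prod>i=1..n. (1 - q ^ i) / (1 + q ^ i))" for n
  proof -
    have "1 + 2 * (\<Sum>k=1..n. (-1) ^ k * q ^ k\<^sup>2) = 2 * (\<Sum>s\<le>n. f n s)"
      unfolding f_def by (rule gauss_finite) (use nz in auto)
    also have "(\<Sum>s\<le>n. f n s) = f n 0 + (\<Sum>s=1..n. f n s)"
      by (simp add: atMost_atLeast0 sum.atLeast_Suc_atMost)
    finally show ?thesis by (simp add: f_def)
  qed
  ultimately show ?thesis by simp
qed

theorem op_gf_theta4:
  assumes "norm q < 1"
  shows "op_gf q * theta4 q = 1"
proof -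
  have nz: "1 + q ^ i \<noteq> 0" "1 - q ^ i \<noteq> 0" if "i \<ge> 1" for i
  proof -
    have "norm (q ^ i) < 1" using that assms by (simp add: norm_power power_less_one_iff)
    then show "1 + q ^ i \<noteq> 0" "1 - q ^ i \<noteq> 0"
      by (auto simp: add_eq_0_iff norm_minus_commute dest: arg_cong[of _ _ norm])
  qed
  have "(\<lambda>n. (\<Prod>i=1..n. (1 + q ^ i) / (1 - q ^ i)) * (\<Prod>i=1..n. (1 - q ^ i) / (1 + q ^ i)))
      \<longlonglongrightarrow> op_gf q * theta4 q"
    by (intro tendsto_mult op_gf_product theta4_product assms)
  moreover have "(\<Prod>i=1..n. (1 + q ^ i) / (1 - q ^ i)) * (\<Prod>i=1..n. (1 - q ^ i) / (1 + q ^ i)) = 1" for n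
    unfolding prod.distrib[symmetric] by (rule prod.neutral) (use nz in auto)
  ultimately show ?thesis using LIMSEQ_unique[OF _ tendsto_const] by auto
qed


section \<open>The recurrence with square shifts\<close>

definition theta4_coeff :: "nat \<Rightarrow> complex" where
  "theta4_coeff n = (if n = 0 then 1 else if \<exists>k. n = k\<^sup>2 then 2 * (-1) ^ n else 0)"

lemma theta4_coeff_sums:
  assumes "norm q < 1"
  shows "(\<lambda>n. theta4_coeff n * q ^ n) sums theta4 q"
proof -
  define g where "g = (\<lambda>k::nat. (Suc k)\<^sup>2)"
  define f where "f = (\<lambda>n. (if n = 0 then 0 else theta4_coeff n) * q ^ n)"
  have "(\<lambda>k. 2 * ((-1) ^ Suc k * q ^ (Suc k)\<^sup>2)) sums (2 * (\<Sum>k. (-1) ^ Suc k * q ^ (Suc k)\<^sup>2))"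
    by (rule sums_mult[OF summable_sums[OF summable_norm_cancel[OF summable_norm_theta4[OF assms]]]])
  also have "(\<lambda>k. 2 * ((-1) ^ Suc k * q ^ (Suc k)\<^sup>2)) = (\<lambda>k. f (g k))"
  proof
    fix k :: nat
    have "\<exists>j. (Suc k)\<^sup>2 = j\<^sup>2" by blast
    moreover have "(-1 :: complex) ^ (Suc k)\<^sup>2 = (-1) ^ Suc k"
      by (cases "even k") simp_all
    ultimately show "2 * ((-1) ^ Suc k * q ^ (Suc k)\<^sup>2) = f (g k)"
      by (simp add: f_def g_def theta4_coeff_def del: power_Suc)
  qed
  also have "(\<lambda>k. f (g k)) sums (2 * (\<Sum>k. (-1) ^ Suc k * q ^ (Suc k)\<^sup>2)) \<longleftrightarrow> f sums (2 * (\<Sum>k. (-1) ^ Suc k * q ^ (Suc k)\<^sup>2))"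
  proof (rule sums_mono_reindex)
    show "strict_mono g" by (auto simp: strict_mono_Suc_iff g_def power2_eq_square)
    fix n assume n: "n \<notin> range g"
    have "\<not> (\<exists>k. n = k\<^sup>2)" if "n \<noteq> 0"
    proof
      assume "\<exists>k. n = k\<^sup>2"
      then obtain k where "n = k\<^sup>2" by blast
      then have "n = g (k - 1)" using that by (cases k) (auto simp: g_def)
      then show False using n by blast
    qed
    then show "f n = 0" by (auto simp: f_def theta4_coeff_def)
  qed
  finally have "(\<lambda>n. (if n = 0 then 1 else 0) + f n) sums (1 + 2 * (\<Sum>k. (-1) ^ Suc k * q ^ (Suc k)\<^sup>2))"
    by (intro sums_add) (use sums_single[of 0 "\<lambda>_. 1::complex"] in simp_all)
  also have "(\<lambda>n. (if n = 0 then 1 else 0) + f n) = (\<lambda>n. theta4_coeff n * q ^ n)"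
    by (auto simp: f_def theta4_coeff_def)
  finally show ?thesis by (simp add: theta4_def)
qed

text \<open>\<open>op_gf_theta4\<close> is an identity of functions on the unit disc. Agreement near
  0 turns it into an identity of formal power series, whose coefficients can be compared.\<close>

lemma theta4_convolution:
  assumes "n > 0"
  shows "(\<Sum>i=0..n. of_nat (overpartitions i) * theta4_coeff (n - i)) = 0"
proof -
  define T where "T = Abs_fps theta4_coeff"
  have radius: "fps_conv_radius f \<ge> 1" if "\<And>q. norm q < 1 \<Longrightarrow> summable (\<lambda>n. f $ n * q ^ n)" for f :: "complex fps"
    unfolding fps_conv_radius_def by (rule conv_radius_geI_ex') (use that in auto)
  have r: "fps_conv_radius op_fps \<ge> 1" "fps_conv_radius T \<ge> 1"
    by (rule radius, use summable_norm_op_gf[THEN summable_norm_cancel] sums_summable[OF theta4_coeff_sums]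
          in \<open>simp add: op_fps_def T_def\<close>)+
  have lt: "ereal (norm q) < R" if "1 \<le> R" "norm q < 1" for R and q :: complex
    using that by (metis ereal_less(3) less_le_trans)
  have "op_fps * T = 1"
  proof (rule eval_fps_eqD)
    have "1 \<le> fps_conv_radius (op_fps * T)"
      using fps_conv_radius_mult[of op_fps T] r by (meson min.boundedI order_trans)
    then show "0 < fps_conv_radius (op_fps * T)" using less_le_trans[of 0 "1::ereal"] by simp
    have "eval_fps (op_fps * T) q = eval_fps 1 q" if "q \<in> ball 0 1" for q
    proof -
      have q: "norm q < 1" using that by simp
      have "eval_fps (op_fps * T) q = eval_fps op_fps q * eval_fps T q"
        by (rule eval_fps_mult) (use lt[OF r(1) q] lt[OF r(2) q] in auto)
      also have "\<dots> = op_gf q * theta4 q"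
        using theta4_coeff_sums[OF q] by (simp add: eval_fps_def op_fps_def T_def op_gf_def sums_iff)
      finally show ?thesis by (simp add: op_gf_theta4[OF q])
    qed
    moreover have "eventually (\<lambda>q::complex. q \<in> ball 0 1) (nhds 0)"
      by (intro eventually_nhds_in_open) auto
    ultimately show "eventually (\<lambda>q. eval_fps (op_fps * T) q = eval_fps 1 q) (nhds 0)"
      by (auto elim: eventually_mono)
  qed auto
  then have "(op_fps * T) $ n = 0" using assms by simp
  then show ?thesis by (simp add: fps_mult_nth op_fps_def T_def)
qed

theorem overpartitions_recurrence:
  assumes "n > 0"
  shows "int (overpartitions n) = 2 * (\<Sum>k | k \<ge> 1 \<and> k\<^sup>2 \<le> n. (-1) ^ Suc k * int (overpartitions (n - k\<^sup>2)))"
proof -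
  define K where "K = {k::nat. k \<ge> 1 \<and> k\<^sup>2 \<le> n}"
  have fin: "finite K"
    by (rule finite_subset[of _ "{..n}"]) (auto simp: K_def dest: power2_nat_le_imp_le)
  have "0 = (\<Sum>i=0..n. of_nat (overpartitions i) * theta4_coeff (n - i))"
    using theta4_convolution[OF assms] by simp
  also have "\<dots> = (\<Sum>i=0..n. of_nat (overpartitions (n - i)) * theta4_coeff i)"
    by (rule sum.reindex_bij_witness[of _ "\<lambda>i. n - i" "\<lambda>i. n - i"]) auto
  also have "\<dots> = of_nat (overpartitions n) + (\<Sum>i=1..n. of_nat (overpartitions (n - i)) * theta4_coeff i)"
    by (simp add: sum.atLeast_Suc_atMost theta4_coeff_def)
  also have "(\<Sum>i=1..n. of_nat (overpartitions (n - i)) * theta4_coeff i)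
      = (\<Sum>i\<in>(\<lambda>k. k\<^sup>2) ` K. of_nat (overpartitions (n - i)) * theta4_coeff i)"
  proof (rule sum.mono_neutral_right)
    show "(\<lambda>k. k\<^sup>2) ` K \<subseteq> {1..n}"
      by (auto simp: K_def Suc_le_eq)
    show "\<forall>i\<in>{1..n} - (\<lambda>k. k\<^sup>2) ` K. of_nat (overpartitions (n - i)) * theta4_coeff i = 0"
    proof
      fix i assume i: "i \<in> {1..n} - (\<lambda>k. k\<^sup>2) ` K"
      have False if "i = k\<^sup>2" for k
      proof -
        have "k \<noteq> 0" using that i by (intro notI) simp
        then have "k \<in> K" using that i by (simp add: K_def)
        then show False using that i by blast
      qed
      then have "theta4_coeff i = 0" using i by (auto simp: theta4_coeff_def)
      then show "of_nat (overpartitions (n - i)) * theta4_coeff i = 0" by simp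
    qed
  qed simp
  also have "\<dots> = (\<Sum>k\<in>K. of_nat (overpartitions (n - k\<^sup>2)) * theta4_coeff (k\<^sup>2))"
    by (subst sum.reindex) (auto simp: inj_on_def)
  also have "\<dots> = (\<Sum>k\<in>K. - 2 * ((-1) ^ Suc k * of_nat (overpartitions (n - k\<^sup>2))))"
  proof (rule sum.cong)
    fix k assume k: "k \<in> K"
    have "(-1 :: complex) ^ k\<^sup>2 = (-1) ^ k" by (cases "even k") simp_all
    then have "theta4_coeff (k\<^sup>2) = 2 * (-1) ^ k"
      using k by (auto simp: theta4_coeff_def K_def)
    then show "of_nat (overpartitions (n - k\<^sup>2)) * theta4_coeff (k\<^sup>2)
      = - 2 * ((-1) ^ Suc k * of_nat (overpartitions (n - k\<^sup>2)))" by simp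
  qed simp
  also have "\<dots> = - 2 * (\<Sum>k\<in>K. (-1) ^ Suc k * of_nat (overpartitions (n - k\<^sup>2)))"
    by (simp add: sum_distrib_left)
  finally have "of_int (int (overpartitions n)) =
      (of_int (2 * (\<Sum>k\<in>K. (-1) ^ Suc k * int (overpartitions (n - k\<^sup>2)))) :: complex)"
    by simp
  then show ?thesis unfolding of_int_eq_iff K_def .
qed

section \<open>The transformation formula of the theta function\<close>

lemma double_cos_power:
  "(2 * cos x) ^ (2 * m) = (\<Sum>k\<le>2 * m. real (2 * m choose k) * cos ((2 * real k - 2 * real m) * x))"
proof -
  have "complex_of_real ((2 * cos x) ^ (2 * m)) = (cis x + cis (- x)) ^ (2 * m)"
    by (simp add: complex_eq_iff flip: of_real_power)
  also have "\<dots> = (\<Sum>k\<le>2 * m. of_nat (2 * m choose k) * cis x ^ k * cis (- x) ^ (2 * m - k))"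
    by (rule binomial_ring)
  also have "\<dots> = (\<Sum>k\<le>2 * m. of_nat (2 * m choose k) * cis ((2 * real k - 2 * real m) * x))"
  proof (rule sum.cong)
    fix k assume "k \<in> {..2 * m}"
    then have ang: "real k * x + real (2 * m - k) * - x = (2 * real k - 2 * real m) * x"
      by (simp add: of_nat_diff algebra_simps)
    have "cis x ^ k * cis (- x) ^ (2 * m - k) = cis (real k * x + real (2 * m - k) * - x)"
      unfolding cis_mult[symmetric] Complex.DeMoivre[symmetric] ..
    then have "cis x ^ k * cis (- x) ^ (2 * m - k) = cis ((2 * real k - 2 * real m) * x)"
      unfolding ang .
    then show "of_nat (2 * m choose k) * cis x ^ k * cis (- x) ^ (2 * m - k)
        = of_nat (2 * m choose k) * cis ((2 * real k - 2 * real m) * x)" by (simp only: mult.assoc)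
  qed simp
  finally have "Re (complex_of_real ((2 * cos x) ^ (2 * m))) = Re \<dots>" by simp
  then show ?thesis by (simp only: Re_complex_of_real Re_sum) (simp add: Re_sum)
qed

text \<open>Multiplied by sin a with a = pi d / l, the sum telescopes to sin (2 l a) / 2 = sin (2 pi
  d) / 2 = 0, and sin a is nonzero unless \<open>l\<close> divides \<open>d\<close>. As a filter on
  the binomial expansion it keeps every l-th term and, as the multiples of a are odd, gives these
  terms alternating signs.\<close>

lemma sum_cos_odd_multiples:
  assumes l: "l > 0"
  shows "(\<Sum>j<l. cos (pi * (2 * real j + 1) * real d / real l)) = (if l dvd d then real l * (-1) ^ (d div l) else 0)"
proof (cases "l dvd d")
  case True
  then obtain v where v: "d = l * v" by blast
  have "cos (pi * (2 * real j + 1) * real d / real l) = (-1) ^ v" for j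
  proof -
    have "pi * (2 * real j + 1) * real d / real l = real ((2 * j + 1) * v) * pi"
      using l by (simp add: v field_simps)
    then have "cos (pi * (2 * real j + 1) * real d / real l) = (-1) ^ ((2 * j + 1) * v)"
      by (simp only: cos_npi)
    then show ?thesis by (simp add: power_add power_mult mult.assoc)
  qed
  then show ?thesis using l v by simp
next
  case False
  define a where "a = pi * real d / real l"
  have "sin a * (\<Sum>j<n. cos ((2 * real j + 1) * a)) = sin (2 * real n * a) / 2" for n
  proof (induction n)
    case (Suc n)
    have "2 * (sin a * cos ((2 * real n + 1) * a)) = sin (a + (2 * real n + 1) * a) + sin (a - (2 * real n + 1) * a)"
      by (simp add: sin_add sin_diff)
    also have "a + (2 * real n + 1) * a = 2 * real (Suc n) * a" by (simp add: algebra_simps)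
    also have "a - (2 * real n + 1) * a = - (2 * real n * a)" by (simp add: algebra_simps)
    finally show ?case using Suc by (simp add: distrib_left)
  qed simp
  from this[of l] have "sin a * (\<Sum>j<l. cos ((2 * real j + 1) * a)) = sin (2 * pi * real d) / 2"
    using l by (simp add: a_def mult_ac)
  also have "sin (2 * pi * real d) = 0"
    using sin_npi2[of "2 * d"] by (simp add: mult_ac)
  finally have "sin a * (\<Sum>j<l. cos ((2 * real j + 1) * a)) = 0" by simp
  moreover have "sin a \<noteq> 0"
  proof
    assume "sin a = 0"
    then obtain i :: int where "a = of_int i * pi" by (auto simp: sin_zero_iff_int2)
    then have "real d = of_int (i * int l)" using l by (simp add: a_def field_simps)
    then have "int d = i * int l" by linarith
    then have "l dvd d" using dvd_triv_right[of "int l" i] int_dvd_int_iff by metis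
    then show False using False by simp
  qed
  ultimately have "(\<Sum>j<l. cos ((2 * real j + 1) * a)) = 0" by simp
  also have "(\<Sum>j<l. cos ((2 * real j + 1) * a)) = (\<Sum>j<l. cos (pi * (2 * real j + 1) * real d / real l))"
    by (intro sum.cong) (auto simp: a_def mult_ac)
  finally show ?thesis using False by simp
qed

lemma sum_centred:
  fixes g :: "nat \<Rightarrow> real"
  assumes "\<And>k. k \<le> 2 * m \<Longrightarrow> g (2 * m - k) = g k"
  shows "(\<Sum>k\<le>2 * m. g k) = g m + 2 * (\<Sum>d=1..m. g (m + d))"
proof -
  have "{..2 * m} = {..<m} \<union> {m} \<union> {Suc m..2 * m}" by auto
  then have "(\<Sum>k\<le>2 * m. g k) = (\<Sum>k<m. g k) + g m + (\<Sum>k=Suc m..2 * m. g k)"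
  proof (simp only:)
    have "sum g ({..<m} \<union> {m} \<union> {Suc m..2 * m}) = sum g ({..<m} \<union> {m}) + sum g {Suc m..2 * m}"
      by (rule sum.union_disjoint) auto
    also have "sum g ({..<m} \<union> {m}) = sum g {..<m} + g m"
      by (rule trans[OF sum.union_disjoint]) auto
    finally show "sum g ({..<m} \<union> {m} \<union> {Suc m..2 * m}) = sum g {..<m} + g m + sum g {Suc m..2 * m}" .
  qed
  also have "(\<Sum>k<m. g k) = (\<Sum>d=1..m. g (m + d))"
  proof (rule sum.reindex_bij_witness[of _ "\<lambda>d. m - d" "\<lambda>k. m - k"])
    fix k assume k: "k \<in> {..<m}"
    then have "m + (m - k) = 2 * m - k" by simp
    then show "g (m + (m - k)) = g k" using assms[of k] k by simp
  qed auto
  also have "(\<Sum>k=Suc m..2 * m. g k) = (\<Sum>d=1..m. g (m + d))"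
    by (rule sum.reindex_bij_witness[of _ "\<lambda>d. m + d" "\<lambda>k. k - m"]) auto
  finally show ?thesis by simp
qed

text \<open>Polya's finite form of the theta transformation formula: both sides sum
  \<^term>\<open>(z + 1 / z) ^ (2 * m)\<close> over the roots of \<open>z\<^sup>2\<^sup>l = -1\<close>,
  taken modulo sign.\<close>

lemma polya_finite:
  assumes l: "l > 0"
  shows "(\<Sum>j<l. cos (pi * (2 * real j + 1) / (2 * real l)) ^ (2 * m)) =
    real l / 4 ^ m * (real (2 * m choose m) + 2 * (\<Sum>v=1..m. (-1) ^ v * real (2 * m choose (m + l * v))))"
proof -
  define c where "c = (\<lambda>d. if l dvd d then real l * (-1) ^ (d div l) else 0)"
  \<comment> \<open>\<open>e k\<close> is the distance of k from m. The cosine is even, so only this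
    distance enters the inner sum over the angles.\<close>
  define e where "e = (\<lambda>k. if k \<le> m then m - k else k - m)"
  have ed: "e (m + d) = d" for d by (auto simp: e_def)
  have ang: "(\<Sum>j<l. cos ((2 * real k - 2 * real m) * (pi * (2 * real j + 1) / (2 * real l)))) = c (e k)" for k
  proof -
    have "cos ((2 * real k - 2 * real m) * (pi * (2 * real j + 1) / (2 * real l)))
        = cos (pi * (2 * real j + 1) * real (e k) / real l)" for j
    proof (cases "k \<le> m")
      case True
      have "(2 * real k - 2 * real m) * (pi * (2 * real j + 1) / (2 * real l)) = - (pi * (2 * real j + 1) * real (e k) / real l)"
        using True l by (simp add: e_def of_nat_diff field_simps)
      then show ?thesis by (simp only: cos_minus)
    next
      case False
      have "(2 * real k - 2 * real m) * (pi * (2 * real j + 1) / (2 * real l)) = pi * (2 * real j + 1) * real (e k) / real l"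
        using False l by (simp add: e_def of_nat_diff field_simps)
      then show ?thesis by simp
    qed
    then show ?thesis using sum_cos_odd_multiples[OF l, of "e k"] by (simp add: c_def)
  qed
  have "4 ^ m * (\<Sum>j<l. cos (pi * (2 * real j + 1) / (2 * real l)) ^ (2 * m))
      = (\<Sum>j<l. (2 * cos (pi * (2 * real j + 1) / (2 * real l))) ^ (2 * m))"
    by (simp add: sum_distrib_left power_mult_distrib power_mult)
  also have "\<dots> = (\<Sum>k\<le>2 * m. \<Sum>j<l. real (2 * m choose k) * cos ((2 * real k - 2 * real m) * (pi * (2 * real j + 1) / (2 * real l))))"
    unfolding double_cos_power by (rule sum.swap)
  also have "\<dots> = (\<Sum>k\<le>2 * m. real (2 * m choose k) * c (e k))"
    unfolding sum_distrib_left[symmetric] ang ..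
  also have "\<dots> = real (2 * m choose m) * c (e m) + 2 * (\<Sum>d=1..m. real (2 * m choose (m + d)) * c (e (m + d)))"
  proof (rule sum_centred)
    fix k assume k: "k \<le> 2 * m"
    then have "e (2 * m - k) = e k" by (auto simp: e_def)
    then show "real (2 * m choose (2 * m - k)) * c (e (2 * m - k)) = real (2 * m choose k) * c (e k)"
      using binomial_symmetric[OF k] by simp
  qed
  \<comment> \<open>Only distances divisible by l contribute. Letting v run up to m is harmless: if
    l v exceeds m, the binomial coefficient is 0.\<close>
  also have "(\<Sum>d=1..m. real (2 * m choose (m + d)) * c (e (m + d))) =
      (\<Sum>d\<in>(\<lambda>v. l * v) ` {1..m}. real (2 * m choose (m + d)) * c d)"
  proof (rule sum.mono_neutral_cong)
    fix d assume d: "d \<in> {1..m} - (\<lambda>v. l * v) ` {1..m}"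
    have "\<not> l dvd d"
    proof
      assume "l dvd d"
      then obtain v where v: "d = l * v" by blast
      then have "v \<le> d" using l by (cases l) auto
      then have "v \<in> {1..m}" using d v by (cases v) auto
      then show False using d v by auto
    qed
    then show "real (2 * m choose (m + d)) * c (e (m + d)) = 0" by (simp add: ed c_def)
  next
    fix d assume "d \<in> (\<lambda>v. l * v) ` {1..m} - {1..m}"
    then have "m + d > 2 * m" using l by auto
    then show "real (2 * m choose (m + d)) * c d = 0" by (simp add: binomial_eq_0)
  qed (auto simp: ed)
  also have "\<dots> = (\<Sum>v=1..m. real (2 * m choose (m + l * v)) * (real l * (-1) ^ v))"
    using l by (subst sum.reindex) (auto simp: inj_on_def c_def)
  finally have "4 ^ m * (\<Sum>j<l. cos (pi * (2 * real j + 1) / (2 * real l)) ^ (2 * m)) =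
    real l * (real (2 * m choose m) + 2 * (\<Sum>v=1..m. (-1) ^ v * real (2 * m choose (m + l * v))))"
    using l by (simp add: c_def e_def sum_distrib_left distrib_left mult_ac)
  then show ?thesis by (simp add: field_simps)
qed

section \<open>Gaussian limits of binomial coefficients and of powers of the cosine\<close>

lemma one_minus_ge_exp:
  fixes u :: real
  assumes "u < 1"
  shows "exp (- u / (1 - u)) \<le> 1 - u"
proof -
  have "1 / (1 - u) \<le> exp (u / (1 - u))"
    using exp_ge_add_one_self[of "u / (1 - u)"] assms by (simp add: field_simps)
  then show ?thesis using assms by (simp add: exp_minus field_simps)
qed

lemma central_ratio_Suc:
  assumes "k < m"
  shows "real (2 * m choose (m + Suc k)) = real (2 * m choose (m + k)) * ((real m - real k) / (real m + real k + 1))"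
proof -
  obtain i where i: "m = Suc (k + i)" using assms less_imp_Suc_add by blast
  have e: "2 * m - (m + Suc k) = i" "2 * m - (m + k) = Suc i" using i by auto
  have A: "real (2 * m choose (m + Suc k)) = fact (2 * m) / (fact (m + Suc k) * fact i)"
    using binomial_fact[of "m + Suc k" "2 * m", where 'a = real] e assms by simp
  have B: "real (2 * m choose (m + k)) = fact (2 * m) / (fact (m + k) * fact (Suc i))"
    using binomial_fact[of "m + k" "2 * m", where 'a = real] e assms by simp
  have C: "fact (m + Suc k) = (real m + real k + 1) * fact (m + k)" "fact (Suc i) = (real i + 1) * fact i"
    by (simp_all add: algebra_simps)
  have D: "real m - real k = real i + 1" using i by simp
  have "real m + real k + 1 \<noteq> 0" "real i + 1 \<noteq> 0" by linarith+
  then show ?thesis unfolding A B C D by (simp add: divide_simps)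
qed

text \<open>Consecutive coefficients have quotient 1 - (2k+1) / (m+k+1), at most exp (- (2k+1) /
  (m+K)) as long as k < K, and the odd numbers 2i+1 with i < k add up to k^2. The extra
  \<open>K\<close> fixes one denominator for the whole induction.\<close>

lemma central_ratio_upper:
  assumes "k \<le> K" "K \<le> m"
  shows "real (2 * m choose (m + k)) \<le> real (2 * m choose m) * exp (- (real k)\<^sup>2 / (real m + real K))"
  using assms(1)
proof (induction k)
  case (Suc k)
  have km: "k < m" using Suc assms by auto
  have "(real m - real k) / (real m + real k + 1) = 1 + - (2 * real k + 1) / (real m + real k + 1)"
    by (simp add: field_simps)
  also have "\<dots> \<le> exp (- (2 * real k + 1) / (real m + real k + 1))"
    by (rule exp_ge_add_one_self)
  also have "(2 * real k + 1) / (real m + real K) \<le> (2 * real k + 1) / (real m + real k + 1)"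
    using Suc km by (intro divide_left_mono) auto
  then have "exp (- (2 * real k + 1) / (real m + real k + 1)) \<le> exp (- (2 * real k + 1) / (real m + real K))"
    unfolding exp_le_cancel_iff minus_divide_left[symmetric] neg_le_iff_le .
  finally have 1: "(real m - real k) / (real m + real k + 1) \<le> exp (- (2 * real k + 1) / (real m + real K))" .
  have "real (2 * m choose (m + Suc k)) \<le> real (2 * m choose m) * exp (- (real k)\<^sup>2 / (real m + real K))
       * exp (- (2 * real k + 1) / (real m + real K))"
    unfolding central_ratio_Suc[OF km] using Suc km by (intro mult_mono 1) auto
  also have "\<dots> = real (2 * m choose m) * exp (- (real (Suc k))\<^sup>2 / (real m + real K))"
    unfolding mult.assoc exp_add[symmetric] by (simp add: power2_eq_square field_simps add_divide_distrib[symmetric])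
  finally show ?case .
qed simp

text \<open>As in the upper bound, with \<open>one_minus_ge_exp\<close> for the quotient 1 - u: here
  u / (1 - u) = (2k+1) / (m-k), whose denominator is at least m - K + 1.\<close>

lemma central_ratio_lower:
  assumes "k \<le> K" "K \<le> m"
  shows "real (2 * m choose (m + k)) \<ge> real (2 * m choose m) * exp (- (real k)\<^sup>2 / (real m - real K + 1))"
  using assms(1)
proof (induction k)
  case (Suc k)
  have km: "k < m" using Suc assms by auto
  define u where "u = (2 * real k + 1) / (real m + real k + 1)"
  have u: "(real m - real k) / (real m + real k + 1) = 1 - u"
    by (simp add: u_def field_simps)
  have "u / (1 - u) = (2 * real k + 1) / (real m - real k)"
    unfolding u[symmetric] using km by (simp add: u_def)
  also have "\<dots> \<le> (2 * real k + 1) / (real m - real K + 1)"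
    using Suc km assms by (intro divide_left_mono) auto
  finally have "exp (- (2 * real k + 1) / (real m - real K + 1)) \<le> exp (- u / (1 - u))"
    unfolding exp_le_cancel_iff minus_divide_left[symmetric] neg_le_iff_le .
  also have "\<dots> \<le> (real m - real k) / (real m + real k + 1)"
    unfolding u using km by (intro one_minus_ge_exp) (simp add: u_def)
  finally have 1: "(real m - real k) / (real m + real k + 1) \<ge> exp (- (2 * real k + 1) / (real m - real K + 1))" .
  have "real (2 * m choose m) * exp (- (real (Suc k))\<^sup>2 / (real m - real K + 1)) =
    real (2 * m choose m) * exp (- (real k)\<^sup>2 / (real m - real K + 1)) * exp (- (2 * real k + 1) / (real m - real K + 1))"
    unfolding mult.assoc exp_add[symmetric] add_divide_distrib[symmetric] by (simp add: power2_eq_square algebra_simps)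
  also have "\<dots> \<le> real (2 * m choose (m + Suc k))"
    unfolding central_ratio_Suc[OF km] using Suc km by (intro mult_mono 1) auto
  finally show ?case .
qed simp

lemma cos_ge_one_minus: "1 - x\<^sup>2 / 2 \<le> cos x" for x :: real
proof -
  have "1 - cos x = 2 * (sin (x / 2))\<^sup>2"
    using cos_double_sin[of "x / 2"] by simp
  moreover have "(sin (x / 2))\<^sup>2 \<le> (x / 2)\<^sup>2"
    using abs_sin_x_le_abs_x[of "x / 2"] by (simp only: abs_le_square_iff)
  ultimately show ?thesis by (simp add: power2_eq_square field_simps)
qed

lemma mult_cos_le_sin:
  fixes y :: real
  assumes "0 \<le> y" "y \<le> pi"
  shows "y * cos y \<le> sin y"
proof -
  have "sin 0 - 0 * cos 0 \<le> sin y - y * cos y"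
  proof (rule DERIV_nonneg_imp_nondecreasing[OF assms(1)])
    fix z assume z: "0 \<le> z" "z \<le> y"
    have "((\<lambda>z. sin z - z * cos z) has_real_derivative z * sin z) (at z)"
      by (auto intro!: derivative_eq_intros)
    moreover have "0 \<le> z * sin z" using z assms by (intro mult_nonneg_nonneg sin_ge_zero) auto
    ultimately show "\<exists>w. ((\<lambda>z. sin z - z * cos z) has_real_derivative w) (at z) \<and> 0 \<le> w" by blast
  qed
  then show ?thesis by simp
qed

lemma cos_le_exp:
  assumes "0 \<le> x" "x \<le> pi / 2"
  shows "cos x \<le> exp (- x\<^sup>2 / 2)"
proof -
  have "cos x * exp (x\<^sup>2 / 2) \<le> cos 0 * exp (0\<^sup>2 / 2)"
  proof (rule DERIV_nonpos_imp_nonincreasing[OF assms(1)])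
    fix y assume y: "0 \<le> y" "y \<le> x"
    have "((\<lambda>y. cos y * exp (y\<^sup>2 / 2)) has_real_derivative (y * cos y - sin y) * exp (y\<^sup>2 / 2)) (at y)"
      by (auto intro!: derivative_eq_intros simp: algebra_simps)
    moreover have "(y * cos y - sin y) * exp (y\<^sup>2 / 2) \<le> 0"
      using mult_cos_le_sin[of y] y assms by (intro mult_nonpos_nonneg) auto
    ultimately show "\<exists>w. ((\<lambda>y. cos y * exp (y\<^sup>2 / 2)) has_real_derivative w) (at y) \<and> w \<le> 0" by blast
  qed
  then show ?thesis by (simp add: exp_minus field_simps)
qed

text \<open>The cosine is squeezed between 1 - x^2/2, which is at least exp (- (x^2/2) / (1 -
  x^2/2)), and exp (- x^2/2). Raised to the power 2 m, both bounds have exponents tending to -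
  y.\<close>

lemma cos_power_tendsto:
  fixes x :: "nat \<Rightarrow> real" and m :: "nat \<Rightarrow> nat"
  assumes x: "x \<longlonglongrightarrow> 0" and nn: "\<And>n. x n \<ge> 0" and y: "(\<lambda>n. real (m n) * (x n)\<^sup>2) \<longlonglongrightarrow> y"
  shows "(\<lambda>n. cos (x n) ^ (2 * m n)) \<longlonglongrightarrow> exp (- y)"
proof (rule tendsto_sandwich)
  have "((\<lambda>n. exp (- (real (m n) * (x n)\<^sup>2) / (1 - (x n)\<^sup>2 / 2))) \<longlongrightarrow> exp (- y / (1 - 0\<^sup>2 / 2))) sequentially"
    by (intro tendsto_intros x y) auto
  then show "(\<lambda>n. exp (- (real (m n) * (x n)\<^sup>2) / (1 - (x n)\<^sup>2 / 2))) \<longlonglongrightarrow> exp (- y)" by simp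
  show "(\<lambda>n. exp (- (real (m n) * (x n)\<^sup>2))) \<longlonglongrightarrow> exp (- y)"
    by (intro tendsto_intros y)
  have ev: "eventually (\<lambda>n. x n < 1) sequentially" using x by (rule order_tendstoD) simp
  show "eventually (\<lambda>n. cos (x n) ^ (2 * m n) \<le> exp (- (real (m n) * (x n)\<^sup>2))) sequentially"
    using ev
  proof eventually_elim
    case (elim n)
    have p: "x n \<le> pi / 2" using elim pi_ge_two by linarith
    have "cos (x n) ^ (2 * m n) \<le> exp (- (x n)\<^sup>2 / 2) ^ (2 * m n)"
      using nn[of n] p by (intro power_mono cos_le_exp cos_ge_zero) auto
    also have "\<dots> = exp (- (real (m n) * (x n)\<^sup>2))"
      by (simp add: exp_of_nat_mult[symmetric])
    finally show ?case .
  qed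
  show "eventually (\<lambda>n. exp (- (real (m n) * (x n)\<^sup>2) / (1 - (x n)\<^sup>2 / 2)) \<le> cos (x n) ^ (2 * m n)) sequentially"
    using ev
  proof eventually_elim
    case (elim n)
    have q: "(x n)\<^sup>2 < 1" using elim nn[of n] by (simp add: power_less_one_iff abs_square_less_1)
    have "exp (- (real (m n) * (x n)\<^sup>2) / (1 - (x n)\<^sup>2 / 2)) = exp (- ((x n)\<^sup>2 / 2) / (1 - (x n)\<^sup>2 / 2)) ^ (2 * m n)"
      unfolding exp_of_nat_mult[symmetric] times_divide_eq_right by simp
    also have "\<dots> \<le> cos (x n) ^ (2 * m n)"
    proof (rule power_mono)
      have "exp (- ((x n)\<^sup>2 / 2) / (1 - (x n)\<^sup>2 / 2)) \<le> 1 - (x n)\<^sup>2 / 2"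
        using q by (intro one_minus_ge_exp) auto
      also have "\<dots> \<le> cos (x n)" by (rule cos_ge_one_minus)
      finally show "exp (- ((x n)\<^sup>2 / 2) / (1 - (x n)\<^sup>2 / 2)) \<le> cos (x n)" .
    qed simp
    finally show ?case .
  qed
qed

text \<open>With c m for the binomial coefficient divided by 4^m, the partial Wallis product equals
  1 / ((c m)^2 (2m+1)), so its limit pi / 2 determines that of (c m)^2 m.\<close>

lemma central_binomial_tendsto:
  "(\<lambda>m. real (2 * m choose m) / 4 ^ m * sqrt (real m)) \<longlonglongrightarrow> 1 / sqrt pi"
proof -
  define c where "c = (\<lambda>m. real (2 * m choose m) / 4 ^ m)"
  have step: "c (Suc m) = c m * ((2 * real m + 1) / (2 * real m + 2))" for m
  proof -
    have A: "real (2 * Suc m choose Suc m) = fact (2 * Suc m) / (fact (Suc m) * fact (Suc m))"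
      using binomial_fact[of "Suc m" "2 * Suc m", where 'a = real] by (simp del: binomial_Suc_Suc)
    have B: "real (2 * m choose m) = fact (2 * m) / (fact m * fact m)"
      using binomial_fact[of m "2 * m", where 'a = real] by simp
    have C: "fact (2 * Suc m) = (2 * real m + 2) * (2 * real m + 1) * fact (2 * m)"
      "fact (Suc m) = (real m + 1) * fact m"
      by (simp_all add: algebra_simps)
    have "real m + 1 \<noteq> 0" "2 * real m + 2 \<noteq> 0" by linarith+
    then show ?thesis unfolding c_def A B C by (simp add: divide_simps) (simp add: algebra_simps)
  qed
  have cpos: "c m > 0" for m by (simp add: c_def)
  have "(\<Prod>k=1..m. (4 * real k ^ 2) / (4 * real k ^ 2 - 1)) = 1 / ((c m)\<^sup>2 * (2 * real m + 1))" for m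
  proof (induction m)
    case 0
    then show ?case by (simp add: c_def)
  next
    case (Suc m)
    define M where "M = real m"
    have M: "M + 1 \<noteq> 0" "2 * M + 1 \<noteq> 0" "2 * M + 2 \<noteq> 0" "2 * M + 3 \<noteq> 0"
      unfolding M_def by linarith+
    have e: "4 * (real (Suc m))\<^sup>2 / (4 * (real (Suc m))\<^sup>2 - 1) = 4 * (M + 1)\<^sup>2 / ((2 * M + 1) * (2 * M + 3))"
      by (rule arg_cong2[where f = "(/)"]) (simp_all add: M_def power2_eq_square algebra_simps)
    have "(\<Prod>k=1..Suc m. 4 * (real k)\<^sup>2 / (4 * (real k)\<^sup>2 - 1))
        = 1 / ((c m)\<^sup>2 * (2 * M + 1)) * (4 * (M + 1)\<^sup>2 / ((2 * M + 1) * (2 * M + 3)))"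
      using Suc e by (simp add: M_def del: of_nat_Suc)
    also have "\<dots> = 1 / ((c m * ((2 * M + 1) / (2 * (M + 1))))\<^sup>2 * (2 * M + 3))"
    proof -
      have "1 / (x\<^sup>2 * a) * (4 * b\<^sup>2 / (a * d)) = 1 / ((x * (a / (2 * b)))\<^sup>2 * d)"
        if "x \<noteq> 0" "a \<noteq> 0" "b \<noteq> 0" "d \<noteq> 0" for x a b d :: real
        using that by (simp add: divide_simps power2_eq_square)
      then show ?thesis using M cpos[of m] by (metis less_irrefl)
    qed
    also have "\<dots> = 1 / ((c (Suc m))\<^sup>2 * (2 * real (Suc m) + 1))"
      unfolding step M_def by (simp add: algebra_simps)
    finally show ?case .
  qed
  then have "(\<lambda>m. 1 / ((c m)\<^sup>2 * (2 * real m + 1))) \<longlonglongrightarrow> pi / 2"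
    using wallis by simp
  then have w: "(\<lambda>m. 1 / (1 / ((c m)\<^sup>2 * (2 * real m + 1)))) \<longlonglongrightarrow> 1 / (pi / 2)"
    by (rule tendsto_divide[OF tendsto_const]) simp
  have "(\<lambda>m. real m / (2 * real m + 1)) \<longlonglongrightarrow> 1 / 2" by real_asymp
  from tendsto_mult[OF w this]
  have "(\<lambda>m. 1 / (1 / ((c m)\<^sup>2 * (2 * real m + 1))) * (real m / (2 * real m + 1))) \<longlonglongrightarrow> 1 / (pi / 2) * (1 / 2)" .
  moreover have "1 / (pi / 2) * (1 / 2) = 1 / pi" by simp
  ultimately have "(\<lambda>m. 1 / (1 / ((c m)\<^sup>2 * (2 * real m + 1))) * (real m / (2 * real m + 1))) \<longlonglongrightarrow> 1 / pi"
    by (simp only:)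
  then have "(\<lambda>m. (c m)\<^sup>2 * real m) \<longlonglongrightarrow> 1 / pi"
  proof (rule Lim_transform_eventually)
    show "eventually (\<lambda>m. 1 / (1 / ((c m)\<^sup>2 * (2 * real m + 1))) * (real m / (2 * real m + 1)) = (c m)\<^sup>2 * real m) sequentially"
    proof (rule always_eventually, rule allI)
      fix m
      have "2 * real m + 1 \<noteq> 0" by linarith
      then show "1 / (1 / ((c m)\<^sup>2 * (2 * real m + 1))) * (real m / (2 * real m + 1)) = (c m)\<^sup>2 * real m" by simp
    qed
  qed
  then have "(\<lambda>m. sqrt ((c m)\<^sup>2 * real m)) \<longlonglongrightarrow> sqrt (1 / pi)" by (rule tendsto_real_sqrt)
  then show ?thesis using cpos by (simp add: real_sqrt_mult real_sqrt_divide c_def abs_of_pos)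
qed

section \<open>Polya's identity in the limit\<close>

lemma summable_exp_neg_square:
  fixes c :: real
  assumes "c > 0"
  shows "summable (\<lambda>v. exp (- c * real (Suc v) ^ 2))"
proof (rule summable_comparison_test)
  show "\<exists>N. \<forall>n\<ge>N. norm (exp (- c * real (Suc n) ^ 2)) \<le> exp (- c) ^ n"
  proof (intro exI allI impI)
    fix n :: nat
    have "real n \<le> real (Suc n) ^ 2" by (simp add: power2_eq_square algebra_simps)
    then have "c * real n \<le> c * real (Suc n) ^ 2" using assms by (intro mult_left_mono) auto
    then show "norm (exp (- c * real (Suc n) ^ 2)) \<le> exp (- c) ^ n"
      by (simp add: exp_of_nat_mult[symmetric] mult.commute del: of_nat_Suc)
  qed
  show "summable (\<lambda>n. exp (- c) ^ n)" using assms by (simp add: summable_geometric)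
qed

text \<open>In the scaling m ~ l^2 / t both sides of Polya's identity have limits: the binomial
  coefficient at distance l v, divided by the central one, tends to exp (- t v^2), and the cosine
  power at the angle with index j tends to exp (- pi^2 (2j+1)^2 / (4t)). Taking l even makes the
  angles fall into two mirror halves.\<close>

locale polya_limit =
  fixes t :: real
  assumes t: "t > 0"
begin

definition l where "l n = 2 * Suc n"
definition m where "m n = nat \<lceil>real (l n) ^ 2 / t\<rceil>"

lemma l_pos: "real (l n) > 0" by (simp add: l_def)

lemma m_bounds:
  "real (l n) ^ 2 / t \<le> real (m n)" "real (m n) \<le> real (l n) ^ 2 / t + 1" "real (m n) > 0"
proof -
  have "real (l n) ^ 2 / t > 0" using l_pos t by simp
  then show "real (l n) ^ 2 / t \<le> real (m n)" "real (m n) \<le> real (l n) ^ 2 / t + 1" "real (m n) > 0"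
    unfolding m_def by linarith+
qed

lemma l_at_top: "filterlim (\<lambda>n. real (l n)) at_top sequentially"
  unfolding l_def by real_asymp

lemma inverse_l: "(\<lambda>n. 1 / real (l n)) \<longlonglongrightarrow> 0"
  unfolding l_def by real_asymp

lemma m_over_l_square: "(\<lambda>n. real (m n) / real (l n) ^ 2) \<longlonglongrightarrow> 1 / t"
proof (rule tendsto_sandwich)
  show "(\<lambda>n. 1 / t) \<longlonglongrightarrow> 1 / t" by simp
  have "(\<lambda>n. 1 / t + (1 / real (l n)) ^ 2) \<longlonglongrightarrow> 1 / t + 0 ^ 2"
    by (intro tendsto_intros inverse_l)
  then show "(\<lambda>n. 1 / t + (1 / real (l n)) ^ 2) \<longlonglongrightarrow> 1 / t" by simp
  show "eventually (\<lambda>n. 1 / t \<le> real (m n) / real (l n) ^ 2) sequentially"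
    using m_bounds(1) l_pos t by (intro always_eventually allI) (simp add: field_simps)
  show "eventually (\<lambda>n. real (m n) / real (l n) ^ 2 \<le> 1 / t + (1 / real (l n)) ^ 2) sequentially"
  proof (rule always_eventually, rule allI)
    fix n
    have "real (m n) / real (l n) ^ 2 \<le> (real (l n) ^ 2 / t + 1) / real (l n) ^ 2"
      using m_bounds(2)[of n] l_pos[of n] by (intro divide_right_mono) auto
    also have "\<dots> = 1 / t + (1 / real (l n)) ^ 2"
      using l_pos[of n] t by (simp add: add_divide_distrib power_divide)
    finally show "real (m n) / real (l n) ^ 2 \<le> 1 / t + (1 / real (l n)) ^ 2" .
  qed
qed

definition ratio where "ratio n v = real (2 * m n choose (m n + l n * v)) / real (2 * m n choose m n)"

text \<open>The majorant for \<open>tannery\<close>. It takes K = m in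
  \<open>central_ratio_upper\<close>, which gives the exponent l^2 v^2 / (2m), and m <= l^2 / t + 1
  <= l^2 (1+t) / t since l >= 1.\<close>

lemma ratio_bound: "ratio n v \<le> exp (- (t / (2 * (1 + t))) * real v ^ 2)"
proof (cases "l n * v \<le> m n")
  case True
  have "real (2 * m n choose (m n + l n * v)) \<le> real (2 * m n choose m n) * exp (- (real (l n * v))\<^sup>2 / (real (m n) + real (m n)))"
    by (rule central_ratio_upper[OF True order.refl])
  then have "ratio n v \<le> exp (- (real (l n * v))\<^sup>2 / (real (m n) + real (m n)))"
    by (simp add: ratio_def divide_le_eq mult.commute)
  also have "\<dots> \<le> exp (- (t / (2 * (1 + t))) * real v ^ 2)"
  proof -
    have "1 \<le> real (l n) ^ 2" by (intro one_le_power) (simp add: l_def)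
    then have "real (m n) \<le> real (l n) ^ 2 / t + real (l n) ^ 2" using m_bounds(2)[of n] by linarith
    then have "real (m n) * t \<le> real (l n) ^ 2 * (1 + t)" using t by (simp add: field_simps)
    then have "t / (2 * (1 + t)) \<le> real (l n) ^ 2 / (2 * real (m n))"
      using m_bounds(3)[of n] t by (simp add: field_simps)
    then have "t / (2 * (1 + t)) * real v ^ 2 \<le> real (l n) ^ 2 / (2 * real (m n)) * real v ^ 2"
      by (intro mult_right_mono) auto
    then show ?thesis by (simp add: power_mult_distrib)
  qed
  finally show ?thesis .
next
  case False
  then show ?thesis by (simp add: ratio_def binomial_eq_0)
qed

text \<open>For the limit, unlike for the majorant, K = k = l v is taken in both binomial bounds:
  divided by l^2, the denominators m + l v and m - l v + 1 both tend to 1 / t.\<close>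

lemma ratio_tendsto: "(\<lambda>n. ratio n v) \<longlonglongrightarrow> exp (- t * real v ^ 2)"
proof -
  have inv: "(\<lambda>n. real v ^ 2 / (real (m n) / real (l n) ^ 2 + real v * (1 / real (l n)))) \<longlonglongrightarrow> real v ^ 2 / (1 / t + real v * 0)"
    using t by (intro tendsto_intros m_over_l_square inverse_l) auto
  have inv2: "(\<lambda>n. real v ^ 2 / (real (m n) / real (l n) ^ 2 - real v * (1 / real (l n)) + (1 / real (l n)) ^ 2))
     \<longlonglongrightarrow> real v ^ 2 / (1 / t - real v * 0 + 0 ^ 2)"
    using t by (intro tendsto_intros m_over_l_square inverse_l) auto
  have lv: "eventually (\<lambda>n. l n * v \<le> m n) sequentially"
  proof -
    have "eventually (\<lambda>n. real v * t \<le> real (l n)) sequentially"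
      using l_at_top by (simp add: filterlim_at_top)
    then show ?thesis
    proof eventually_elim
      case (elim n)
      have "real (l n) * real v \<le> real (l n) * (real (l n) / t)"
        using elim t l_pos[of n] by (intro mult_left_mono) (auto simp: field_simps)
      also have "\<dots> \<le> real (m n)" using m_bounds(1)[of n] by (simp add: power2_eq_square)
      finally have "real (l n * v) \<le> real (m n)" by simp
      then show ?case by (simp only: of_nat_le_iff)
    qed
  qed
  show ?thesis
  proof (rule tendsto_sandwich)
    show "eventually (\<lambda>n. exp (- (real v ^ 2 / (real (m n) / real (l n) ^ 2 - real v * (1 / real (l n)) + (1 / real (l n)) ^ 2))) \<le> ratio n v) sequentially"
      using lv
    proof eventually_elim
      case (elim n)
      have "(real (l n * v))\<^sup>2 / (real (m n) - real (l n * v) + 1) = real v ^ 2 / (real (m n) / real (l n) ^ 2 - real v * (1 / real (l n)) + (1 / real (l n)) ^ 2)"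
        using l_pos[of n] by (simp add: field_simps power2_eq_square)
      then have "- (real v ^ 2 / (real (m n) / real (l n) ^ 2 - real v * (1 / real (l n)) + (1 / real (l n)) ^ 2)) = - (real (l n * v))\<^sup>2 / (real (m n) - real (l n * v) + 1)"
        by (simp only: minus_divide_left[symmetric])
      also have "exp \<dots> \<le> ratio n v"
        using central_ratio_lower[OF order.refl elim] by (simp add: ratio_def le_divide_eq mult.commute)
      finally show ?case by simp
    qed
    show "eventually (\<lambda>n. ratio n v \<le> exp (- (real v ^ 2 / (real (m n) / real (l n) ^ 2 + real v * (1 / real (l n)))))) sequentially"
      using lv
    proof eventually_elim
      case (elim n)
      have "ratio n v \<le> exp (- (real (l n * v))\<^sup>2 / (real (m n) + real (l n * v)))"
        using central_ratio_upper[OF order.refl elim] by (simp add: ratio_def divide_le_eq mult.commute)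
      also have "(real (l n * v))\<^sup>2 / (real (m n) + real (l n * v)) = real v ^ 2 / (real (m n) / real (l n) ^ 2 + real v * (1 / real (l n)))"
        using l_pos[of n] by (simp add: field_simps power2_eq_square)
      then have "- (real (l n * v))\<^sup>2 / (real (m n) + real (l n * v)) = - (real v ^ 2 / (real (m n) / real (l n) ^ 2 + real v * (1 / real (l n))))"
        by (simp only: minus_divide_left[symmetric])
      finally show ?case .
    qed
    show "(\<lambda>n. exp (- (real v ^ 2 / (real (m n) / real (l n) ^ 2 - real v * (1 / real (l n)) + (1 / real (l n)) ^ 2)))) \<longlonglongrightarrow> exp (- t * real v ^ 2)"
      using tendsto_exp[OF tendsto_minus[OF inv2]] t by (simp add: mult.commute)
    show "(\<lambda>n. exp (- (real v ^ 2 / (real (m n) / real (l n) ^ 2 + real v * (1 / real (l n)))))) \<longlonglongrightarrow> exp (- t * real v ^ 2)"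
      using tendsto_exp[OF tendsto_minus[OF inv]] t by (simp add: mult.commute)
  qed
qed

text \<open>Padding with 0 turns half of Polya's cosine sum into a series whose range does not
  depend on n. The other half is equal to it under x -> pi - x, because the exponent is
  even.\<close>

definition cos_term where
  "cos_term n j = (if j \<le> n then cos (pi * (2 * real j + 1) / (2 * real (l n))) ^ (2 * m n) else 0)"

lemma cos_sum: "(\<Sum>j<l n. cos (pi * (2 * real j + 1) / (2 * real (l n))) ^ (2 * m n)) = 2 * (\<Sum>j. cos_term n j)"
proof -
  define f where "f = (\<lambda>j::nat. cos (pi * (2 * real j + 1) / (2 * real (l n))) ^ (2 * m n))"
  have sym: "f (2 * n + 1 - j) = f j" if "j \<le> 2 * n + 1" for j
  proof -
    have "pi * (2 * real (2 * n + 1 - j) + 1) / (2 * real (l n)) = pi - pi * (2 * real j + 1) / (2 * real (l n))"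
      using that by (simp add: l_def of_nat_diff field_simps)
    then show ?thesis by (simp add: f_def power_mult)
  qed
  have "(\<Sum>j<l n. f j) = (\<Sum>j\<in>{..n} \<union> {Suc n..2 * n + 1}. f j)"
    by (rule sum.cong) (auto simp: l_def)
  also have "\<dots> = (\<Sum>j\<le>n. f j) + (\<Sum>j=Suc n..2 * n + 1. f j)"
    by (rule sum.union_disjoint) auto
  also have "(\<Sum>j=Suc n..2 * n + 1. f j) = (\<Sum>j\<le>n. f j)"
  proof (rule sum.reindex_bij_witness[of _ "\<lambda>j. 2 * n + 1 - j" "\<lambda>j. 2 * n + 1 - j"])
    show "f (2 * n + 1 - j) = f j" if "j \<in> {Suc n..2 * n + 1}" for j using sym that by simp
  qed auto
  also have "(\<Sum>j\<le>n. f j) = (\<Sum>j\<le>n. cos_term n j)"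
    by (rule sum.cong) (auto simp: f_def cos_term_def)
  also have "\<dots> = (\<Sum>j. cos_term n j)"
    by (rule suminf_finite[symmetric]) (auto simp: cos_term_def)
  finally show ?thesis by (simp add: f_def)
qed

text \<open>Only the half with angles in [0, pi / 2] is kept, so \<open>cos_le_exp\<close> applies.
  The power 2 m with m >= l^2 / t yields the limiting Gaussian itself as a bound, which is then
  weakened from (2j+1)^2 to (j+1)^2.\<close>

lemma cos_term_bound: "\<bar>cos_term n j\<bar> \<le> exp (- (pi\<^sup>2 / (4 * t)) * real (Suc j) ^ 2)"
proof (cases "j \<le> n")
  case True
  define x where "x = pi * (2 * real j + 1) / (2 * real (l n))"
  have "2 * real j + 1 \<le> real (l n)" using True by (simp add: l_def)
  then have "pi * (2 * real j + 1) \<le> pi * real (l n)" by (intro mult_left_mono) auto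
  then have x: "0 \<le> x" "x \<le> pi / 2" using l_pos[of n] by (simp_all add: x_def field_simps)
  have "\<bar>cos_term n j\<bar> = cos x ^ (2 * m n)" using True by (simp add: cos_term_def x_def power_mult)
  also have "\<dots> \<le> exp (- x\<^sup>2 / 2) ^ (2 * m n)"
    using x by (intro power_mono cos_le_exp cos_ge_zero) auto
  also have "\<dots> = exp (- (real (m n) * x\<^sup>2))"
    by (simp add: exp_of_nat_mult[symmetric])
  also have "\<dots> \<le> exp (- (real (l n) ^ 2 / t * x\<^sup>2))"
    using mult_right_mono[OF m_bounds(1)[of n], of "x\<^sup>2"] by simp
  also have "real (l n) ^ 2 / t * x\<^sup>2 = pi\<^sup>2 / (4 * t) * (2 * real j + 1) ^ 2"
    using l_pos[of n] by (simp add: x_def power_divide power_mult_distrib)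
  also have "exp (- (pi\<^sup>2 / (4 * t) * (2 * real j + 1) ^ 2)) \<le> exp (- (pi\<^sup>2 / (4 * t) * real (Suc j) ^ 2))"
    unfolding exp_le_cancel_iff neg_le_iff_le using t by (intro mult_left_mono power_mono) auto
  finally show ?thesis by simp
qed (simp add: cos_term_def)

lemma cos_term_tendsto: "(\<lambda>n. cos_term n j) \<longlonglongrightarrow> exp (- (pi\<^sup>2 / (4 * t)) * (2 * real j + 1) ^ 2)"
proof -
  have "(\<lambda>n. cos (pi * (2 * real j + 1) / (2 * real (l n))) ^ (2 * m n)) \<longlonglongrightarrow> exp (- (pi\<^sup>2 / (4 * t) * (2 * real j + 1) ^ 2))"
  proof (rule cos_power_tendsto)
    have "(\<lambda>n. pi * (2 * real j + 1) / 2 * (1 / real (l n))) \<longlonglongrightarrow> pi * (2 * real j + 1) / 2 * 0"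
      by (intro tendsto_intros inverse_l)
    then show "(\<lambda>n. pi * (2 * real j + 1) / (2 * real (l n))) \<longlonglongrightarrow> 0" by simp
    show "0 \<le> pi * (2 * real j + 1) / (2 * real (l n))" for n by simp
    have "(\<lambda>n. pi\<^sup>2 * (2 * real j + 1)\<^sup>2 / 4 * (real (m n) / real (l n) ^ 2)) \<longlonglongrightarrow> pi\<^sup>2 * (2 * real j + 1)\<^sup>2 / 4 * (1 / t)"
      by (intro tendsto_intros m_over_l_square)
    then show "(\<lambda>n. real (m n) * (pi * (2 * real j + 1) / (2 * real (l n)))\<^sup>2) \<longlonglongrightarrow> pi\<^sup>2 / (4 * t) * (2 * real j + 1)\<^sup>2"
      by (simp add: power_divide power_mult_distrib mult_ac)
  qed
  then have "(\<lambda>n. cos (pi * (2 * real j + 1) / (2 * real (l n))) ^ (2 * m n)) \<longlonglongrightarrow> exp (- (pi\<^sup>2 / (4 * t)) * (2 * real j + 1) ^ 2)"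
    by simp
  then show ?thesis
    by (rule Lim_transform_eventually)
       (use eventually_ge_at_top[of j] in \<open>eventually_elim, simp add: cos_term_def\<close>)
qed

text \<open>Polya's identity divided by its normalisation l C, with C the central binomial
  coefficient over 4^m. Writing 1 / (l C) as sqrt (m / l^2) / (C sqrt m) exhibits its limit sqrt (pi
  / t); the sums converge by \<open>tannery\<close>.\<close>

theorem inversion:
  "1 + 2 * (\<Sum>v. (-1) ^ Suc v * exp (- t * real (Suc v) ^ 2))
     = 2 * sqrt (pi / t) * (\<Sum>j. exp (- (pi\<^sup>2 / (4 * t)) * (2 * real j + 1) ^ 2))"
proof -
  define C where "C = (\<lambda>n. real (2 * m n choose m n) / 4 ^ m n)"
  have ratio0: "ratio n (Suc v) = 0" if "m n \<le> v" for n v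
  proof -
    have "l n * Suc v > m n" using that by (simp add: l_def)
    then show ?thesis by (simp add: ratio_def binomial_eq_0)
  qed
  have "(\<lambda>n. \<Sum>v. (-1) ^ Suc v * ratio n (Suc v)) \<longlonglongrightarrow> (\<Sum>v. (-1) ^ Suc v * exp (- t * real (Suc v) ^ 2))"
  proof (rule tannery)
    show "(\<lambda>n. (-1) ^ Suc v * ratio n (Suc v)) \<longlonglongrightarrow> (-1) ^ Suc v * exp (- t * real (Suc v) ^ 2)" for v
      by (intro tendsto_intros ratio_tendsto)
    show "summable (\<lambda>v. exp (- (t / (2 * (1 + t))) * real (Suc v) ^ 2))"
      using t by (intro summable_exp_neg_square) auto
    show "norm ((-1) ^ Suc v * ratio n (Suc v)) \<le> exp (- (t / (2 * (1 + t))) * real (Suc v) ^ 2)" for n v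
    proof -
      have "norm ((-1) ^ Suc v * ratio n (Suc v)) = ratio n (Suc v)"
        by (simp add: abs_mult power_abs ratio_def)
      then show ?thesis using ratio_bound[of n "Suc v"] by simp
    qed
  qed
  then have rhs: "(\<lambda>n. 1 + 2 * (\<Sum>v. (-1) ^ Suc v * ratio n (Suc v))) \<longlonglongrightarrow> 1 + 2 * (\<Sum>v. (-1) ^ Suc v * exp (- t * real (Suc v) ^ 2))"
    by (intro tendsto_intros)
  have cs: "(\<lambda>n. \<Sum>j. cos_term n j) \<longlonglongrightarrow> (\<Sum>j. exp (- (pi\<^sup>2 / (4 * t)) * (2 * real j + 1) ^ 2))"
  proof (rule tannery[OF cos_term_tendsto])
    show "norm (cos_term n j) \<le> exp (- (pi\<^sup>2 / (4 * t)) * real (Suc j) ^ 2)" for n j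
      using cos_term_bound by simp
    show "summable (\<lambda>j. exp (- (pi\<^sup>2 / (4 * t)) * real (Suc j) ^ 2))"
      using t by (intro summable_exp_neg_square) simp
  qed
  have m_top: "filterlim m at_top sequentially"
  proof -
    have "filterlim (\<lambda>n. real (l n) ^ 2 / t) at_top sequentially"
      unfolding l_def using t by real_asymp
    then have "filterlim (\<lambda>n. real (m n)) at_top sequentially"
      by (rule filterlim_at_top_mono) (use m_bounds(1) in auto)
    then show ?thesis by (simp add: filterlim_sequentially_iff_filterlim_real)
  qed
  have cl: "(\<lambda>n. sqrt (real (m n) / real (l n) ^ 2) / (C n * sqrt (real (m n)))) \<longlonglongrightarrow> sqrt (1 / t) / (1 / sqrt pi)"
    unfolding C_def
    by (intro tendsto_divide tendsto_real_sqrt m_over_l_square filterlim_compose[OF central_binomial_tendsto m_top]) auto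
  have key: "2 * (sqrt (real (m n) / real (l n) ^ 2) / (C n * sqrt (real (m n)))) * (\<Sum>j. cos_term n j)
      = 1 + 2 * (\<Sum>v. (-1) ^ Suc v * ratio n (Suc v))" for n
  proof -
    have Cp: "C n > 0" by (simp add: C_def)
    have "2 * (\<Sum>j. cos_term n j) = real (l n) / 4 ^ m n * (real (2 * m n choose m n) + 2 * (\<Sum>v=1..m n. (-1) ^ v * real (2 * m n choose (m n + l n * v))))"
      using polya_finite[of "l n" "m n"] l_pos[of n] unfolding cos_sum by simp
    also have "(\<Sum>v=1..m n. (-1) ^ v * real (2 * m n choose (m n + l n * v))) = real (2 * m n choose m n) * (\<Sum>v=1..m n. (-1) ^ v * ratio n v)"
      unfolding sum_distrib_left by (intro sum.cong) (auto simp: ratio_def)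
    also have "(\<Sum>v=1..m n. (-1) ^ v * ratio n v) = (\<Sum>v<m n. (-1) ^ Suc v * ratio n (Suc v))"
      by (rule sum.reindex_bij_witness[of _ Suc "\<lambda>k. k - 1"]) auto
    also have "\<dots> = (\<Sum>v. (-1) ^ Suc v * ratio n (Suc v))"
      by (rule suminf_finite[symmetric]) (auto simp: ratio0)
    also have "a / d * (b + 2 * (b * s)) = a * (b / d) * (1 + 2 * s)" for a b d s :: real
      by (simp add: add_divide_distrib algebra_simps)
    finally have "2 * (\<Sum>j. cos_term n j) = real (l n) * C n * (1 + 2 * (\<Sum>v. (-1) ^ Suc v * ratio n (Suc v)))"
      by (simp only: C_def)
    moreover have "sqrt (real (m n) / real (l n) ^ 2) / (C n * sqrt (real (m n))) = 1 / (real (l n) * C n)"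
      using m_bounds(3)[of n] l_pos[of n] by (simp add: real_sqrt_divide)
    ultimately show ?thesis using Cp l_pos[of n] by (simp add: field_simps)
  qed
  have "(\<lambda>n. 2 * (sqrt (real (m n) / real (l n) ^ 2) / (C n * sqrt (real (m n)))) * (\<Sum>j. cos_term n j))
    \<longlonglongrightarrow> 2 * (sqrt (1 / t) / (1 / sqrt pi)) * (\<Sum>j. exp (- (pi\<^sup>2 / (4 * t)) * (2 * real j + 1) ^ 2))"
    by (intro tendsto_mult tendsto_const cl cs)
  from LIMSEQ_unique[OF rhs this[unfolded key]] show ?thesis
    by (simp add: real_sqrt_divide)
qed

end

section \<open>Extension to complex arguments\<close>

lemma theta4_holomorphic: "theta4 holomorphic_on ball 0 1"
  by (rule power_series_holomorphic[where a = theta4_coeff]) (simp add: theta4_coeff_sums)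

text \<open>Jacobi's theta2 at nome u is 2 u^(1/4) \<open>psi u\<close>. The exponents arise from
  (2j+1)^2 = 4 j (j+1) + 1, which lets the leading exponential be split off in the inversion
  formula.\<close>

definition psi :: "complex \<Rightarrow> complex" where
  "psi u = (\<Sum>j. u ^ (j * Suc j))"

lemma norm_psi_term_le: "norm u < 1 \<Longrightarrow> norm (u ^ (j * Suc j)) \<le> norm u ^ j" for u :: complex
  by (simp add: norm_power power_decreasing)

lemma summable_psi:
  fixes u :: complex
  assumes "norm u < 1"
  shows "summable (\<lambda>j. norm (u ^ (j * Suc j)))"
  by (rule summable_comparison_test[of _ "\<lambda>j. norm u ^ j"])
     (use norm_psi_term_le[OF assms] assms in \<open>auto intro!: exI[of _ 0] simp: summable_geometric\<close>)

lemma psi_holomorphic: "psi holomorphic_on ball 0 1"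
proof (rule power_series_holomorphic)
  fix u :: complex assume "u \<in> ball 0 1"
  then have u: "norm u < 1" by simp
  define f where "f = (\<lambda>n. (if n \<in> range (\<lambda>j::nat. j * Suc j) then 1 else 0) * u ^ n)"
  have "(\<lambda>j. f (j * Suc j)) sums psi u"
    using summable_sums[OF summable_norm_cancel[OF summable_psi[OF u]]] by (simp add: f_def psi_def del: mult_Suc_right)
  also have "(\<lambda>j. f (j * Suc j)) sums psi u \<longleftrightarrow> f sums psi u"
    by (rule sums_mono_reindex) (auto simp: strict_mono_Suc_iff f_def)
  finally show "(\<lambda>n. (if n \<in> range (\<lambda>j::nat. j * Suc j) then 1 else 0) * (u - 0) ^ n) sums psi u"
    by (simp add: f_def)
qed

lemma psi_approx:
  assumes "norm u \<le> 1 / 2"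
  shows "norm (psi u - 1) \<le> 2 * norm u ^ 2"
proof -
  have u: "norm u < 1" using assms by simp
  have s: "summable (\<lambda>j. norm (u ^ (Suc j * Suc (Suc j))))"
    using summable_psi[OF u] by (subst summable_Suc_iff)
  have "psi u = (\<Sum>j. u ^ (Suc j * Suc (Suc j))) + 1"
    using suminf_split_head[OF summable_norm_cancel[OF summable_psi[OF u]]] by (simp add: psi_def)
  then have "norm (psi u - 1) \<le> (\<Sum>j. norm (u ^ (Suc j * Suc (Suc j))))"
    using summable_norm[OF s] by simp
  also have "\<dots> \<le> (\<Sum>j. norm u ^ 2 * (1 / 2) ^ j)"
  proof (rule suminf_le[OF _ s])
    show "norm (u ^ (Suc j * Suc (Suc j))) \<le> norm u ^ 2 * (1 / 2) ^ j" for j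
    proof -
      have "norm (u ^ (Suc j * Suc (Suc j))) \<le> norm u ^ (2 + j)"
        unfolding norm_power using assms by (intro power_decreasing) auto
      also have "\<dots> \<le> norm u ^ 2 * (1 / 2) ^ j"
        unfolding power_add using assms by (intro mult_left_mono power_mono) auto
      finally show ?thesis .
    qed
    show "summable (\<lambda>j. norm u ^ 2 * (1 / 2) ^ j)"
      by (intro summable_mult summable_geometric) simp
  qed
  also have "\<dots> = 2 * norm u ^ 2"
    by (subst suminf_mult) (simp_all add: suminf_geometric summable_geometric)
  finally show ?thesis .
qed

lemma theta4_inversion_real:
  fixes t :: real
  assumes t: "t > 0"
  shows "csqrt (of_real t) * theta4 (exp (- of_real t)) =
    2 * of_real (sqrt pi) * exp (- of_real (pi\<^sup>2) / (4 * of_real t)) * psi (exp (- of_real (pi\<^sup>2) / of_real t))"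
proof -
  interpret polya_limit t by unfold_locales (rule t)
  define E where "E = exp (- (pi\<^sup>2 / (4 * t)))"
  define U where "U = exp (- (pi\<^sup>2 / t))"
  have q1: "exp (- t) < 1" and U1: "0 \<le> U" "U < 1" using t by (auto simp: U_def)
  have th: "theta4 (exp (- of_real t)) = of_real (1 + 2 * (\<Sum>v. (-1) ^ Suc v * exp (- t * real (Suc v) ^ 2)))"
  proof -
    have sq: "exp (- complex_of_real t) ^ (Suc k)\<^sup>2 = of_real (exp (- t * real (Suc k) ^ 2))" for k
      by (simp add: exp_of_nat_mult[symmetric] exp_of_real[symmetric] mult.commute)
    have n: "norm (exp (- complex_of_real t)) < 1" using t by simp
    have "(\<lambda>k. complex_of_real ((-1) ^ Suc k * exp (- t * real (Suc k) ^ 2))) = (\<lambda>k. (-1) ^ Suc k * exp (- complex_of_real t) ^ (Suc k)\<^sup>2)"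
      unfolding sq by simp
    then have "summable (\<lambda>k. complex_of_real ((-1) ^ Suc k * exp (- t * real (Suc k) ^ 2)))"
      using summable_norm_cancel[OF summable_norm_theta4[OF n]] by (simp only:)
    then have "summable (\<lambda>k. (-1) ^ Suc k * exp (- t * real (Suc k) ^ 2))"
      by (simp only: summable_of_real_iff)
    from suminf_of_real[OF this, where 'a = complex] show ?thesis
      unfolding theta4_def sq by simp
  qed
  have ps: "(\<Sum>j. exp (- (pi\<^sup>2 / (4 * t)) * (2 * real j + 1) ^ 2)) = E * (\<Sum>j. U ^ (j * Suc j))"
    and sU: "summable (\<lambda>j. U ^ (j * Suc j))"
  proof -
    show sU: "summable (\<lambda>j. U ^ (j * Suc j))"
      using summable_psi[of "of_real U"] U1 by (simp add: norm_power del: mult_Suc_right)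
    have "exp (- (pi\<^sup>2 / (4 * t)) * (2 * real j + 1) ^ 2) = E * U ^ (j * Suc j)" for j
    proof -
      have "- (pi\<^sup>2 / (4 * t)) * (2 * real j + 1) ^ 2 = - (pi\<^sup>2 / (4 * t)) + real (j * Suc j) * - (pi\<^sup>2 / t)"
        using t by (simp add: field_simps power2_eq_square)
      then show ?thesis unfolding E_def U_def by (simp only: exp_add exp_of_nat_mult)
    qed
    then show "(\<Sum>j. exp (- (pi\<^sup>2 / (4 * t)) * (2 * real j + 1) ^ 2)) = E * (\<Sum>j. U ^ (j * Suc j))"
      using suminf_mult[OF sU, of E] by simp
  qed
  have pu: "psi (of_real U) = of_real (\<Sum>j. U ^ (j * Suc j))"
    unfolding psi_def using suminf_of_real[OF sU, where 'a = complex] by (simp del: mult_Suc_right)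
  have "sqrt t * (1 + 2 * (\<Sum>v. (-1) ^ Suc v * exp (- t * real (Suc v) ^ 2)))
      = 2 * sqrt pi * E * (\<Sum>j. U ^ (j * Suc j))"
    unfolding inversion ps using t by (simp add: real_sqrt_divide)
  then have "complex_of_real (sqrt t * (1 + 2 * (\<Sum>v. (-1) ^ Suc v * exp (- t * real (Suc v) ^ 2))))
      = complex_of_real (2 * sqrt pi * E * (\<Sum>j. U ^ (j * Suc j)))" by (rule arg_cong)
  also have "\<dots> = 2 * of_real (sqrt pi) * of_real E * psi (of_real U)" unfolding pu by simp
  also have "complex_of_real E = exp (- of_real (pi\<^sup>2) / (4 * of_real t))"
    unfolding E_def exp_of_real[symmetric] by simp
  also have "complex_of_real U = exp (- of_real (pi\<^sup>2) / of_real t)"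
    unfolding U_def exp_of_real[symmetric] by simp
  finally show ?thesis unfolding th using t by (simp add: csqrt_of_real)
qed

lemma Re_inverse_pos: "Re t > 0 \<Longrightarrow> Re (1 / t) > 0"
  by (auto simp: Re_divide intro!: divide_pos_pos add_pos_nonneg)

lemma norm_exp_pi_div:
  "norm (exp (- of_real (pi\<^sup>2) / t)) = exp (- pi\<^sup>2 * Re (1 / t))"
proof -
  have "- of_real (pi\<^sup>2) / t = of_real (- pi\<^sup>2) * (1 / t)" by simp
  then have "Re (- of_real (pi\<^sup>2) / t) = - pi\<^sup>2 * Re (1 / t)" by (simp only: times_complex.sel Re_complex_of_real Im_complex_of_real mult_zero_left diff_zero)
  then show ?thesis by (simp only: norm_exp_eq_Re)
qed

theorem theta4_inversion:
  assumes "Re t > 0"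
  shows "csqrt t * theta4 (exp (- t)) =
    2 * of_real (sqrt pi) * exp (- of_real (pi\<^sup>2) / (4 * t)) * psi (exp (- of_real (pi\<^sup>2) / t))"
proof -
  define H where "H = {t. Re t > 0}"
  define f where "f = (\<lambda>t. csqrt t * theta4 (exp (- t)) -
    2 * of_real (sqrt pi) * exp (- of_real (pi\<^sup>2) / (4 * t)) * psi (exp (- of_real (pi\<^sup>2) / t)))"
  have "f t = 0"
  proof (rule analytic_continuation[of f H "of_real ` {0<..}" 1])
    show "open H" unfolding H_def by (rule open_halfspace_Re_gt)
    show "connected H" unfolding H_def by (rule convex_connected[OF convex_halfspace_Re_gt])
    show "t \<in> H" using assms by (simp add: H_def)
    show "complex_of_real ` {0<..} \<subseteq> H" "1 \<in> H" by (auto simp: H_def)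
    show "f z = 0" if "z \<in> complex_of_real ` {0<..}" for z
      using that theta4_inversion_real by (auto simp: f_def)
    show "(1::complex) islimpt complex_of_real ` {0<..}"
    proof (rule islimpt_approachable[THEN iffD2], intro allI impI)
      fix e :: real assume "e > 0"
      moreover have "dist (complex_of_real (1 + e / 2)) 1 = \<bar>e / 2\<bar>"
        by (simp add: dist_norm)
      moreover have "complex_of_real (1 + e / 2) \<noteq> 1"
        using \<open>e > 0\<close> by (simp only: of_real_eq_1_iff)
      moreover have "complex_of_real (1 + e / 2) \<in> complex_of_real ` {0<..}"
        using \<open>e > 0\<close> by (intro imageI) simp
      ultimately show "\<exists>x'\<in>complex_of_real ` {0<..}. x' \<noteq> 1 \<and> dist x' 1 < e"
        by (intro bexI[of _ "complex_of_real (1 + e / 2)"]) simp_all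
    qed
    have 1: "(\<lambda>t. theta4 (exp (- t))) holomorphic_on H"
      by (rule holomorphic_on_compose_gen[OF _ theta4_holomorphic, unfolded o_def])
         (auto intro!: holomorphic_intros simp: H_def)
    have 2: "(\<lambda>t. psi (exp (- of_real (pi\<^sup>2) / t))) holomorphic_on H"
    proof (rule holomorphic_on_compose_gen[OF _ psi_holomorphic, unfolded o_def])
      show "(\<lambda>t. exp (- of_real (pi\<^sup>2) / t)) holomorphic_on H"
        by (auto intro!: holomorphic_intros simp: H_def)
      show "(\<lambda>t. exp (- of_real (pi\<^sup>2) / t)) ` H \<subseteq> ball 0 1"
      proof safe
        fix t assume "t \<in> H"
        then have "pi\<^sup>2 * Re (1 / t) > 0" using Re_inverse_pos[of t] by (intro mult_pos_pos) (auto simp: H_def)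
        then have "norm (exp (- of_real (pi\<^sup>2) / t)) < 1" unfolding norm_exp_pi_div by simp
        then show "exp (- of_real (pi\<^sup>2) / t) \<in> ball 0 1" by simp
      qed
    qed
    show "f holomorphic_on H"
      unfolding f_def
      by (intro holomorphic_intros 1 2) (auto simp: H_def complex_nonpos_Reals_iff)
  qed
  then show ?thesis by (simp add: f_def)
qed

text \<open>The reciprocal of \<open>theta4 (exp (- t))\<close> according to the inversion formula,
  with \<open>psi\<close> replaced by its value 1 at 0.\<close>

definition op_main :: "complex \<Rightarrow> complex" where
  "op_main t = csqrt t * exp (of_real (pi\<^sup>2) / (4 * t)) / (2 * of_real (sqrt pi))"

lemma norm_op_main: "norm (op_main t) = sqrt (norm t) * exp (pi\<^sup>2 / 4 * Re (1 / t)) / (2 * sqrt pi)"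
proof -
  have "of_real (pi\<^sup>2) / (4 * t) = of_real (pi\<^sup>2 / 4) * (1 / t)" by simp
  then have "Re (of_real (pi\<^sup>2) / (4 * t)) = pi\<^sup>2 / 4 * Re (1 / t)" by (simp only: times_complex.sel Re_complex_of_real Im_complex_of_real mult_zero_left diff_zero)
  then show ?thesis by (simp add: op_main_def norm_mult norm_divide norm_exp_eq_Re del: of_real_power)
qed

lemma op_gf_psi:
  assumes "Re t > 0"
  shows "op_gf (exp (- t)) * psi (exp (- of_real (pi\<^sup>2) / t)) = op_main t"
proof -
  have n: "norm (exp (- t)) < 1" using assms by simp
  define E where "E = exp (of_real (pi\<^sup>2) / (4 * t))"
  have E: "E \<noteq> 0" "exp (- of_real (pi\<^sup>2) / (4 * t)) = 1 / E" by (simp_all add: E_def exp_minus field_simps)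
  have "csqrt t = op_gf (exp (- t)) * (csqrt t * theta4 (exp (- t)))"
    using op_gf_theta4[OF n] by (simp add: mult_ac)
  also have "\<dots> = op_gf (exp (- t)) * (2 * of_real (sqrt pi) * (1 / E) * psi (exp (- of_real (pi\<^sup>2) / t)))"
    unfolding theta4_inversion[OF assms] E ..
  finally have "csqrt t = op_gf (exp (- t)) * (2 * of_real (sqrt pi) * (1 / E) * psi (exp (- of_real (pi\<^sup>2) / t)))" .
  then show ?thesis unfolding op_main_def E_def[symmetric] using E(1) by (simp add: field_simps)
qed

text \<open>The error is \<open>op_gf\<close> times 1 - psi u with u = exp (- pi^2 / t). The
  hypothesis gives \<open>norm u\<close> <= 1/2, so the first factor is at most twice
  \<open>op_main\<close> and the second at most 2 |u|^2. The growth exponent pi^2 Re (1/t) / 4 of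
  \<open>op_main\<close> is thus outweighed by the - 2 pi^2 Re (1/t) from |u|^2, leaving only the
  square root.\<close>

lemma op_gf_approx:
  assumes "Re t > 0" "pi\<^sup>2 * Re (1 / t) \<ge> 1"
  shows "norm (op_gf (exp (- t)) - op_main t) \<le> 2 * sqrt (norm t)"
proof -
  define u where "u = exp (- of_real (pi\<^sup>2) / t)"
  have nu: "norm u = exp (- pi\<^sup>2 * Re (1 / t))" unfolding u_def by (rule norm_exp_pi_div)
  have "norm u \<le> exp (-1)" unfolding nu using assms by simp
  also have "exp (-1) \<le> (1 / 2 :: real)" using exp_ge_add_one_self[of "1::real"] by (simp add: exp_minus field_simps)
  finally have u2: "norm u \<le> 1 / 2" .
  have pa: "norm (psi u - 1) \<le> 2 * norm u ^ 2" by (rule psi_approx[OF u2])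
  also have "\<dots> \<le> 2 * (1 / 2) ^ 2" using u2 by (intro mult_left_mono power_mono) auto
  finally have ps: "norm (psi u) \<ge> 1 / 2"
    using norm_triangle_ineq2[of 1 "1 - psi u"] by (simp add: norm_minus_commute power2_eq_square)
  have eq: "op_gf (exp (- t)) * psi u = op_main t" unfolding u_def by (rule op_gf_psi[OF assms(1)])
  have "norm (op_gf (exp (- t))) * (1 / 2) \<le> norm (op_gf (exp (- t))) * norm (psi u)"
    using ps by (intro mult_left_mono) auto
  also have "\<dots> = norm (op_main t)" unfolding eq[symmetric] norm_mult ..
  finally have b: "norm (op_gf (exp (- t))) \<le> 2 * norm (op_main t)" by simp
  have "op_gf (exp (- t)) - op_main t = op_gf (exp (- t)) * (1 - psi u)"
    unfolding eq[symmetric] by (simp add: algebra_simps)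
  then have "norm (op_gf (exp (- t)) - op_main t) = norm (op_gf (exp (- t))) * norm (psi u - 1)"
    by (simp add: norm_mult norm_minus_commute)
  also have "\<dots> \<le> (2 * norm (op_main t)) * (2 * norm u ^ 2)"
    by (intro mult_mono b pa) auto
  also have "\<dots> = 2 / sqrt pi * sqrt (norm t) * exp (- (7 / 4) * (pi\<^sup>2 * Re (1 / t)))"
  proof -
    have "exp (pi\<^sup>2 / 4 * Re (1 / t)) * norm u ^ 2 = exp (- (7 / 4) * (pi\<^sup>2 * Re (1 / t)))"
      unfolding nu exp_of_nat_mult[symmetric] exp_add[symmetric] by (simp add: algebra_simps)
    then show ?thesis unfolding norm_op_main by (simp add: field_simps)
  qed
  also have "\<dots> \<le> 2 / 1 * sqrt (norm t) * 1"
    using assms pi_ge_two by (intro mult_mono divide_left_mono) auto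
  finally show ?thesis by simp
qed

text \<open>For real t all terms of \<open>psi\<close> are nonnegative and the first is 1, so
  \<open>op_gf\<close> is at most \<open>op_main\<close>, for every \<open>s\<close> and not only
  near 0.\<close>

lemma norm_op_gf_real:
  fixes s :: real
  assumes "s > 0"
  shows "norm (op_gf (of_real (exp (- s)))) \<le> sqrt s * exp (pi\<^sup>2 / (4 * s))"
proof -
  define U where "U = exp (- (pi\<^sup>2 / s))"
  have U1: "0 \<le> U" "U < 1" using assms by (auto simp: U_def)
  have u: "exp (- of_real (pi\<^sup>2) / complex_of_real s) = of_real U"
    unfolding U_def exp_of_real[symmetric] by simp
  have sU: "summable (\<lambda>j. U ^ (j * Suc j))"
    using summable_psi[of "of_real U"] U1 by (simp add: norm_power del: mult_Suc_right)
  have pu: "psi (of_real U) = of_real (\<Sum>j. U ^ (j * Suc j))"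
    unfolding psi_def using suminf_of_real[OF sU, where 'a = complex] by (simp del: mult_Suc_right)
  have "(\<Sum>j\<in>{0}. U ^ (j * Suc j)) \<le> (\<Sum>j. U ^ (j * Suc j))"
    by (rule sum_le_suminf[OF sU]) (use U1 in auto)
  then have p1: "1 \<le> norm (psi (of_real U))" unfolding pu by simp
  have e: "op_gf (exp (- of_real s)) * psi (of_real U) = op_main (of_real s)"
    using op_gf_psi[of "of_real s"] assms unfolding u by simp
  have "norm (op_gf (exp (- of_real s))) * 1 \<le> norm (op_gf (exp (- of_real s))) * norm (psi (of_real U))"
    using p1 by (intro mult_left_mono) auto
  also have "\<dots> = norm (op_main (of_real s))" unfolding e[symmetric] norm_mult ..
  also have "\<dots> = sqrt s * exp (pi\<^sup>2 / (4 * s)) / (2 * sqrt pi)"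
    unfolding norm_op_main using assms by (simp add: Re_divide power2_eq_square)
  also have "\<dots> \<le> sqrt s * exp (pi\<^sup>2 / (4 * s)) / 1"
  proof (rule divide_left_mono)
    have "1 \<le> sqrt pi" using pi_ge_two by simp
    then show "1 \<le> 2 * sqrt pi" by linarith
  qed (use assms in auto)
  finally show ?thesis by (simp add: exp_of_real[symmetric])
qed

section \<open>The circle method\<close>

text \<open>The Taylor coefficients of \<open>log ((1 + z) / (1 - z))\<close> are nonnegative; all of them except the
  linear one are bounded by their values at \<open>norm z\<close>.\<close>

lemma norm_quotient_le:
  assumes "norm z < 1"
  shows "norm ((1 + z) / (1 - z)) \<le> (1 + norm z) / (1 - norm z) * exp (- 2 * (norm z - Re z))"
proof -
  \<comment> \<open>These are 2 / n for odd n and 0 for even n. At n = 0 division by 0 gives 0, in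
    agreement with the vanishing constant terms of the logarithms.\<close>
  define c :: "nat \<Rightarrow> real" where "c = (\<lambda>n. (1 - (-1) ^ n) / real n)"
  define d :: "complex \<Rightarrow> complex" where "d = (\<lambda>w. ln (1 + w) - ln (1 - w))"
  have c: "c n \<ge> 0" for n by (cases "even n") (simp_all add: c_def)
  have ser: "(\<lambda>n. c n * Re (w ^ n)) sums Re (d w)" if "norm w < 1" for w
  proof -
    have "(\<lambda>n. - ((- w) ^ n) / of_nat n - (- ((- (- w)) ^ n) / of_nat n)) sums (ln (1 + w) - ln (1 + - w))"
      using that by (intro sums_diff Ln_series') auto
    also have "(\<lambda>n. - ((- w) ^ n) / of_nat n - (- ((- (- w)) ^ n) / of_nat n)) = (\<lambda>n. of_real (c n) * w ^ n)"
      by (rule ext) (simp add: c_def power_minus[of w] diff_divide_distrib algebra_simps)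
    finally have "(\<lambda>n. of_real (c n) * w ^ n) sums d w" by (simp add: d_def)
    from sums_Re[OF this] show ?thesis by simp
  qed
  have nd: "norm ((1 + w) / (1 - w)) = exp (Re (d w))" if "norm w < 1" for w
  proof -
    have "1 + w \<noteq> 0" "1 - w \<noteq> 0" using that by (auto simp: add_eq_0_iff)
    then have "(1 + w) / (1 - w) = exp (d w)" by (simp add: d_def exp_diff)
    then show ?thesis by simp
  qed
  have r: "norm (complex_of_real (norm z)) < 1" using assms by simp
  have diff: "(\<lambda>n. c n * (norm z ^ n - Re (z ^ n))) sums (Re (d (of_real (norm z))) - Re (d z))"
    using sums_diff[OF ser[OF r] ser[OF assms]] by (simp add: right_diff_distrib flip: of_real_power)
  have nn: "norm z ^ n - Re (z ^ n) \<ge> 0" for n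
    using complex_Re_le_cmod[of "z ^ n"] by (simp add: norm_power)
  have "(\<Sum>n\<in>{1}. c n * (norm z ^ n - Re (z ^ n))) \<le> (\<Sum>n. c n * (norm z ^ n - Re (z ^ n)))"
    using diff c nn by (intro sum_le_suminf) (auto simp: sums_iff)
  then have "2 * (norm z - Re z) \<le> Re (d (of_real (norm z))) - Re (d z)"
    using diff by (simp add: sums_iff c_def)
  then have "norm ((1 + z) / (1 - z)) \<le> exp (Re (d (of_real (norm z))) + - 2 * (norm z - Re z))"
    unfolding nd[OF assms] by simp
  also have "\<dots> = norm ((1 + complex_of_real (norm z)) / (1 - complex_of_real (norm z))) * exp (- 2 * (norm z - Re z))"
    unfolding exp_add nd[OF r] ..
  also have "norm ((1 + complex_of_real (norm z)) / (1 - complex_of_real (norm z))) = (1 + norm z) / (1 - norm z)"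
  proof -
    have "(1 + complex_of_real (norm z)) / (1 - complex_of_real (norm z)) = of_real ((1 + norm z) / (1 - norm z))"
      by simp
    also have "norm \<dots> = (1 + norm z) / (1 - norm z)"
      unfolding norm_of_real using assms by (intro abs_of_nonneg) auto
    finally show ?thesis .
  qed
  finally show ?thesis .
qed

text \<open>\<open>norm_quotient_le\<close> is applied to every q^i. The linear savings 2 (r^i - Re
  (q^i)) form geometric series, so the total saving is an explicit rational expression that measures
  how far q is from the positive real axis.\<close>

lemma norm_op_gf_le:
  assumes q: "norm q < 1"
  shows "norm (op_gf q) \<le> norm (op_gf (of_real (norm q))) * exp (- 2 * (norm q / (1 - norm q) - Re (q / (1 - q))))"
proof -
  define r where "r = norm q"
  have r: "0 \<le> r" "r < 1" using q by (auto simp: r_def)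
  have geo: "(\<lambda>m. \<Sum>i=1..m. w ^ i) \<longlonglongrightarrow> w / (1 - w)" if "norm w < 1" for w :: "'a::{real_normed_field, banach}"
  proof -
    have "(\<lambda>n. w * w ^ n) sums (w * (1 / (1 - w)))"
      by (intro sums_mult geometric_sums that)
    then show ?thesis by (simp add: sums_def sum.atLeast1_atMost_eq)
  qed
  have e1: "(\<lambda>m. exp (- 2 * ((\<Sum>i=1..m. r ^ i) - Re (\<Sum>i=1..m. q ^ i)))) \<longlonglongrightarrow> exp (- 2 * (r / (1 - r) - Re (q / (1 - q))))"
    using r q by (intro tendsto_intros geo) auto
  have n1: "(\<lambda>m. norm (\<Prod>i=1..m. (1 + q ^ i) / (1 - q ^ i))) \<longlonglongrightarrow> norm (op_gf q)"
    by (intro tendsto_norm op_gf_product q)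
  have n2: "(\<lambda>m. norm (\<Prod>i=1..m. (1 + complex_of_real r ^ i) / (1 - complex_of_real r ^ i))) \<longlonglongrightarrow> norm (op_gf (of_real r))"
    using r by (intro tendsto_norm op_gf_product) simp
  have le: "norm (\<Prod>i=1..m. (1 + q ^ i) / (1 - q ^ i)) \<le> norm (\<Prod>i=1..m. (1 + complex_of_real r ^ i) / (1 - of_real r ^ i))
      * exp (- 2 * ((\<Sum>i=1..m. r ^ i) - Re (\<Sum>i=1..m. q ^ i)))" for m
  proof -
    have "norm (\<Prod>i=1..m. (1 + q ^ i) / (1 - q ^ i)) = (\<Prod>i=1..m. norm ((1 + q ^ i) / (1 - q ^ i)))"
      by (rule prod_norm[symmetric])
    also have "\<dots> \<le> (\<Prod>i=1..m. norm ((1 + complex_of_real r ^ i) / (1 - of_real r ^ i)) * exp (- 2 * (r ^ i - Re (q ^ i))))"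
    proof (intro prod_mono conjI)
      fix i assume i: "i \<in> {1..m}"
      have ri: "r ^ i < 1" using r i by (auto simp: power_less_one_iff)
      have "norm ((1 + q ^ i) / (1 - q ^ i)) \<le> (1 + norm (q ^ i)) / (1 - norm (q ^ i)) * exp (- 2 * (norm (q ^ i) - Re (q ^ i)))"
        by (rule norm_quotient_le) (use ri in \<open>simp add: norm_power r_def\<close>)
      also have "(1 + norm (q ^ i)) / (1 - norm (q ^ i)) = norm (complex_of_real ((1 + r ^ i) / (1 - r ^ i)))"
        unfolding norm_of_real norm_power r_def[symmetric] using ri r by simp
      also have "complex_of_real ((1 + r ^ i) / (1 - r ^ i)) = (1 + complex_of_real r ^ i) / (1 - of_real r ^ i)" by simp
      finally show "norm ((1 + q ^ i) / (1 - q ^ i)) \<le> norm ((1 + complex_of_real r ^ i) / (1 - of_real r ^ i)) * exp (- 2 * (r ^ i - Re (q ^ i)))"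
        by (simp only: norm_power r_def)
    qed simp
    also have "\<dots> = norm (\<Prod>i=1..m. (1 + complex_of_real r ^ i) / (1 - of_real r ^ i)) * exp (\<Sum>i=1..m. - 2 * (r ^ i - Re (q ^ i)))"
      unfolding prod.distrib prod_norm by (simp add: exp_sum)
    also have "(\<Sum>i=1..m. - 2 * (r ^ i - Re (q ^ i))) = - 2 * ((\<Sum>i=1..m. r ^ i) - Re (\<Sum>i=1..m. q ^ i))"
      unfolding Re_sum sum_subtractf[symmetric] sum_distrib_left ..
    finally show ?thesis .
  qed
  show ?thesis unfolding r_def[symmetric]
    by (rule LIMSEQ_le[OF n1 tendsto_mult[OF n2 e1]]) (use le in blast)
qed

section \<open>Gaussian integrals over a segment\<close>

lemma gaussian_tail_le:
  fixes N b :: real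
  assumes N: "N > 0" and b: "1 \<le> b"
  shows "integral {1..b} (\<lambda>y. exp (- (N * y\<^sup>2))) \<le> exp (- N) / (2 * N)"
proof -
  have "((\<lambda>y. y * exp (- (N * y\<^sup>2))) has_integral
      (- exp (- (N * b\<^sup>2)) / (2 * N) - (- exp (- (N * 1\<^sup>2)) / (2 * N)))) {1..b}"
    using N by (intro fundamental_theorem_of_calculus[OF b])
      (auto intro!: derivative_eq_intros simp: field_simps has_real_derivative_iff_has_vector_derivative[symmetric])
  then have i: "integral {1..b} (\<lambda>y. y * exp (- (N * y\<^sup>2))) = (exp (- N) - exp (- (N * b\<^sup>2))) / (2 * N)"
    by (simp add: integral_unique diff_divide_distrib)
  have "integral {1..b} (\<lambda>y. exp (- (N * y\<^sup>2))) \<le> integral {1..b} (\<lambda>y. y * exp (- (N * y\<^sup>2)))"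
    by (intro integral_le integrable_continuous_interval continuous_intros) auto
  also have "\<dots> \<le> exp (- N) / (2 * N)"
    unfolding i using N by (intro divide_right_mono) auto
  finally show ?thesis .
qed

lemma gaussian_has_integral:
  fixes N :: real
  assumes N: "N > 0"
  shows "((\<lambda>y. exp (- (N * y\<^sup>2))) has_integral sqrt (pi / N)) UNIV"
proof -
  define s where "s = sqrt (1 / (2 * N))"
  have s: "s > 0" "s\<^sup>2 = 1 / (2 * N)" using N by (simp_all add: s_def)
  have e: "normal_density 0 s = (\<lambda>y. exp (- (N * y\<^sup>2)) / sqrt (pi / N))"
    unfolding normal_density_def s(2) using N by (simp add: field_simps)
  have "(normal_density 0 s has_integral 1) UNIV"
    using has_integral_integral_lborel[OF integrable_normal_density[OF s(1)], of 0] integral_normal_density[OF s(1), of 0] by simp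
  from has_integral_mult_right[OF this, of "sqrt (pi / N)"] show ?thesis
    unfolding e using N by simp
qed

lemma gaussian_segment:
  fixes N :: real
  assumes N: "N > 0"
  shows "integral {-1..1} (\<lambda>y. exp (- (N * y\<^sup>2))) \<le> sqrt (pi / N)"
    and "sqrt (pi / N) - exp (- N) / N \<le> integral {-1..1} (\<lambda>y. exp (- (N * y\<^sup>2)))"
proof -
  define f where "f = (\<lambda>y::real. exp (- (N * y\<^sup>2)))"
  have int: "f integrable_on {a..b}" for a b
    unfolding f_def by (intro integrable_continuous_interval continuous_intros)
  have U: "(f has_integral sqrt (pi / N)) UNIV"
    unfolding f_def by (rule gaussian_has_integral[OF N])
  show "integral {-1..1} (\<lambda>y. exp (- (N * y\<^sup>2))) \<le> sqrt (pi / N)"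
    using has_integral_subset_le[OF _ integrable_integral[OF int[of "-1" 1]] U] by (simp add: f_def)
  \<comment> \<open>The integral over the line is approximated by one over [-b, b]. Since b >= 1,
    what lies outside [-1, 1] is two equal tails, each at most exp (- N) / (2 N).\<close>
  have "sqrt (pi / N) \<le> (integral {-1..1} f + exp (- N) / N) + e" if e: "e > 0" for e
  proof -
    obtain B where B: "B > 0" "\<And>a b. ball 0 B \<subseteq> cbox a b \<Longrightarrow> norm (integral (cbox a b) (\<lambda>x. if x \<in> UNIV then f x else 0) - sqrt (pi / N)) < e"
      using U e unfolding has_integral_alt' by meson
    define b where "b = max 1 B"
    have b: "1 \<le> b" "B \<le> b" by (auto simp: b_def)
    have "ball 0 B \<subseteq> cbox (- b) b" using b by (auto simp: dist_real_def)
    from B(2)[OF this] have 1: "sqrt (pi / N) \<le> integral {-b..b} f + e" by simp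
    have "integral {-b..b} f = integral {-b..-1} f + (integral {-1..1} f + integral {1..b} f)"
      using b by (simp add: Henstock_Kurzweil_Integration.integral_combine int)
    also have "integral {-b..-1} f = integral {1..b} f"
      using Henstock_Kurzweil_Integration.integral_reflect_real[of b 1 f] by (simp add: f_def)
    also have "integral {1..b} f \<le> exp (- N) / (2 * N)"
      unfolding f_def by (rule gaussian_tail_le[OF N b(1)])
    finally show ?thesis using 1 by simp
  qed
  then show "sqrt (pi / N) - exp (- N) / N \<le> integral {-1..1} (\<lambda>y. exp (- (N * y\<^sup>2)))"
    using field_le_epsilon[of "sqrt (pi / N)" "integral {-1..1} f + exp (- N) / N"] by (simp add: f_def)
qed

text \<open>The derivative of y exp (- N y^2) is (1 - 2 N y^2) exp (- N y^2), and 1 - y^2 = (1 -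
  1/(2N)) + (1 - 2 N y^2) / (2N). The boundary term raises the value by exp (- N) / N and cutting
  off the tails lowers it by at most as much, so the two errors do not add up.\<close>

lemma gaussian_weighted_segment:
  fixes N :: real
  assumes N: "N \<ge> 1"
  shows "\<bar>integral {-1..1} (\<lambda>y. (1 - y\<^sup>2) * exp (- (N * y\<^sup>2))) - sqrt (pi / N) * (1 - 1 / (2 * N))\<bar> \<le> exp (- N) / N"
proof -
  define g where "g = integral {-1..1} (\<lambda>y::real. exp (- (N * y\<^sup>2)))"
  have "((\<lambda>y. exp (- (N * y\<^sup>2)) - 2 * N * (y\<^sup>2 * exp (- (N * y\<^sup>2)))) has_integral
      (1 * exp (- (N * 1\<^sup>2)) - (-1) * exp (- (N * (-1)\<^sup>2)))) {-1..1}"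
    by (rule fundamental_theorem_of_calculus)
      (auto intro!: derivative_eq_intros simp: field_simps power2_eq_square has_real_derivative_iff_has_vector_derivative[symmetric])
  then have d: "((\<lambda>y. exp (- (N * y\<^sup>2)) - 2 * N * (y\<^sup>2 * exp (- (N * y\<^sup>2)))) has_integral 2 * exp (- N)) {-1..1}"
    by simp
  have gi: "((\<lambda>y. exp (- (N * y\<^sup>2))) has_integral g) {-1..1}"
    unfolding g_def by (intro integrable_integral integrable_continuous_interval continuous_intros)
  have "((\<lambda>y. (1 - 1 / (2 * N)) * exp (- (N * y\<^sup>2)) + 1 / (2 * N) * (exp (- (N * y\<^sup>2)) - 2 * N * (y\<^sup>2 * exp (- (N * y\<^sup>2))))) has_integral
      ((1 - 1 / (2 * N)) * g + 1 / (2 * N) * (2 * exp (- N)))) {-1..1}"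
    by (intro has_integral_add has_integral_mult_right gi d)
  also have "(\<lambda>y. (1 - 1 / (2 * N)) * exp (- (N * y\<^sup>2)) + 1 / (2 * N) * (exp (- (N * y\<^sup>2)) - 2 * N * (y\<^sup>2 * exp (- (N * y\<^sup>2)))))
      = (\<lambda>y. (1 - y\<^sup>2) * exp (- (N * y\<^sup>2)))"
    using N by (intro ext) (simp add: field_simps)
  finally have i: "integral {-1..1} (\<lambda>y. (1 - y\<^sup>2) * exp (- (N * y\<^sup>2))) = (1 - 1 / (2 * N)) * g + exp (- N) / N"
    by (simp add: integral_unique)
  have g: "g \<le> sqrt (pi / N)" "sqrt (pi / N) - exp (- N) / N \<le> g"
    unfolding g_def using gaussian_segment[of N] N by auto
  define c where "c = 1 - 1 / (2 * N)"
  have c: "0 \<le> c" "c \<le> 1" using N by (auto simp: c_def)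
  have "c * (sqrt (pi / N) - g) \<le> 1 * (exp (- N) / N)" "0 \<le> c * (sqrt (pi / N) - g)"
  proof -
    have "c * (sqrt (pi / N) - g) \<le> 1 * (sqrt (pi / N) - g)" using c g by (intro mult_right_mono) auto
    then show "c * (sqrt (pi / N) - g) \<le> 1 * (exp (- N) / N)" unfolding mult_1_left using g by linarith
    show "0 \<le> c * (sqrt (pi / N) - g)" using c g by simp
  qed
  moreover have "c * g + exp (- N) / N - sqrt (pi / N) * c = exp (- N) / N - c * (sqrt (pi / N) - g)"
    by (simp add: algebra_simps)
  ultimately show ?thesis unfolding i c_def[symmetric] by linarith
qed

section \<open>Cauchy's formula for the coefficients\<close>

lemma exp_harmonic_integral:
  fixes k :: int
  shows "((\<lambda>x. exp (\<i> * of_int k * of_real x)) has_integral (if k = 0 then 2 * pi else 0)) {-pi..pi}"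
proof (cases "k = 0")
  case True
  then show ?thesis using has_integral_const_real[of "1::complex" "-pi" pi] by (simp add: scaleR_conv_of_real)
next
  case False
  define F where "F = (\<lambda>x::real. exp (\<i> * of_int k * of_real x) / (\<i> * of_int k))"
  have "((\<lambda>x. exp (\<i> * of_int k * of_real x)) has_integral (F pi - F (- pi))) {-pi..pi}"
  proof (rule fundamental_theorem_of_calculus)
    fix x :: real
    have "((\<lambda>z. exp (\<i> * of_int k * z) / (\<i> * of_int k)) has_field_derivative exp (\<i> * of_int k * of_real x)) (at (of_real x))"
      using False by (auto intro!: derivative_eq_intros)
    from has_vector_derivative_real_field[OF this]
    show "(F has_vector_derivative exp (\<i> * of_int k * of_real x)) (at x within {-pi..pi})"
      unfolding F_def by (rule has_vector_derivative_at_within)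
  qed simp
  moreover have "F pi = F (- pi)"
  proof -
    have "exp (\<i> * of_int k * of_real pi) = exp (\<i> * of_int k * of_real (- pi))"
      unfolding exp_eq by (rule exI[of _ k]) (simp add: algebra_simps)
    then show ?thesis by (simp add: F_def)
  qed
  ultimately show ?thesis using False by simp
qed

text \<open>On the vertical segment the norm of each term of the series does not depend on x. So the
  Weierstrass test applies and the integral may be taken term by term; only k = n survives.\<close>

lemma op_gf_coefficient:
  assumes s: "s > 0"
  shows "((\<lambda>x. op_gf (exp (- Complex s x)) * exp (of_nat n * Complex s x)) has_integral
    2 * pi * real (overpartitions n)) {-pi..pi}"
proof -
  define a where "a = (\<lambda>k x. of_nat (overpartitions k) * exp (- Complex s x) ^ k * exp (of_nat n * Complex s x))"
  define M where "M = (\<lambda>k. real (overpartitions k) * exp (- s) ^ k * exp (real n * s))"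
  have na: "norm (a k x) = M k" for k x
    by (simp add: a_def M_def norm_mult norm_power)
  have sM: "summable M"
    unfolding M_def using s by (intro summable_mult2 summable_overpartitions) auto
  have u: "uniform_limit {-pi..pi} (\<lambda>m x. \<Sum>k<m. a k x) (\<lambda>x. \<Sum>k. a k x) sequentially"
    by (rule Weierstrass_m_test[OF _ sM]) (simp add: na)
  have sa: "(\<Sum>k. a k x) = op_gf (exp (- Complex s x)) * exp (of_nat n * Complex s x)" for x
    unfolding a_def op_gf_def
    by (rule suminf_mult2[symmetric], rule summable_norm_cancel, rule summable_norm_op_gf) (use s in simp)
  have ae: "a k x = of_nat (overpartitions k) * exp (of_real (real_of_int (int n - int k) * s)) * exp (\<i> * of_int (int n - int k) * of_real x)" for k x
  proof -
    have "exp (- Complex s x) ^ k * exp (of_nat n * Complex s x) = exp (of_nat k * (- Complex s x) + of_nat n * Complex s x)"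
      by (simp only: exp_add exp_of_nat_mult)
    also have "of_nat k * (- Complex s x) + of_nat n * Complex s x = of_real (real_of_int (int n - int k) * s) + \<i> * of_int (int n - int k) * of_real x"
      by (simp add: complex_eq_iff algebra_simps)
    finally show ?thesis unfolding a_def by (simp only: exp_add mult.assoc)
  qed
  have ai: "(a k has_integral (if k = n then 2 * pi * real (overpartitions n) else 0)) {-pi..pi}" for k
  proof -
    define c where "c = of_nat (overpartitions k) * exp (complex_of_real (real_of_int (int n - int k) * s))"
    have "a k = (\<lambda>x. c * exp (\<i> * of_int (int n - int k) * of_real x))"
      by (rule ext) (simp only: ae c_def)
    then have "(a k has_integral (c * of_real (if int n - int k = 0 then 2 * pi else 0))) {-pi..pi}"
      using has_integral_mult_right[OF exp_harmonic_integral[of "int n - int k"], of c] by (simp only:)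
    moreover have "c * of_real (if int n - int k = 0 then 2 * pi else 0) = of_real (if k = n then 2 * pi * real (overpartitions n) else 0)"
      by (auto simp: c_def)
    ultimately show ?thesis by (simp only:)
  qed
  have si: "((\<lambda>x. \<Sum>k<m. a k x) has_integral (\<Sum>k<m. of_real (if k = n then 2 * pi * real (overpartitions n) else 0))) {-pi..pi}" for m
    by (rule has_integral_sum) (use ai in simp_all)
  have ca: "continuous_on {-pi..pi} (\<lambda>x. \<Sum>k<m. a k x)" for m
    unfolding ae by (intro continuous_intros)
  obtain I J where I: "\<And>m. ((\<lambda>x. \<Sum>k<m. a k x) has_integral I m) {-pi..pi}"
    and J: "((\<lambda>x. \<Sum>k. a k x) has_integral J) {-pi..pi}" and IJ: "I \<longlonglongrightarrow> J"
    using uniform_limit_integral[OF u ca] by auto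
  have "I m = (\<Sum>k<m. of_real (if k = n then 2 * pi * real (overpartitions n) else 0))" for m
    using has_integral_unique[OF I si] .
  then have Im: "I m = complex_of_real (2 * pi * real (overpartitions n))" if "n < m" for m
    using that by (simp add: if_distrib[of complex_of_real] cong: if_cong)
  have "eventually (\<lambda>m. I m = complex_of_real (2 * pi * real (overpartitions n))) sequentially"
    by (rule eventually_mono[OF eventually_gt_at_top[of n]]) (rule Im)
  then have "I \<longlonglongrightarrow> complex_of_real (2 * pi * real (overpartitions n))"
    by (rule tendsto_eventually)
  then have "J = complex_of_real (2 * pi * real (overpartitions n))"
    using IJ LIMSEQ_unique by blast
  then show ?thesis using J unfolding sa by simp
qed

section \<open>The range away from the real axis\<close>

lemma one_minus_cos_ge:
  fixes y :: real
  assumes "0 \<le> y" "y \<le> 1 / 5"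
  shows "49 / 100 * y\<^sup>2 \<le> 1 - cos y"
proof -
  define z where "z = y / 2"
  have z: "0 \<le> z" "z \<le> 1 / 10" "z \<le> pi" using assms pi_ge_two by (auto simp: z_def)
  have "z\<^sup>2 \<le> (1 / 10)\<^sup>2" using z by (intro power_mono) auto
  then have "0.995 \<le> cos z" using cos_ge_one_minus[of z] by (simp add: power2_eq_square)
  then have "z * 0.995 \<le> z * cos z" using z by (intro mult_left_mono) auto
  also have "\<dots> \<le> sin z" by (rule mult_cos_le_sin) (use z in auto)
  finally have "(z * 0.995)\<^sup>2 \<le> (sin z)\<^sup>2" using z by (intro power_mono) auto
  moreover have "1 - cos y = 2 * (sin z)\<^sup>2" using cos_double_sin[of z] by (simp add: z_def)
  moreover have "49 / 100 * y\<^sup>2 \<le> 2 * (z * 0.995)\<^sup>2" by (simp add: z_def power2_eq_square)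
  ultimately show ?thesis by linarith
qed

text \<open>With r = exp (- s), |1 - q|^2 = (1-r)^2 + 2 r (1 - cos x). For |x| >= 5 s and r >= 0.96
  the second summand is at least 23.52 s^2, which exceeds the required 15 (1-r)^2 because 1 - r <=
  s.\<close>

lemma norm_one_minus_exp_ge:
  assumes s: "0 < s" "s \<le> 1 / 25" and x: "5 * s \<le> \<bar>x\<bar>" "\<bar>x\<bar> \<le> pi"
  shows "4 * (1 - exp (- s)) \<le> norm (1 - exp (- Complex s x))"
proof -
  define r where "r = exp (- s)"
  have r: "0 < r" "1 - s \<le> r" "r < 1" using s exp_ge_add_one_self[of "- s"] by (auto simp: r_def)
  have e: "exp (- Complex s x) = Complex (r * cos x) (- (r * sin x))"
    by (simp add: complex_eq_iff Re_exp Im_exp r_def)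
  have "norm (1 - exp (- Complex s x)) ^ 2 = (1 - r * cos x)\<^sup>2 + (r * sin x)\<^sup>2"
    unfolding e cmod_power2 by simp
  also have "(r * sin x)\<^sup>2 = r\<^sup>2 * (1 - (cos x)\<^sup>2)"
    by (simp add: power_mult_distrib sin_squared_eq)
  also have "(1 - r * cos x)\<^sup>2 + r\<^sup>2 * (1 - (cos x)\<^sup>2) = (1 - r)\<^sup>2 + 2 * r * (1 - cos x)"
    by (simp add: power2_eq_square algebra_simps)
  finally have n: "norm (1 - exp (- Complex s x)) ^ 2 = (1 - r)\<^sup>2 + 2 * r * (1 - cos x)" .
  have "cos x = cos \<bar>x\<bar>" by simp
  also have "\<dots> \<le> cos (5 * s)"
    using s x by (intro cos_monotone_0_pi_le) auto
  finally have "49 / 100 * (5 * s)\<^sup>2 \<le> 1 - cos x"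
    using one_minus_cos_ge[of "5 * s"] s by simp
  then have "2 * (96 / 100) * (49 / 100 * (5 * s)\<^sup>2) \<le> 2 * r * (1 - cos x)"
    using r s by (intro mult_mono) auto
  moreover have "2 * (96 / 100) * (49 / 100 * (5 * s)\<^sup>2) = 2352 / 100 * s\<^sup>2" by (simp add: power_mult_distrib)
  moreover have "(1 - r)\<^sup>2 \<le> s\<^sup>2" using r by (intro power_mono) auto
  moreover have "(4 * (1 - r))\<^sup>2 = 16 * (1 - r)\<^sup>2" by (simp only: power_mult_distrib) simp
  ultimately have "(4 * (1 - r))\<^sup>2 \<le> norm (1 - exp (- Complex s x)) ^ 2"
    unfolding n using zero_le_power2[of s] by argo
  then show ?thesis unfolding r_def by (rule power2_le_imp_le) simp
qed

text \<open>The bound 4 (1-r) <= |1 - q| makes Re (q / (1-q)) at most a quarter of r / (1-r). The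
  saving in \<open>norm_op_gf_le\<close> is therefore at least 2 (1 - 1/4) = 3/2 times r / (1-r),
  and r / (1-r) >= 1/s - 1.\<close>

lemma op_gf_minor_arc:
  assumes s: "0 < s" "s \<le> 1 / 25" and x: "5 * s \<le> \<bar>x\<bar>" "\<bar>x\<bar> \<le> pi"
  shows "norm (op_gf (exp (- Complex s x))) \<le> sqrt s * exp (pi\<^sup>2 / (4 * s) - 3 / 2 * (1 / s - 1))"
proof -
  define q where "q = exp (- Complex s x)"
  define r where "r = exp (- s)"
  have nq: "norm q = r" by (simp add: q_def r_def)
  have r: "0 < r" "r < 1" using s by (auto simp: r_def)
  have q1: "norm q < 1" using nq r by simp
  have "Re (q / (1 - q)) \<le> norm (q / (1 - q))" by (rule complex_Re_le_cmod)
  also have "\<dots> = r / norm (1 - q)" by (simp add: norm_divide nq)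
  also have "\<dots> \<le> r / (4 * (1 - r))"
  proof (rule divide_left_mono)
    have p: "0 < 4 * (1 - r)" using r by simp
    show l: "4 * (1 - r) \<le> norm (1 - q)"
      using norm_one_minus_exp_ge[OF assms] by (simp add: q_def r_def)
    show "0 < norm (1 - q) * (4 * (1 - r))" by (rule mult_pos_pos) (use p l in linarith)+
  qed (use r in simp)
  finally have 1: "Re (q / (1 - q)) \<le> 1 / 4 * (r / (1 - r))" by simp
  have low: "1 / s - 1 \<le> r / (1 - r)"
  proof -
    have "1 - s \<le> r" using exp_ge_add_one_self[of "- s"] by (simp add: r_def)
    then have "1 / s \<le> 1 / (1 - r)" using r by (intro divide_left_mono) auto
    moreover have "r / (1 - r) = 1 / (1 - r) - 1" using r by (simp add: field_simps)
    ultimately show ?thesis by linarith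
  qed
  have g: "- 2 * (norm q / (1 - norm q) - Re (q / (1 - q))) \<le> - (3 / 2 * (1 / s - 1))"
  proof -
    have "R \<le> 1 / 4 * A \<Longrightarrow> S - 1 \<le> A \<Longrightarrow> - 2 * (A - R) \<le> - (3 / 2 * (S - 1))" for A R S :: real
      by argo
    from this[OF 1 low] show ?thesis unfolding nq .
  qed
  have "norm (op_gf q) \<le> norm (op_gf (of_real r)) * exp (- 2 * (norm q / (1 - norm q) - Re (q / (1 - q))))"
    using norm_op_gf_le[OF q1] unfolding nq .
  also have "\<dots> \<le> (sqrt s * exp (pi\<^sup>2 / (4 * s))) * exp (- (3 / 2 * (1 / s - 1)))"
    using norm_op_gf_real[OF s(1)] g s(1) by (intro mult_mono) (auto simp: r_def)
  also have "\<dots> = sqrt s * exp (pi\<^sup>2 / (4 * s) - 3 / 2 * (1 / s - 1))"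
    by (simp only: exp_diff exp_minus divide_inverse mult.assoc)
  finally show ?thesis unfolding q_def .
qed

section \<open>The main term: from the segment to the arc\<close>

lemma op_main_exp_holomorphic:
  "(\<lambda>t. op_main t * exp (of_nat n * t)) holomorphic_on {t. Re t > 0}"
  unfolding op_main_def by (intro holomorphic_intros) (auto simp: complex_nonpos_Reals_iff)

text \<open>Both curves join R cis (- pi/3) to R cis (pi/3) inside the right half-plane, which is
  convex, so a primitive of \<open>f\<close> gives both integrals. The common factor i of the two
  velocity vectors is divided out.\<close>

lemma segment_arc_integral:
  assumes f: "f holomorphic_on {t. Re t > 0}" and R: "R > 0"
  obtains I where "((\<lambda>x. f (Complex (R / 2) x)) has_integral I) {- (R * sqrt 3 / 2)..R * sqrt 3 / 2}"
    and "((\<lambda>\<phi>. f (of_real R * cis \<phi>) * (of_real R * cis \<phi>)) has_integral I) {- (pi / 3)..pi / 3}"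
proof -
  define H where "H = {t. Re t > 0}"
  have H: "convex H" "open H"
    unfolding H_def by (simp_all add: convex_halfspace_Re_gt open_halfspace_Re_gt)
  obtain P where P: "\<And>t. t \<in> H \<Longrightarrow> (P has_field_derivative f t) (at t within H)"
    using holomorphic_convex_primitive'[OF H] f unfolding H_def by blast
  have P: "(P has_field_derivative f t) (at t)" if "t \<in> H" for t
    using P[OF that] at_within_open[OF that H(2)] by simp
  define T where "T = R * sqrt 3 / 2"
  have 1: "((\<lambda>x. f (Complex (R / 2) x) * \<i>) has_integral (P (Complex (R / 2) T) - P (Complex (R / 2) (- T)))) {-T..T}"
  proof (rule fundamental_theorem_of_calculus)
    show "- T \<le> T" using R by (simp add: T_def)
    fix x :: real
    have c: "((\<lambda>x. Complex (R / 2) x) has_vector_derivative \<i>) (at x)"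
      unfolding Complex_eq by (auto intro!: derivative_eq_intros)
    have "Complex (R / 2) x \<in> H" using R by (simp add: H_def)
    from field_vector_diff_chain_at[OF c P[OF this]]
    show "((\<lambda>x. P (Complex (R / 2) x)) has_vector_derivative f (Complex (R / 2) x) * \<i>) (at x within {-T..T})"
      by (simp add: o_def mult.commute has_vector_derivative_at_within)
  qed
  have 2: "((\<lambda>\<phi>. f (of_real R * cis \<phi>) * (of_real R * cis \<phi>) * \<i>) has_integral (P (of_real R * cis (pi / 3)) - P (of_real R * cis (- (pi / 3))))) {- (pi / 3)..pi / 3}"
  proof (rule fundamental_theorem_of_calculus)
    fix x :: real assume x: "x \<in> {- (pi / 3)..pi / 3}"
    have "cos x > 0"
    proof (rule cos_gt_zero_pi)
      show "- (pi / 2) < x" "x < pi / 2" using x pi_gt_zero unfolding atLeastAtMost_iff by linarith+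
    qed
    then have "of_real R * cis x \<in> H" using R by (simp add: H_def)
    note D = P[OF this]
    have "((\<lambda>x. of_real R * cis x) has_vector_derivative of_real R * (\<i> * cis x)) (at x)"
      unfolding cis_conv_exp
      by (auto intro!: derivative_eq_intros has_vector_derivative_real_field simp: field_simps)
    from field_vector_diff_chain_at[OF this D]
    show "((\<lambda>x. P (of_real R * cis x)) has_vector_derivative f (of_real R * cis x) * (of_real R * cis x) * \<i>) (at x within {- (pi / 3)..pi / 3})"
      by (simp add: o_def mult_ac has_vector_derivative_at_within)
  qed simp
  have e: "of_real R * cis (pi / 3) = Complex (R / 2) T" "of_real R * cis (- (pi / 3)) = Complex (R / 2) (- T)"
    by (simp_all add: complex_eq_iff cos_60 sin_60 T_def)
  define I where "I = (P (Complex (R / 2) T) - P (Complex (R / 2) (- T))) * - \<i>"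
  show thesis
  proof (rule that[of I])
    show "((\<lambda>x. f (Complex (R / 2) x)) has_integral I) {- (R * sqrt 3 / 2)..R * sqrt 3 / 2}"
      using has_integral_mult_left[OF 1, of "- \<i>"] unfolding T_def[symmetric] I_def by (simp add: mult.assoc)
    show "((\<lambda>\<phi>. f (of_real R * cis \<phi>) * (of_real R * cis \<phi>)) has_integral I) {- (pi / 3)..pi / 3}"
      using has_integral_mult_left[OF 2, of "- \<i>"] unfolding e I_def by (simp add: mult.assoc)
  qed
qed

text \<open>The substitution \<open>y = 2 * sin (\<phi> / 2)\<close> turns the arc into a Gaussian integral.\<close>

lemma arc_integral_gaussian:
  fixes N :: real
  shows "((\<lambda>\<phi>. cos (3 * \<phi> / 2) * exp (2 * N * cos \<phi>)) has_integral
    exp (2 * N) * integral {-1..1} (\<lambda>y. (1 - y\<^sup>2) * exp (- (N * y\<^sup>2)))) {- (pi / 3)..pi / 3}"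
proof -
  define f where "f = (\<lambda>y::real. (1 - y\<^sup>2) * exp (- (N * y\<^sup>2)))"
  define g where "g = (\<lambda>\<phi>::real. 2 * sin (\<phi> / 2))"
  have "((\<lambda>\<phi>. cos (\<phi> / 2) *\<^sub>R f (g \<phi>)) has_integral integral {g (- (pi / 3))..g (pi / 3)} f) {- (pi / 3)..pi / 3}"
  proof (rule has_integral_substitution[where c = "-2" and d = 2])
    show "continuous_on {-2..2} f" unfolding f_def by (intro continuous_intros)
    show "(g has_real_derivative cos (x / 2)) (at x within {- (pi / 3)..pi / 3})" for x
      unfolding g_def by (auto intro!: derivative_eq_intros)
    show "g (- (pi / 3)) \<le> g (pi / 3)" by (simp add: g_def sin_30)
    show "g ` {- (pi / 3)..pi / 3} \<subseteq> {- 2..2}" by (auto simp: g_def)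
  qed simp
  then have "((\<lambda>\<phi>. cos (\<phi> / 2) * f (g \<phi>)) has_integral integral {-1..1} f) {- (pi / 3)..pi / 3}"
    by (simp add: g_def sin_30)
  from has_integral_mult_right[OF this, of "exp (2 * N)"]
  have "((\<lambda>\<phi>. exp (2 * N) * (cos (\<phi> / 2) * f (g \<phi>))) has_integral exp (2 * N) * integral {-1..1} f) {- (pi / 3)..pi / 3}" .
  also have "(\<lambda>\<phi>. exp (2 * N) * (cos (\<phi> / 2) * f (g \<phi>))) = (\<lambda>\<phi>. cos (3 * \<phi> / 2) * exp (2 * N * cos \<phi>))"
  proof
    fix \<phi> :: real
    define w where "w = \<phi> / 2"
    have w: "\<phi> = 2 * w" by (simp add: w_def)
    \<comment> \<open>Here cos w is the Jacobian of the substitution and the other factor is 1 -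
      y^2, the weight in the Gaussian integral. The exponent follows from cos (2 w) = 1 - y^2 /
      2.\<close>
    have c3: "cos (3 * w) = cos w * (1 - (2 * sin w)\<^sup>2)"
    proof -
      have h: "(2 * sin w)\<^sup>2 = 4 * (1 - (cos w)\<^sup>2)" by (simp add: power_mult_distrib sin_squared_eq)
      show ?thesis unfolding cos_treble_cos h by (simp add: power2_eq_square power3_eq_cube algebra_simps)
    qed
    have "exp (2 * N) * exp (- (N * (2 * sin w)\<^sup>2)) = exp (2 * N * cos (2 * w))"
      unfolding exp_add[symmetric] cos_double_sin by (simp add: power2_eq_square algebra_simps)
    then show "exp (2 * N) * (cos (\<phi> / 2) * f (g \<phi>)) = cos (3 * \<phi> / 2) * exp (2 * N * cos \<phi>)"
      unfolding w using c3 by (simp add: f_def g_def mult_ac)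
  qed
  finally show ?thesis by (simp add: f_def)
qed

text \<open>R satisfies pi^2 / (4 R) = n R = N. On the circle of radius R the exponent pi^2 / (4t) +
  n t is therefore N (cis (- phi) + cis phi), which is real. The remaining phase is half of phi from
  the square root and one phi from the line element.\<close>

lemma op_main_on_arc:
  assumes x: "x > 0" "real n = x\<^sup>2" and phi: "\<bar>\<phi>\<bar> \<le> pi / 3"
  defines "R \<equiv> pi / (2 * x)" and "N \<equiv> pi * x / 2"
  shows "op_main (of_real R * cis \<phi>) * exp (of_nat n * (of_real R * cis \<phi>)) * (of_real R * cis \<phi>)
    = of_real (R * sqrt R / (2 * sqrt pi) * exp (2 * N * cos \<phi>)) * cis (3 * \<phi> / 2)"
proof -
  have R: "R > 0" using x by (simp add: R_def)
  \<comment> \<open>A positive real part identifies the root with argument phi / 2 as the principal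
    one.\<close>
  have "cos (\<phi> / 2) > 0" by (rule cos_gt_zero_pi) (use phi pi_gt_zero in linarith)+
  then have s: "csqrt (of_real R * cis \<phi>) = of_real (sqrt R) * cis (\<phi> / 2)"
    using R by (intro csqrt_unique) (auto simp: power_mult_distrib Complex.DeMoivre simp flip: of_real_power)
  have "of_real (pi\<^sup>2) / (4 * (of_real R * cis \<phi>)) = of_real N * cis (- \<phi>)"
  proof -
    have "of_real (pi\<^sup>2) / (4 * (of_real R * cis \<phi>)) = of_real (pi\<^sup>2 / (4 * R)) * inverse (cis \<phi>)"
      by (simp add: field_simps)
    also have "pi\<^sup>2 / (4 * R) = N" using x by (simp add: R_def N_def power2_eq_square)
    finally show ?thesis by simp
  qed
  moreover have "of_nat n * (of_real R * cis \<phi>) = of_real N * cis \<phi>"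
  proof -
    have "real n * R = N" using x by (simp add: R_def N_def power2_eq_square)
    then have "of_nat n * complex_of_real R = of_real N" by (metis of_real_mult of_real_of_nat_eq)
    then show ?thesis by (simp only: mult.assoc[symmetric])
  qed
  ultimately have "exp (of_real (pi\<^sup>2) / (4 * (of_real R * cis \<phi>))) * exp (of_nat n * (of_real R * cis \<phi>)) = exp (of_real N * cis (- \<phi>) + of_real N * cis \<phi>)"
    by (simp only: exp_add)
  also have "of_real N * cis (- \<phi>) + of_real N * cis \<phi> = of_real (2 * N * cos \<phi>)"
    by (simp add: complex_eq_iff)
  finally have e: "exp (of_real (pi\<^sup>2) / (4 * (of_real R * cis \<phi>))) * exp (of_nat n * (of_real R * cis \<phi>)) = of_real (exp (2 * N * cos \<phi>))"
    by (simp only: exp_of_real)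
  have c: "cis (\<phi> / 2) * cis \<phi> = cis (3 * \<phi> / 2)" by (simp add: cis_mult)
  have "op_main (of_real R * cis \<phi>) * exp (of_nat n * (of_real R * cis \<phi>)) * (of_real R * cis \<phi>)
    = (of_real (sqrt R) * cis (\<phi> / 2)) * (exp (of_real (pi\<^sup>2) / (4 * (of_real R * cis \<phi>))) * exp (of_nat n * (of_real R * cis \<phi>))) * (of_real R * cis \<phi>) / (2 * of_real (sqrt pi))"
    unfolding op_main_def s by (simp add: mult_ac)
  also have "\<dots> = of_real (R * sqrt R / (2 * sqrt pi) * exp (2 * N * cos \<phi>)) * (cis (\<phi> / 2) * cis \<phi>)"
    unfolding e by (simp add: field_simps)
  finally show ?thesis unfolding c .
qed

text \<open>The leading term (1 / (2 pi)) d/dn (sinh (pi sqrt n) / sqrt n) of Zuckerman's exact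
  series, with the part containing exp (- pi sqrt n) left out.\<close>

definition op_asymp :: "nat \<Rightarrow> real" where
  "op_asymp n = exp (pi * sqrt (real n)) / (8 * real n) * (1 - 1 / (pi * sqrt (real n)))"

text \<open>The error is exp (2 N) times the truncation error exp (- N) of the Gaussian integral,
  where N = pi x / 2. The hypothesis x >= 2 gives R <= 1 and N >= 1, so that the remaining factors
  are at most 1.\<close>

lemma main_integral:
  assumes n: "real n = x\<^sup>2" and x: "x \<ge> 2"
  obtains I where "((\<lambda>y. op_main (Complex (pi / (4 * x)) y) * exp (of_nat n * Complex (pi / (4 * x)) y)) has_integral I)
      {- (pi / (4 * x) * sqrt 3)..pi / (4 * x) * sqrt 3}"
    and "\<bar>Re I - 2 * pi * op_asymp n\<bar> \<le> exp (pi * x / 2)"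
proof -
  define R where "R = pi / (2 * x)"
  define N where "N = pi * x / 2"
  define K where "K = R * sqrt R / (2 * sqrt pi)"
  define W where "W = integral {-1..1} (\<lambda>y. (1 - y\<^sup>2) * exp (- (N * y\<^sup>2)))"
  have R: "R > 0" "R \<le> 1" using x pi_less_4 by (auto simp: R_def)
  have "2 * 1 \<le> pi * x" using x pi_ge_two by (intro mult_mono) auto
  then have N: "N \<ge> 1" by (simp add: N_def)
  obtain I where I1: "((\<lambda>y. op_main (Complex (R / 2) y) * exp (of_nat n * Complex (R / 2) y)) has_integral I) {- (R * sqrt 3 / 2)..R * sqrt 3 / 2}"
    and I2: "((\<lambda>\<phi>. op_main (of_real R * cis \<phi>) * exp (of_nat n * (of_real R * cis \<phi>)) * (of_real R * cis \<phi>)) has_integral I) {- (pi / 3)..pi / 3}"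
    by (rule segment_arc_integral[OF op_main_exp_holomorphic[of n] R(1)])
  have "((\<lambda>\<phi>. of_real (K * exp (2 * N * cos \<phi>)) * cis (3 * \<phi> / 2)) has_integral I) {- (pi / 3)..pi / 3}"
    by (rule has_integral_eq[OF _ I2], subst op_main_on_arc[OF _ n, folded R_def N_def])
       (use x in \<open>auto simp: K_def abs_le_iff\<close>)
  from has_integral_linear[OF this bounded_linear_Re]
  have a: "((\<lambda>\<phi>. K * (cos (3 * \<phi> / 2) * exp (2 * N * cos \<phi>))) has_integral Re I) {- (pi / 3)..pi / 3}"
    by (simp add: o_def mult_ac)
  have ReI: "Re I = K * (exp (2 * N) * W)"
    using has_integral_unique[OF a has_integral_mult_right[OF arc_integral_gaussian]] by (simp add: W_def)
  have "K * exp (2 * N) * (sqrt (pi / N) * (1 - 1 / (2 * N))) = 2 * pi * op_asymp n"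
  proof -
    have sx: "sqrt (real n) = x" using n x by simp
    have "R / N = (1 / x)\<^sup>2" using x by (simp add: R_def N_def power2_eq_square)
    then have "sqrt R / sqrt N = 1 / x" using x by (metis real_sqrt_divide real_sqrt_unique zero_le_divide_1_iff order_trans zero_le_numeral)
    moreover have "K * sqrt (pi / N) = R / 2 * (sqrt R / sqrt N)"
      by (simp add: K_def real_sqrt_divide)
    ultimately have "K * sqrt (pi / N) = 2 * pi / (8 * x\<^sup>2)"
      by (simp add: R_def power2_eq_square)
    moreover have "exp (2 * N) * (1 - 1 / (2 * N)) = exp (pi * x) * (1 - 1 / (pi * x))" by (simp add: N_def)
    moreover have "K * exp (2 * N) * (sqrt (pi / N) * (1 - 1 / (2 * N))) = (K * sqrt (pi / N)) * (exp (2 * N) * (1 - 1 / (2 * N)))"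
      by (simp only: mult_ac)
    ultimately show ?thesis unfolding op_asymp_def sx unfolding n by simp
  qed
  then have "Re I - 2 * pi * op_asymp n = K * exp (2 * N) * (W - sqrt (pi / N) * (1 - 1 / (2 * N)))"
    unfolding ReI by (simp add: algebra_simps)
  then have "\<bar>Re I - 2 * pi * op_asymp n\<bar> = K * exp (2 * N) * \<bar>W - sqrt (pi / N) * (1 - 1 / (2 * N))\<bar>"
    using R by (simp add: abs_mult K_def)
  also have "\<dots> \<le> 1 * exp (2 * N) * (exp (- N) / 1)"
  proof (intro mult_mono)
    have "R * sqrt R \<le> 1 * 1" using R by (intro mult_mono) auto
    moreover have "1 \<le> 2 * sqrt pi" using pi_ge_two real_sqrt_ge_1_iff[of pi] by linarith
    ultimately show "K \<le> 1" unfolding K_def by (simp add: divide_le_eq)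
    have "\<bar>W - sqrt (pi / N) * (1 - 1 / (2 * N))\<bar> \<le> exp (- N) / N"
      unfolding W_def by (rule gaussian_weighted_segment[OF N])
    also have "\<dots> \<le> exp (- N) / 1" using N by (intro divide_left_mono) auto
    finally show "\<bar>W - sqrt (pi / N) * (1 - 1 / (2 * N))\<bar> \<le> exp (- N) / 1" .
  qed (use R in \<open>auto simp: K_def\<close>)
  also have "\<dots> = exp (pi * x / 2)" by (simp add: N_def flip: exp_add)
  finally have "\<bar>Re I - 2 * pi * op_asymp n\<bar> \<le> exp (pi * x / 2)" .
  moreover have "R / 2 = pi / (4 * x)" "R * sqrt 3 / 2 = pi / (4 * x) * sqrt 3" by (simp_all add: R_def)
  ultimately show thesis using that[of I] I1 by simp
qed

section \<open>Estimates on the line of integration\<close>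

lemma three_le_exp_2: "(3::real) \<le> exp 2"
  using exp_ge_add_one_self[of "2::real"] by simp

text \<open>The line of integration has abscissa \<open>s\<close>, half the saddle point \<open>pi / (2 * x)\<close>; the circle around 0
  through the saddle point meets it at height \<open>T\<close>.\<close>

context
  fixes n :: nat and x s T :: real
  assumes n: "real n = x\<^sup>2" and x: "x \<ge> 20"
  defines "s \<equiv> pi / (4 * x)" and "T \<equiv> s * sqrt 3"
begin

lemma s_bounds: "0 < s" "s \<le> 1 / 25" "1 / s = 4 * x / pi" "pi\<^sup>2 / (4 * s) = pi * x" "real n * s = pi * x / 4"
proof -
  show "0 < s" "1 / s = 4 * x / pi" "pi\<^sup>2 / (4 * s) = pi * x" "real n * s = pi * x / 4"
    using x by (simp_all add: s_def n power2_eq_square)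
  have "pi \<le> 3.2" using pi_approx by simp
  then show "s \<le> 1 / 25" using x by (simp add: s_def divide_le_eq)
qed

lemma norm_exp_n: "norm (exp (of_nat n * Complex s y)) = exp (pi * x / 4)"
  using s_bounds(5) by simp

lemma Re_inverse_segment: "Re (1 / Complex s y) = s / (s\<^sup>2 + y\<^sup>2)"
  by (simp add: Re_divide)

lemma pi_x_ge: "pi * x \<ge> 60"
proof -
  have "3 * 20 \<le> pi * x" using x pi_approx by (intro mult_mono) auto
  then show ?thesis by simp
qed

lemma op_gf_near:
  assumes y: "\<bar>y\<bar> \<le> 5 * s"
  shows "norm (op_gf (exp (- Complex s y)) - op_main (Complex s y)) \<le> 2"
    and "norm (Complex s y) \<le> 1"
proof -
  note sb = s_bounds
  have "\<bar>y\<bar>\<^sup>2 \<le> (5 * s)\<^sup>2" using y by (intro power_mono) auto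
  then have y2: "y\<^sup>2 \<le> (5 * s)\<^sup>2" by (simp only: power2_abs)
  \<comment> \<open>26 = 1 + 5^2 comes from |y| <= 5 s. As s <= 1/25, the resulting lower bound for
    Re (1/t) satisfies the hypothesis of \<open>op_gf_approx\<close> with room to spare.\<close>
  have "1 / (26 * s) = s / (s\<^sup>2 + (5 * s)\<^sup>2)" using sb by (simp add: power2_eq_square field_simps)
  also have "\<dots> \<le> s / (s\<^sup>2 + y\<^sup>2)"
    using y2 sb by (intro divide_left_mono mult_pos_pos add_left_mono) (auto intro: add_pos_nonneg)
  finally have r: "1 / (26 * s) \<le> Re (1 / Complex s y)" unfolding Re_inverse_segment .
  have "3 * 3 \<le> pi * pi" using pi_approx by (intro mult_mono) auto
  then have "1 \<le> pi\<^sup>2 * (1 / (26 * s))" using sb by (simp add: power2_eq_square le_divide_eq)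
  also have "\<dots> \<le> pi\<^sup>2 * Re (1 / Complex s y)" using r by (intro mult_left_mono) auto
  finally have a: "norm (op_gf (exp (- Complex s y)) - op_main (Complex s y)) \<le> 2 * sqrt (norm (Complex s y))"
    using sb by (intro op_gf_approx) auto
  show nt: "norm (Complex s y) \<le> 1"
    using cmod_le[of "Complex s y"] y sb by simp
  have "sqrt (norm (Complex s y)) \<le> 1" using nt by simp
  then show "norm (op_gf (exp (- Complex s y)) - op_main (Complex s y)) \<le> 2" using a by linarith
qed

lemma integrand_major:
  assumes y: "\<bar>y\<bar> \<le> 5 * s"
  shows "norm (op_gf (exp (- Complex s y)) * exp (of_nat n * Complex s y) - op_main (Complex s y) * exp (of_nat n * Complex s y))
    \<le> 2 * exp (pi * x / 4)"
proof -
  have "op_gf (exp (- Complex s y)) * exp (of_nat n * Complex s y) - op_main (Complex s y) * exp (of_nat n * Complex s y)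
    = (op_gf (exp (- Complex s y)) - op_main (Complex s y)) * exp (of_nat n * Complex s y)"
    by (simp add: algebra_simps)
  then show ?thesis
    unfolding norm_mult norm_exp_n using op_gf_near(1)[OF y] by (metis exp_ge_zero mult_right_mono norm_mult norm_exp_n)
qed

text \<open>For |y| > T the point t lies outside the circle, |t| > 2 s, hence Re (1/t) <= 1 / (4 s).
  So \<open>op_main\<close> contributes at most exp (pi x / 4), as does the factor exp (n t).
  Nothing has to be subtracted on this range.\<close>

lemma integrand_intermediate:
  assumes y: "\<bar>y\<bar> \<le> 5 * s" "T < \<bar>y\<bar>"
  shows "norm (op_gf (exp (- Complex s y)) * exp (of_nat n * Complex s y)) \<le> 3 * exp (pi * x / 2)"
proof -
  note sb = s_bounds
  have "T\<^sup>2 \<le> \<bar>y\<bar>\<^sup>2" using y(2) sb by (intro power_mono) (auto simp: T_def)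
  then have "3 * s\<^sup>2 \<le> y\<^sup>2" by (simp add: T_def power_mult_distrib)
  then have "Re (1 / Complex s y) \<le> s / (4 * s\<^sup>2)"
    unfolding Re_inverse_segment using sb by (intro divide_left_mono mult_pos_pos) (auto intro: add_pos_nonneg)
  also have "\<dots> = x / pi" using sb x by (simp add: s_def power2_eq_square)
  finally have r: "pi\<^sup>2 / 4 * Re (1 / Complex s y) \<le> pi\<^sup>2 / 4 * (x / pi)" by (intro mult_left_mono) auto
  have "norm (op_main (Complex s y)) \<le> 1 * exp (pi * x / 4) / 1"
    unfolding norm_op_main
  proof (intro frac_le mult_mono)
    show "sqrt (norm (Complex s y)) \<le> 1" using op_gf_near(2)[OF y(1)] by simp
    show "exp (pi\<^sup>2 / 4 * Re (1 / Complex s y)) \<le> exp (pi * x / 4)" using r by (simp add: power2_eq_square)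
    have "1 \<le> sqrt pi" using pi_ge_two by simp
    then show "1 \<le> 2 * sqrt pi" by linarith
  qed auto
  then have "norm (op_gf (exp (- Complex s y))) \<le> exp (pi * x / 4) + 2"
    using op_gf_near(1)[OF y(1)] norm_triangle_ineq2[of "op_gf (exp (- Complex s y))" "op_main (Complex s y)"] by linarith
  also have "\<dots> \<le> 3 * exp (pi * x / 4)" using pi_x_ge by simp
  finally have "norm (op_gf (exp (- Complex s y))) * exp (pi * x / 4) \<le> 3 * exp (pi * x / 4) * exp (pi * x / 4)"
    by (intro mult_right_mono) auto
  also have "\<dots> = 3 * exp (pi * x / 2)" unfolding mult.assoc exp_add[symmetric] by simp
  finally show ?thesis unfolding norm_mult norm_exp_n .
qed

lemma integrand_minor:
  assumes y: "5 * s \<le> \<bar>y\<bar>" "\<bar>y\<bar> \<le> pi"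
  shows "norm (op_gf (exp (- Complex s y)) * exp (of_nat n * Complex s y)) \<le> exp (2 * pi * x / 3)"
proof -
  note sb = s_bounds
  \<comment> \<open>The exponents require x (6/pi - 7 pi/12) >= 3/2, where 7/12 = 1 + 1/4 - 2/3. The
    margin 0.075 meets this exactly at x = 20, which is where the threshold 400 is needed.\<close>
  have "0.075 \<le> 6 / pi - 7 * pi / 12"
  proof -
    have p: "pi \<le> 3.1416" using pi_approx by simp
    have "6 / 3.1416 \<le> 6 / pi" using p by (intro divide_left_mono) auto
    then show ?thesis using p by simp
  qed
  then have "20 * 0.075 \<le> x * (6 / pi - 7 * pi / 12)" using x by (intro mult_mono) auto
  then have ex: "pi * x - 3 / 2 * (4 * x / pi - 1) + pi * x / 4 \<le> 2 * pi * x / 3"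
    by (simp add: right_diff_distrib)
  have "norm (op_gf (exp (- Complex s y))) \<le> sqrt s * exp (pi * x - 3 / 2 * (4 * x / pi - 1))"
    using op_gf_minor_arc[OF sb(1,2) y] unfolding sb(3,4) .
  also have "\<dots> \<le> 1 * exp (pi * x - 3 / 2 * (4 * x / pi - 1))"
    using sb by (intro mult_right_mono) auto
  finally have "norm (op_gf (exp (- Complex s y))) * exp (pi * x / 4) \<le> exp (pi * x - 3 / 2 * (4 * x / pi - 1)) * exp (pi * x / 4)"
    by (intro mult_right_mono) auto
  also have "\<dots> \<le> exp (2 * pi * x / 3)" unfolding exp_add[symmetric] using ex by simp
  finally show ?thesis unfolding norm_mult norm_exp_n .
qed

text \<open>The main term is subtracted only on [-T, T], the part of the line that can be bent into
  the arc. The errors on the three ranges have exponents pi x / 4, pi x / 2 and 2 pi x / 3; the last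
  one decides.\<close>

lemma integrand_bound:
  assumes y: "\<bar>y\<bar> \<le> pi"
  shows "norm (op_gf (exp (- Complex s y)) * exp (of_nat n * Complex s y)
    - (if y \<in> {-T..T} then op_main (Complex s y) * exp (of_nat n * Complex s y) else 0)) \<le> exp (2 * pi * x / 3)"
proof -
  note sb = s_bounds
  have T5: "T \<le> 5 * s"
  proof -
    have "sqrt 3 \<le> 5" by (rule real_le_lsqrt) auto
    then show ?thesis using sb by (simp add: T_def mult.commute)
  qed
  have E1: "3 * exp (pi * x / 2) \<le> exp (2 * pi * x / 3)"
  proof -
    have "3 * exp (pi * x / 2) \<le> exp (pi * x / 6) * exp (pi * x / 2)"
      using pi_x_ge three_le_exp_2 by (intro mult_right_mono) (auto intro: order_trans)
    also have "\<dots> = exp (2 * pi * x / 3)" by (simp add: exp_add[symmetric] field_simps)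
    finally show ?thesis .
  qed
  have E2: "2 * exp (pi * x / 4) \<le> 3 * exp (pi * x / 2)" 
  proof -
    have "exp (pi * x / 4) \<le> exp (pi * x / 2)" using pi_x_ge unfolding exp_le_cancel_iff by linarith
    moreover have "0 < exp (pi * x / 2)" by simp
    ultimately show ?thesis by linarith
  qed
  consider "\<bar>y\<bar> \<le> T" | "T < \<bar>y\<bar>" "\<bar>y\<bar> \<le> 5 * s" | "T < \<bar>y\<bar>" "5 * s \<le> \<bar>y\<bar>" by linarith
  then show ?thesis
  proof cases
    case 1
    then have "y \<in> {-T..T}" by auto
    then show ?thesis using integrand_major[of y] 1 T5 E1 E2 by (simp only: if_True) simp
  next
    case 2
    then have "y \<notin> {-T..T}" by auto
    then show ?thesis using integrand_intermediate[of y] 2 E1 by (simp only: if_False diff_zero) simp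
  next
    case 3
    then have "y \<notin> {-T..T}" by auto
    then show ?thesis using integrand_minor[of y] 3 y by (simp only: if_False diff_zero)
  qed
qed

lemma overpartitions_asymp_aux: "\<bar>real (overpartitions n) - op_asymp n\<bar> \<le> 2 * exp (2 * pi * x / 3)"
proof -
  note sb = s_bounds
  define E where "E = exp (2 * pi * x / 3)"
  obtain I where I: "((\<lambda>y. op_main (Complex s y) * exp (of_nat n * Complex s y)) has_integral I) {-T..T}"
    and ReI: "\<bar>Re I - 2 * pi * op_asymp n\<bar> \<le> exp (pi * x / 2)"
    using main_integral[OF n] x unfolding s_def T_def by auto
  have Tpi: "{-T..T} \<subseteq> {-pi..pi}"
  proof -
    have "sqrt 3 \<le> 5" by (rule real_le_lsqrt) auto
    then have "s * sqrt 3 \<le> 1 / 25 * 5" using sb by (intro mult_mono) auto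
    then show ?thesis using pi_ge_two by (auto simp: T_def)
  qed
  have "((\<lambda>y. op_gf (exp (- Complex s y)) * exp (of_nat n * Complex s y)
    - (if y \<in> {-T..T} then op_main (Complex s y) * exp (of_nat n * Complex s y) else 0)) has_integral
      (2 * pi * real (overpartitions n) - I)) {-pi..pi}"
    by (rule has_integral_diff[OF op_gf_coefficient[OF sb(1)] has_integral_restrict[THEN iffD2, OF Tpi I]])
  then have "norm (of_real (2 * pi * real (overpartitions n)) - I) \<le> E * measure lborel {-pi..pi}"
    by (intro has_integral_bound_real[where B = E]) (use integrand_bound in \<open>auto simp: E_def abs_le_iff\<close>)
  then have "norm (of_real (2 * pi * real (overpartitions n)) - I) \<le> E * (2 * pi)" by simp
  moreover have "\<bar>2 * pi * real (overpartitions n) - Re I\<bar> \<le> norm (of_real (2 * pi * real (overpartitions n)) - I)"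
    using abs_Re_le_cmod[of "of_real (2 * pi * real (overpartitions n)) - I"] by simp
  moreover have "exp (pi * x / 2) \<le> E * (2 * pi)"
  proof -
    have "exp (pi * x / 2) \<le> E * 1" using x by (simp add: E_def)
    also have "\<dots> \<le> E * (2 * pi)" using pi_ge_two by (intro mult_left_mono) (auto simp: E_def)
    finally show ?thesis .
  qed
  \<comment> \<open>One copy of E (2 pi) is the pointwise bound times the length of the interval,
    the other absorbs the error of \<open>main_integral\<close>.\<close>
  ultimately have "\<bar>2 * pi * real (overpartitions n) - 2 * pi * op_asymp n\<bar> \<le> 2 * (E * (2 * pi))"
    using ReI by linarith
  also have "2 * pi * real (overpartitions n) - 2 * pi * op_asymp n = 2 * pi * (real (overpartitions n) - op_asymp n)"
    by (simp add: algebra_simps)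
  finally have "2 * pi * \<bar>real (overpartitions n) - op_asymp n\<bar> \<le> 2 * pi * (2 * E)"
    by (simp add: abs_mult)
  then show ?thesis unfolding E_def using pi_gt_zero by (simp only: mult_le_cancel_left_pos mult_pos_pos zero_less_numeral)
qed

end

theorem overpartitions_asymp:
  assumes "n \<ge> 400"
  shows "\<bar>real (overpartitions n) - op_asymp n\<bar> \<le> 2 * exp (2 * pi * sqrt (real n) / 3)"
proof (rule overpartitions_asymp_aux)
  show "20 \<le> sqrt (real n)" using assms by (intro real_le_rsqrt) simp
qed simp

section \<open>Large arguments\<close>

lemma power4_le_exp:
  fixes x :: real
  assumes "x \<ge> 20"
  shows "x ^ 4 \<le> 160000 * exp (x - 20)"
proof -
  have "x / 20 \<le> exp ((x - 20) / 20)" using exp_ge_add_one_self[of "(x - 20) / 20"] by (simp add: field_simps)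
  then have "(x / 20) ^ 4 \<le> exp ((x - 20) / 20) ^ 4" using assms by (intro power_mono) auto
  also have "\<dots> = exp ((x - 20) / 5)" by (simp add: exp_of_nat_mult[symmetric])
  also have "\<dots> \<le> exp (x - 20)" using assms by simp
  finally show ?thesis by (simp add: power_divide)
qed

text \<open>Converts the additive error into a relative error 3 / (1000 x^2): with 1 - 1/(pi x) >=
  0.98 this takes exp (pi x / 3) >= 16000 / (3 * 0.98) x^4, roughly 5442 x^4. Since pi / 3 exceeds
  1.047, the exponent is at least x + 0.94 for x >= 20.\<close>

lemma exp_pi_third_ge:
  fixes x :: real
  assumes "x \<ge> 20"
  shows "5900 * x ^ 4 \<le> exp (pi * x / 3)"
proof -
  \<comment> \<open>41/32 is the quadratic Taylor polynomial of exp at 1/4.\<close>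
  have "(41 / 32 :: real) \<le> exp (1 / 4)"
    using exp_lower_Taylor_quadratic[of "1 / 4 :: real"] by (simp add: power2_eq_square)
  then have "(41 / 32 :: real) ^ 80 \<le> exp (1 / 4) ^ 80" by (intro power_mono) auto
  also have "\<dots> = exp (20 :: real)" by (simp add: exp_of_nat_mult[symmetric])
  finally have "(41 / 32 :: real) ^ 80 \<le> exp (20 :: real)" .
  moreover have "400000000 \<le> (41 / 32 :: real) ^ 80" by (simp add: power_divide)
  ultimately have e20: "400000000 \<le> exp (20 :: real)" by (rule order_trans[rotated])
  have e94: "(238 / 100) \<le> exp ((94 / 100) :: real)"
    using exp_lower_Taylor_quadratic[of "(94 / 100) :: real"] by (simp add: power2_eq_square)
  have "5900 * x ^ 4 \<le> 5900 * (160000 * exp (x - 20))"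
    using power4_le_exp[OF assms] by (intro mult_left_mono) auto
  also have "\<dots> \<le> (400000000 * (238 / 100)) * exp (x - 20)" by simp
  also have "\<dots> \<le> (exp 20 * exp (94 / 100)) * exp (x - 20)"
    using e20 e94 by (intro mult_right_mono mult_mono) auto
  also have "\<dots> = exp (x + (94 / 100))" by (simp add: exp_add[symmetric])
  also have "\<dots> \<le> exp (pi * x / 3)"
  proof -
    have "(3141 / 1000) * x \<le> pi * x" using assms pi_approx by (intro mult_right_mono) auto
    then show ?thesis using assms unfolding exp_le_cancel_iff by linarith
  qed
  finally show ?thesis .
qed

text \<open>The constant is tailored to \<open>ratio_large\<close>: there an error d = 3 / (1000 n)
  gets multiplied by at most 3 and must stay below 13 / (1000 n).\<close>

lemma op_asymp_relative:
  assumes "n \<ge> 400"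
  shows "\<bar>real (overpartitions n) - op_asymp n\<bar> \<le> 3 / 1000 / real n * op_asymp n" and "op_asymp n > 0"
proof -
  define x where "x = sqrt (real n)"
  have x: "x \<ge> 20" using assms unfolding x_def by (intro real_le_rsqrt) simp
  have n: "real n = x\<^sup>2" by (simp add: x_def)
  have "3 * 20 \<le> pi * x" using x pi_approx by (intro mult_mono) auto
  then have c: "(98 / 100) \<le> 1 - 1 / (pi * x)" by (simp add: field_simps)
  show "op_asymp n > 0"
    unfolding op_asymp_def x_def[symmetric] using c x assms by (intro mult_pos_pos divide_pos_pos) auto
  have "2 * exp (2 * pi * x / 3) * (8 * 1000 * x\<^sup>2 * x\<^sup>2) \<le> 3 * (98 / 100) * (exp (2 * pi * x / 3) * (5900 * x ^ 4))"
  proof -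
    have "0 \<le> exp (2 * pi * x / 3) * x ^ 4" by simp
    moreover have "x\<^sup>2 * x\<^sup>2 = x ^ 4" by (simp add: power2_eq_square power4_eq_xxxx)
    ultimately show ?thesis by (simp add: mult.assoc)
  qed
  also have "\<dots> \<le> 3 * (98 / 100) * (exp (2 * pi * x / 3) * exp (pi * x / 3))"
    using exp_pi_third_ge[OF x] by (intro mult_left_mono) auto
  also have "\<dots> = 3 * (98 / 100) * exp (pi * x)"
    by (simp add: exp_add[symmetric] field_simps)
  also have "\<dots> \<le> 3 * (1 - 1 / (pi * x)) * exp (pi * x)"
    using c by (intro mult_right_mono mult_left_mono) auto
  finally have "2 * exp (2 * pi * x / 3) * (8 * 1000 * x\<^sup>2 * x\<^sup>2) \<le> 3 * (1 - 1 / (pi * x)) * exp (pi * x)" .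
  then have "2 * exp (2 * pi * x / 3) \<le> 3 * (1 - 1 / (pi * x)) * exp (pi * x) / (8 * 1000 * x\<^sup>2 * x\<^sup>2)"
    using x by (subst le_divide_eq) auto
  also have "\<dots> = 3 / 1000 / real n * op_asymp n"
  proof -
    have "3 * k * e / (8 * 1000 * x\<^sup>2 * x\<^sup>2) = 3 / 1000 / x\<^sup>2 * (e / (8 * x\<^sup>2) * k)" for k e
      by (simp add: power2_eq_square mult_ac)
    then show ?thesis unfolding op_asymp_def x_def[symmetric] unfolding n .
  qed
  finally show "\<bar>real (overpartitions n) - op_asymp n\<bar> \<le> 3 / 1000 / real n * op_asymp n"
    using overpartitions_asymp[OF assms] unfolding x_def[symmetric] by linarith
qed

lemma exp_le_cubic:
  fixes u :: real
  assumes "0 \<le> u" "u \<le> 1 / 10"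
  shows "exp u \<le> 1 + u + u\<^sup>2 / 2 + u ^ 3 / 5"
proof -
  obtain t where t: "\<bar>t\<bar> \<le> \<bar>u\<bar>" "exp u = (\<Sum>m<3. u ^ m / fact m) + exp t / fact 3 * u ^ 3"
    using Maclaurin_exp_le[of u 3] by blast
  have "exp t \<le> exp (1 / 10)" using t assms by simp
  also have "\<dots> \<le> 1 + 1 / 10 + (1 / 10)\<^sup>2" by (rule exp_bound) auto
  also have "\<dots> \<le> 6 / 5" by (simp add: power2_eq_square)
  finally have "exp t / 6 * u ^ 3 \<le> 1 / 5 * u ^ 3" using assms by (intro mult_right_mono) auto
  then show ?thesis unfolding t(2) by (simp add: numeral_3_eq_3 power2_eq_square fact_numeral)
qed

section \<open>The quotient of consecutive main terms, expanded in v = 1 / x\<close>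

definition asymp_ratio :: "real \<Rightarrow> real \<Rightarrow> real" where
  "asymp_ratio x y = exp (pi * (y - x)) * (1 / (1 + (1 / x)\<^sup>2)) * ((1 - 1 / (pi * y)) / (1 - 1 / (pi * x)))"

context
  fixes x y v p :: real
  assumes x: "x \<ge> 20" and y: "y\<^sup>2 = x\<^sup>2 + 1" "y > 0"
  defines "v \<equiv> 1 / x" and "p \<equiv> pi / 2"
begin

lemma v_p_bounds: "0 < v" "v \<le> 1 / 20" "(15707 / 10000) \<le> p" "p \<le> (15708 / 10000)" "x * v = 1"
  using x pi_approx by (simp_all add: v_def p_def field_simps)

lemma gap_upper: "0 \<le> y - x" "y - x \<le> v / 2"
proof -
  have "x\<^sup>2 \<le> y\<^sup>2" using y by simp
  then have "x \<le> y" by (rule power2_le_imp_le) (use y in simp)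
  then show "0 \<le> y - x" by simp
  have "(x + v / 2)\<^sup>2 = x\<^sup>2 + 1 + (v / 2)\<^sup>2"
    using v_p_bounds(5) by (simp add: power2_eq_square algebra_simps)
  then have "y\<^sup>2 \<le> (x + v / 2)\<^sup>2" using y by simp
  then have "y \<le> x + v / 2" by (rule power2_le_imp_le) (use x v_p_bounds in auto)
  then show "y - x \<le> v / 2" by simp
qed

text \<open>v/2 - v^3/8 is the beginning of the expansion of sqrt (x^2 + 1) - x. Added to x and
  squared, it stays below x^2 + 1 because x v = 1.\<close>

lemma gap_lower: "v / 2 - v ^ 3 / 8 \<le> y - x"
proof -
  have v3: "v ^ 3 = v * v\<^sup>2" by (simp add: power2_eq_square power3_eq_cube)
  have vv: "v\<^sup>2 \<le> 1" using v_p_bounds by (simp add: power_le_one)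
  have "(x + (v / 2 - v ^ 3 / 8))\<^sup>2 = x\<^sup>2 + x * v * (1 - v\<^sup>2 / 4) + (v / 2)\<^sup>2 * (1 - v\<^sup>2 / 4)\<^sup>2"
    unfolding v3 by (simp add: power2_eq_square algebra_simps)
  also have "\<dots> \<le> x\<^sup>2 + 1 * (1 - v\<^sup>2 / 4) + (v / 2)\<^sup>2 * 1"
    using vv by (intro add_mono mult_mono) (auto simp: v_p_bounds power_le_one)
  also have "\<dots> = y\<^sup>2" using y by (simp add: power2_eq_square)
  finally have "x + (v / 2 - v ^ 3 / 8) \<le> y" by (rule power2_le_imp_le) (use y in simp)
  then show ?thesis by simp
qed

text \<open>The correction changes the quotient only in third order: 1/(pi x) - 1/(pi y) = (y-x) v /
  (pi y) is at most v^3 / (2 pi) <= v^3 / 6, and 0.17 is slightly more than (1/6) (60/59).\<close>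

lemma correction_factor_bounds: "1 \<le> (1 - 1 / (pi * y)) / (1 - 1 / (pi * x))"
  "(1 - 1 / (pi * y)) / (1 - 1 / (pi * x)) \<le> 1 + (17 / 100) * v ^ 3"
proof -
  have xy: "x \<le> y" using gap_upper by simp
  have "3 * 20 \<le> pi * x" using x pi_approx by (intro mult_mono) auto
  then have dx: "1 - 1 / (pi * x) \<ge> 59 / 60" by (simp add: field_simps)
  have "1 / (pi * y) \<le> 1 / (pi * x)" using xy x by (intro divide_left_mono mult_left_mono) auto
  then show "1 \<le> (1 - 1 / (pi * y)) / (1 - 1 / (pi * x))" using dx by (simp add: le_divide_eq)
  have "1 / (pi * x) - 1 / (pi * y) = (y - x) * v / (pi * y)"
    using x y by (simp add: v_def field_simps)
  also have "\<dots> \<le> (v / 2) * v / (pi * x)"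
    using gap_upper v_p_bounds x xy by (intro frac_le mult_mono) auto
  also have "\<dots> = v ^ 3 / (2 * pi)" by (simp add: v_def power3_eq_cube)
  also have "\<dots> \<le> v ^ 3 / 6" using pi_approx v_p_bounds by (intro divide_left_mono) auto
  also have "\<dots> \<le> (59 / 60) * ((17 / 100) * v ^ 3)" using v_p_bounds by simp
  also have "\<dots> \<le> (1 - 1 / (pi * x)) * ((17 / 100) * v ^ 3)" using dx v_p_bounds by (intro mult_right_mono) auto
  finally have f: "1 / (pi * x) - 1 / (pi * y) \<le> (1 - 1 / (pi * x)) * ((17 / 100) * v ^ 3)" .
  have "(1 + c) * (1 - b) = (1 - b) + (1 - b) * c" for b c :: real by (simp add: algebra_simps)
  then have "1 - 1 / (pi * y) \<le> (1 + (17 / 100) * v ^ 3) * (1 - 1 / (pi * x))" using f by argo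
  then show "(1 - 1 / (pi * y)) / (1 - 1 / (pi * x)) \<le> 1 + (17 / 100) * v ^ 3"
    by (subst pos_divide_le_eq) (use dx in linarith)+
qed

lemma v_powers: "v ^ 3 \<le> v\<^sup>2 / 20" "v ^ 4 \<le> v ^ 3 / 20" "0 \<le> v\<^sup>2" "0 \<le> v ^ 3" "0 \<le> v ^ 4"
proof -
  have "v * v\<^sup>2 \<le> 1 / 20 * v\<^sup>2" "v * v ^ 3 \<le> 1 / 20 * v ^ 3"
    using v_p_bounds by (intro mult_right_mono; simp)+
  then show "v ^ 3 \<le> v\<^sup>2 / 20" "v ^ 4 \<le> v ^ 3 / 20"
    by (simp_all add: power2_eq_square power3_eq_cube power4_eq_xxxx)
qed (use v_p_bounds in auto)

text \<open>The - 1 in the quadratic coefficient stems from x^2 / (x^2 + 1). No cubic term is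
  needed: the collected coefficients 0.776 (from p^3/5 in the exponential), - 1.57 (from - p) and
  0.187 (from 1.1 * 0.17) have a negative sum, which also absorbs the term in v^4.\<close>

lemma asymp_ratio_upper: "asymp_ratio x y \<le> 1 + p * v + (p\<^sup>2 / 2 - 1) * v\<^sup>2"
proof -
  define E where "E = 1 + p * v + p\<^sup>2 / 2 * v\<^sup>2 + (776 / 1000) * v ^ 3"
  have "exp (pi * (y - x)) \<le> exp (p * v)"
    using gap_upper by (simp add: p_def)
  also have "\<dots> \<le> 1 + p * v + (p * v)\<^sup>2 / 2 + (p * v) ^ 3 / 5"
  proof (rule exp_le_cubic)
    have "p * v \<le> (15708 / 10000) * (1 / 20)" using v_p_bounds by (intro mult_mono) auto
    then show "p * v \<le> 1 / 10" by simp
  qed (use v_p_bounds in simp)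
  also have "\<dots> \<le> E"
  proof -
    have "p ^ 3 \<le> (15708 / 10000) ^ 3" using v_p_bounds by (intro power_mono) auto
    then have "p ^ 3 / 5 * v ^ 3 \<le> (776 / 1000) * v ^ 3" using v_p_bounds by (intro mult_right_mono) (auto simp: power3_eq_cube)
    then show ?thesis by (simp add: E_def power_mult_distrib)
  qed
  finally have e: "exp (pi * (y - x)) \<le> E" .
  have pp: "p\<^sup>2 \<le> (24675 / 10000)"
  proof -
    have "p\<^sup>2 \<le> (15708 / 10000)\<^sup>2" using v_p_bounds by (intro power_mono) auto
    then show ?thesis by (simp add: power2_eq_square)
  qed
  have Eb: "E \<le> (11 / 10)"
  proof -
    have "p * v \<le> (15708 / 10000) * (1 / 20)" "p\<^sup>2 / 2 * v\<^sup>2 \<le> (24675 / 10000) / 2 * (1 / 20)\<^sup>2" "v ^ 3 \<le> (1 / 20) ^ 3"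
      using v_p_bounds pp by (intro mult_mono power_mono; simp)+
    then show ?thesis by (simp add: E_def power2_eq_square power3_eq_cube)
  qed
  have E0: "1 + (157 / 100) * v \<le> E"
  proof -
    have "(157 / 100) * v \<le> p * v" using v_p_bounds by (intro mult_right_mono) auto
    moreover have "0 \<le> p\<^sup>2 / 2 * v\<^sup>2" by simp
    ultimately show ?thesis unfolding E_def using v_powers by linarith
  qed
  have g: "1 / (1 + v\<^sup>2) \<le> 1 - v\<^sup>2 + v ^ 4"
  proof -
    have "1 \<le> (1 - v\<^sup>2 + v ^ 4) * (1 + v\<^sup>2)"
      using v_p_bounds by (simp add: algebra_simps power2_eq_square power4_eq_xxxx)
    then show ?thesis by (simp add: divide_le_eq add_pos_nonneg)
  qed
  have "asymp_ratio x y \<le> E * (1 - v\<^sup>2 + v ^ 4) * (1 + (17 / 100) * v ^ 3)"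
  proof -
    have E: "0 \<le> E" using E0 v_p_bounds by linarith
    have n: "0 \<le> 1 - v\<^sup>2 + v ^ 4" using v_powers v_p_bounds by (simp add: power_le_one add_nonneg_nonneg)
    have "exp (pi * (y - x)) * (1 / (1 + v\<^sup>2)) \<le> E * (1 - v\<^sup>2 + v ^ 4)"
      by (rule mult_mono[OF e g E]) (simp add: add_nonneg_nonneg)
    then show ?thesis
      unfolding asymp_ratio_def v_def[symmetric]
      by (rule mult_mono[OF _ correction_factor_bounds(2) mult_nonneg_nonneg[OF E n]]) (use correction_factor_bounds(1) in linarith)
  qed
  also have "(1 - v\<^sup>2 + v ^ 4) * (1 + (17 / 100) * v ^ 3) \<le> 1 - v\<^sup>2 + (17 / 100) * v ^ 3 + v ^ 4"
  proof -
    have "v ^ 4 \<le> v\<^sup>2" using v_powers by linarith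
    then have "v ^ 4 * v ^ 3 \<le> v\<^sup>2 * v ^ 3" by (rule mult_right_mono[OF _ v_powers(4)])
    then show ?thesis by (simp add: algebra_simps)
  qed
  then have "E * (1 - v\<^sup>2 + v ^ 4) * (1 + (17 / 100) * v ^ 3) \<le> E * (1 - v\<^sup>2 + (17 / 100) * v ^ 3 + v ^ 4)"
    unfolding mult.assoc using E0 v_p_bounds by (intro mult_left_mono) auto
  also have "\<dots> = E - E * v\<^sup>2 + E * ((17 / 100) * v ^ 3 + v ^ 4)" by (simp add: algebra_simps)
  also have "\<dots> \<le> E - (1 + (157 / 100) * v) * v\<^sup>2 + (11 / 10) * ((17 / 100) * v ^ 3 + v ^ 4)"
    using E0 Eb v_powers by (intro add_mono diff_mono mult_right_mono) auto
  also have "\<dots> = 1 + p * v + (p\<^sup>2 / 2 - 1) * v\<^sup>2 + ((776 / 1000) - (157 / 100) + (187 / 1000)) * v ^ 3 + (11 / 10) * v ^ 4"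
    by (simp add: E_def algebra_simps power2_eq_square power3_eq_cube)
  also have "\<dots> \<le> 1 + p * v + (p\<^sup>2 / 2 - 1) * v\<^sup>2"
  proof -
    have "((776 / 1000) - (157 / 100) + (187 / 1000)) * v ^ 3 + (11 / 10) * v ^ 4 \<le> 0" using v_powers by argo
    then show ?thesis by linarith
  qed
  finally show ?thesis .
qed

text \<open>The true quadratic coefficient is about 0.23. The value 1/10 remains when all cubic and
  quartic losses are charged to v^2 at v = 1/20, and it is ample for the lower inequality.\<close>

lemma asymp_ratio_lower: "1 + p * v + (1 / 10) * v\<^sup>2 \<le> asymp_ratio x y"
proof -
  \<comment> \<open>\<open>gap_lower\<close> gives p v - (p/4) v^3 as a lower bound for the
    exponent, and 0.4 exceeds p / 4.\<close>
  define w where "w = p * v - (4 / 10) * v ^ 3"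
  have "2 * p * (v / 2 - v ^ 3 / 8) \<le> pi * (y - x)"
    using gap_lower by (simp add: p_def)
  moreover have "2 * p * (v / 2 - v ^ 3 / 8) = p * v - p * v ^ 3 / 4" by (simp add: right_diff_distrib)
  moreover have "p * v ^ 3 \<le> (15708 / 10000) * v ^ 3" using v_p_bounds by (intro mult_right_mono) auto
  ultimately have w1: "w \<le> pi * (y - x)"
    unfolding w_def using v_powers by linarith
  have w0: "(99 / 100) * (p * v) \<le> w"
  proof -
    have "(157 / 100) * v \<le> p * v" using v_p_bounds by (intro mult_right_mono) auto
    moreover have "v\<^sup>2 \<le> v / 20" using mult_right_mono[OF v_p_bounds(2), of v] v_p_bounds(1) by (simp add: power2_eq_square)
    ultimately show ?thesis unfolding w_def using v_powers by argo
  qed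
  have "(2414 / 1000) * v\<^sup>2 \<le> w\<^sup>2"
  proof -
    have "(1554 / 1000) * v \<le> (99 / 100) * (p * v)" using mult_right_mono[OF v_p_bounds(3), of v] v_p_bounds(1) by simp
    then have "(1554 / 1000) * v \<le> w" using w0 by linarith
    then have "((1554 / 1000) * v)\<^sup>2 \<le> w\<^sup>2" using v_p_bounds by (intro power_mono) auto
    moreover have "((1554 / 1000) * v)\<^sup>2 = (2414916 / 1000000) * v\<^sup>2" by (simp add: power_mult_distrib power_divide)
    ultimately show ?thesis using v_powers(3) by linarith
  qed
  then have "1 + p * v - (4 / 10) * v ^ 3 + (1207 / 1000) * v\<^sup>2 \<le> 1 + w + w\<^sup>2 / 2" by (simp add: w_def)
  also have "\<dots> \<le> exp w"
  proof (rule exp_lower_Taylor_quadratic)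
    have "0 \<le> (99 / 100) * (p * v)" using v_p_bounds by simp
    then show "0 \<le> w" using w0 by linarith
  qed
  also have "\<dots> \<le> exp (pi * (y - x))" using w1 by simp
  finally have e: "1 + p * v - (4 / 10) * v ^ 3 + (1207 / 1000) * v\<^sup>2 \<le> exp (pi * (y - x))" .
  have g: "1 - v\<^sup>2 \<le> 1 / (1 + v\<^sup>2)"
  proof -
    have "(1 - v\<^sup>2) * (1 + v\<^sup>2) \<le> 1" by (simp add: algebra_simps)
    then show ?thesis by (simp add: le_divide_eq add_pos_nonneg)
  qed
  have v1: "v\<^sup>2 \<le> 1" using v_p_bounds by (simp add: power_le_one)
  have "1 + p * v + (1 / 10) * v\<^sup>2 \<le> (1 + p * v - (4 / 10) * v ^ 3 + (1207 / 1000) * v\<^sup>2) * (1 - v\<^sup>2)"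
  proof -
    have "(1 + p * v - (4 / 10) * v ^ 3 + (1207 / 1000) * v\<^sup>2) * (1 - v\<^sup>2)
      = 1 + p * v + (207 / 1000) * v\<^sup>2 - (4 / 10) * v ^ 3 - p * v ^ 3 + (4 / 10) * v\<^sup>2 * v ^ 3 - (1207 / 1000) * v ^ 4"
      by (simp add: field_simps power2_eq_square power3_eq_cube power4_eq_xxxx)
    moreover have "p * v ^ 3 \<le> (15708 / 10000) * v ^ 3" using v_p_bounds by (intro mult_right_mono) auto
    moreover have "0 \<le> v\<^sup>2 * v ^ 3" using v_powers by simp
    ultimately show ?thesis using v_powers by argo
  qed
  also have "\<dots> \<le> exp (pi * (y - x)) * (1 / (1 + v\<^sup>2))"
    using e g v1 by (intro mult_mono) auto
  also have "\<dots> = exp (pi * (y - x)) * (1 / (1 + v\<^sup>2)) * 1" by simp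
  also have "\<dots> \<le> asymp_ratio x y"
    unfolding asymp_ratio_def v_def[symmetric] using correction_factor_bounds(1) by (intro mult_left_mono) (auto intro: add_nonneg_nonneg)
  finally show ?thesis .
qed

end


lemma op_asymp_Suc:
  assumes "n \<ge> 400"
  shows "op_asymp (Suc n) = op_asymp n * asymp_ratio (sqrt (real n)) (sqrt (real (Suc n)))"
proof -
  define x y where "x = sqrt (real n)" and "y = sqrt (real (Suc n))"
  have x: "x \<ge> 20" using assms unfolding x_def by (intro real_le_rsqrt) simp
  have y: "y > 0" by (simp add: y_def)
  have n: "real n = x\<^sup>2" "real (Suc n) = x\<^sup>2 + 1" by (simp_all add: x_def)
  have "3 * 20 \<le> pi * x" using x pi_approx by (intro mult_mono) auto
  then have c: "1 - 1 / (pi * x) \<noteq> 0" by (simp add: field_simps)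
  have e: "exp (pi * y) = exp (pi * x) * exp (pi * (y - x))"
    by (simp add: exp_add[symmetric] right_diff_distrib)
  have d: "1 / (8 * (x\<^sup>2 + 1)) = 1 / (8 * x\<^sup>2) * (1 / (1 + (1 / x)\<^sup>2))"
  proof -
    have "x\<^sup>2 * (1 + (1 / x)\<^sup>2) = x\<^sup>2 + 1" using x by (simp add: distrib_left power_divide)
    then show ?thesis by (simp add: mult.assoc)
  qed
  have "op_asymp (Suc n) = exp (pi * y) * (1 / (8 * (x\<^sup>2 + 1))) * (1 - 1 / (pi * y))"
    unfolding op_asymp_def y_def[symmetric] unfolding n by simp
  also have "\<dots> = exp (pi * x) * (1 / (8 * x\<^sup>2)) * (1 - 1 / (pi * x)) *
      (exp (pi * (y - x)) * (1 / (1 + (1 / x)\<^sup>2)) * ((1 - 1 / (pi * y)) / (1 - 1 / (pi * x))))"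
  proof -
    have "e1 * e2 * (u * w) * g = e1 * u * k * (e2 * w * (g / k))" if "k \<noteq> 0" for e1 e2 u w g k :: real
      using that by simp
    from this[OF c] show ?thesis unfolding e d .
  qed
  also have "exp (pi * x) * (1 / (8 * x\<^sup>2)) * (1 - 1 / (pi * x)) = op_asymp n"
    unfolding op_asymp_def x_def[symmetric] unfolding n by simp
  finally show ?thesis unfolding asymp_ratio_def x_def y_def .
qed

text \<open>In \<open>p\<close> and \<open>v\<close> the claimed bounds are p v and p v + (p^2/10)
  v^2. The quadratic slack is 0.1 below and 1 - 2 p^2/5 >= 0.013 above, while the relative errors
  \<open>d\<close> of the two values together cost at most 3 d = 0.009 v^2.\<close>

lemma ratio_large:
  assumes n: "n \<ge> 400"
  defines "r \<equiv> (real (overpartitions (Suc n)) - real (overpartitions n)) / real (overpartitions n)"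
  shows "pi / (2 * sqrt (real n)) < r" and "r < pi / (2 * sqrt (real n)) + pi\<^sup>2 / (40 * real n)"
proof -
  define x y where "x = sqrt (real n)" and "y = sqrt (real (Suc n))"
  define v p where "v = 1 / x" and "p = pi / 2"
  define P Q a where "P = real (overpartitions n)" and "Q = real (overpartitions (Suc n))" and "a = op_asymp n"
  define q d where "q = asymp_ratio x y" and "d = 3 / 1000 * v\<^sup>2"
  have x: "x \<ge> 20" using n unfolding x_def by (intro real_le_rsqrt) simp
  have xy: "y\<^sup>2 = x\<^sup>2 + 1" "y > 0" by (simp_all add: x_def y_def)
  have vn: "v\<^sup>2 = 1 / real n" by (simp add: v_def x_def power_divide)
  have v: "0 < v" "v \<le> 1 / 20" and p: "157 / 100 \<le> p" "p \<le> 15708 / 10000"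
    using v_p_bounds[OF x xy] by (simp_all add: v_def p_def)
  have v2: "0 < v\<^sup>2" "v\<^sup>2 \<le> 1 / 400"
    using v power_mono[of v "1 / 20" 2] by (simp_all add: power_divide)
  have q: "1 + p * v + 1 / 10 * v\<^sup>2 \<le> q" "q \<le> 1 + p * v + (p\<^sup>2 / 2 - 1) * v\<^sup>2"
    using asymp_ratio_lower[OF x xy] asymp_ratio_upper[OF x xy] by (simp_all add: q_def v_def p_def)
  have a: "a > 0" unfolding a_def by (rule op_asymp_relative(2)[OF n])
  have pv: "0 \<le> p * v" "p * v \<le> 8 / 100"
  proof -
    have "p * v \<le> 15708 / 10000 * (1 / 20)" using v p by (intro mult_mono) auto
    then show "p * v \<le> 8 / 100" by simp
  qed (use v p in simp)
  have pp: "p\<^sup>2 \<le> 24675 / 10000"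
  proof -
    have "p\<^sup>2 \<le> (15708 / 10000)\<^sup>2" using p by (intro power_mono) auto
    then show ?thesis by (simp add: power_divide)
  qed
  have q0: "q > 0" using q(1) pv v2 by linarith
  have P: "(1 - d) * a \<le> P" "P \<le> (1 + d) * a"
    using op_asymp_relative(1)[OF n] by (simp_all add: P_def a_def d_def vn abs_le_iff algebra_simps)
  have Q: "(1 - d) * (a * q) \<le> Q" "Q \<le> (1 + d) * (a * q)"
  proof -
    have b: "op_asymp (Suc n) = a * q" unfolding a_def q_def x_def y_def by (rule op_asymp_Suc[OF n])
    have "3 / 1000 / real (Suc n) \<le> d"
      unfolding d_def vn using n by (simp add: frac_le)
    then have "3 / 1000 / real (Suc n) * (a * q) \<le> d * (a * q)" using a q0 by (intro mult_right_mono) auto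
    moreover have "\<bar>Q - a * q\<bar> \<le> 3 / 1000 / real (Suc n) * (a * q)"
      using op_asymp_relative(1)[of "Suc n"] n unfolding b Q_def by simp
    ultimately have "\<bar>Q - a * q\<bar> \<le> d * (a * q)" by linarith
    then show "(1 - d) * (a * q) \<le> Q" "Q \<le> (1 + d) * (a * q)"
      unfolding left_diff_distrib distrib_right by linarith+
  qed
  have d: "0 \<le> d" "d \<le> 1 / 100" using v2 by (simp_all add: d_def)
  have Ppos: "P > 0"
  proof -
    have "0 < (1 - d) * a" using a d by simp
    then show ?thesis using P(1) by linarith
  qed
  have "(1 + p * v) * P < Q"
  proof -
    have "(1 + p * v) * P \<le> (1 + p * v) * ((1 + d) * a)" using P pv by (intro mult_left_mono) auto
    also have "\<dots> = ((1 + p * v) * (1 + d)) * a" by simp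
    also have "\<dots> < ((1 - d) * (1 + p * v + 1 / 10 * v\<^sup>2)) * a"
    proof (rule mult_strict_right_mono[OF _ a])
      have "d * (2 * (1 + p * v) + 1 / 10 * v\<^sup>2) \<le> d * 3" using d pv v2 by (intro mult_left_mono) auto
      also have "\<dots> < 1 / 10 * v\<^sup>2" using v2 by (simp add: d_def)
      finally show "(1 + p * v) * (1 + d) < (1 - d) * (1 + p * v + 1 / 10 * v\<^sup>2)"
        by (simp add: algebra_simps)
    qed
    also have "\<dots> \<le> ((1 - d) * q) * a" using q(1) d a by (intro mult_right_mono mult_left_mono) auto
    also have "\<dots> = (1 - d) * (a * q)" by simp
    also have "\<dots> \<le> Q" by (rule Q(1))
    finally show ?thesis .
  qed
  then show "pi / (2 * sqrt (real n)) < r"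
    unfolding r_def P_def[symmetric] Q_def[symmetric] x_def[symmetric]
    using Ppos by (simp add: less_divide_eq p_def v_def algebra_simps)
  have "Q < (1 + p * v + p\<^sup>2 / 10 * v\<^sup>2) * P"
  proof -
    have "Q \<le> (1 + d) * (a * q)" by (rule Q(2))
    also have "\<dots> = ((1 + d) * q) * a" by simp
    also have "\<dots> \<le> ((1 + d) * (1 + p * v + (p\<^sup>2 / 2 - 1) * v\<^sup>2)) * a"
      using q(2) d a by (intro mult_right_mono mult_left_mono) auto
    also have "\<dots> < ((1 - d) * (1 + p * v + p\<^sup>2 / 10 * v\<^sup>2)) * a"
    proof (rule mult_strict_right_mono[OF _ a])
      have "p\<^sup>2 * v\<^sup>2 \<le> 24675 / 10000 * (1 / 400)" using pp v2 by (intro mult_mono) auto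
      then have s: "2 * (1 + p * v) + (3 / 5 * (p\<^sup>2 * v\<^sup>2) - v\<^sup>2) \<le> 3" using pv v2 by argo
      have "d * (2 * (1 + p * v) + (3 / 5 * (p\<^sup>2 * v\<^sup>2) - v\<^sup>2)) \<le> d * 3"
        using s d by (intro mult_left_mono) auto
      also have "\<dots> < 13 / 1000 * v\<^sup>2" using v2 by (simp add: d_def)
      also have "\<dots> \<le> (1 - 2 / 5 * p\<^sup>2) * v\<^sup>2" using pp by (intro mult_right_mono) auto
      finally have "d * (2 * (1 + p * v) + (3 / 5 * (p\<^sup>2 * v\<^sup>2) - v\<^sup>2)) < (1 - 2 / 5 * p\<^sup>2) * v\<^sup>2" .
      moreover have "(1 - d) * (1 + p * v + p\<^sup>2 / 10 * v\<^sup>2) - (1 + d) * (1 + p * v + (p\<^sup>2 / 2 - 1) * v\<^sup>2)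
        = (1 - 2 / 5 * p\<^sup>2) * v\<^sup>2 - d * (2 * (1 + p * v) + (3 / 5 * (p\<^sup>2 * v\<^sup>2) - v\<^sup>2))"
        by (simp add: field_simps)
      ultimately show "(1 + d) * (1 + p * v + (p\<^sup>2 / 2 - 1) * v\<^sup>2) < (1 - d) * (1 + p * v + p\<^sup>2 / 10 * v\<^sup>2)"
        by linarith
    qed
    also have "\<dots> = (1 + p * v + p\<^sup>2 / 10 * v\<^sup>2) * ((1 - d) * a)" by simp
    also have "\<dots> \<le> (1 + p * v + p\<^sup>2 / 10 * v\<^sup>2) * P"
      using P(1) pv by (intro mult_left_mono) (auto intro!: add_nonneg_nonneg)
    finally show ?thesis .
  qed
  then have "(Q - P) / P < p * v + p\<^sup>2 / 10 * v\<^sup>2"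
    using Ppos by (simp add: pos_divide_less_eq algebra_simps)
  also have "p\<^sup>2 / 10 * v\<^sup>2 = pi\<^sup>2 / (40 * real n)" unfolding vn by (simp add: p_def power_divide)
  also have "p * v = pi / (2 * sqrt (real n))" by (simp add: p_def v_def x_def)
  finally show "r < pi / (2 * sqrt (real n)) + pi\<^sup>2 / (40 * real n)"
    by (simp add: r_def P_def Q_def)
qed

section \<open>Small arguments\<close>

text \<open>Applied to \<open>2, 0\<close> and the list of earlier values, latest first, the following function reads the
  entries at positions \<open>k\<^sup>2 - 1\<close>; its arguments are the next gap and the number of entries still to skip.\<close>

fun alternating_squares :: "nat \<Rightarrow> nat \<Rightarrow> int list \<Rightarrow> int" where
  "alternating_squares d c [] = 0"
| "alternating_squares d 0 (x # xs) = x - alternating_squares (Suc (Suc d)) d xs"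
| "alternating_squares d (Suc c) (x # xs) = alternating_squares d c xs"

text \<open>The constants are rational bounds for \<open>pi\<^sup>2\<close>: 9.8697 from above, 9.8696 from below, and
  0.24674 = 9.8696 / 40.\<close>

definition ratio_lower :: "int \<Rightarrow> int \<Rightarrow> int \<Rightarrow> bool" where
  "ratio_lower n p d \<longleftrightarrow> 0 < d \<and> 98697 * (p * p) < 40000 * (n * (d * d))"

text \<open>With e = 100000 n d - 24674 p one has d/p - 0.24674/n = e / (100000 n p). The test says
  that the square of this is below 9.8696 / (4 n), with denominators cleared and a factor 10000 to
  make the constants integral.\<close>

definition ratio_upper :: "int \<Rightarrow> int \<Rightarrow> int \<Rightarrow> bool" where
  "ratio_upper n p e \<longleftrightarrow> 40000 * (e * e) < 986960000000000 * (n * (p * p))"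

definition ratio_check :: "int \<Rightarrow> int \<Rightarrow> int \<Rightarrow> bool" where
  "ratio_check n p d \<longleftrightarrow> n < 26 \<or> ratio_lower n p d \<and> ratio_upper n p (100000 * (n * d) - 24674 * p)"

text \<open>\<open>v\<close> is the new value and \<open>p\<close> the latest old one, whose index
  is \<open>n\<close>; so the difference v - p is tested at index n before the index is
  increased.\<close>

fun extend_history :: "int \<Rightarrow> bool \<Rightarrow> int \<Rightarrow> int list \<Rightarrow> bool \<times> int \<times> int list" where
  "extend_history v b n [] = (False, n, [])"
| "extend_history v b n (p # l) = (b \<and> ratio_check n p (v - p), n + 1, v # p # l)"

fun history_step :: "bool \<times> int \<times> int list \<Rightarrow> bool \<times> int \<times> int list" where
  "history_step (b, n, l) = extend_history (2 * alternating_squares (Suc (Suc 0)) 0 l) b n l"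

text \<open>Recursion on binary numerals, so that 400 steps can be evaluated by rewriting without a unary counter.\<close>

fun history_steps :: "num \<Rightarrow> bool \<times> int \<times> int list \<Rightarrow> bool \<times> int \<times> int list" where
  "history_steps num.One s = history_step s"
| "history_steps (num.Bit0 k) s = history_steps k (history_steps k s)"
| "history_steps (num.Bit1 k) s = history_step (history_steps k (history_steps k s))"


lemma alternating_squares_drop: "alternating_squares d c l = alternating_squares d 0 (drop c l)"
proof (induction c arbitrary: l)
  case (Suc c)
  then show ?case by (cases l) auto
qed simp

text \<open>When position j^2 - 1 is read, the gap argument is 2 j, the number of entries strictly
  between that position and (j+1)^2 - 1. The nested subtractions alternate the signs relative to the
  first term read, which the prefactor compensates.\<close>

lemma alternating_squares_eq:
  assumes "j \<ge> 1"
  shows "(-1) ^ Suc j * alternating_squares (2 * j) 0 (drop (j\<^sup>2 - 1) l) =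
    (\<Sum>k | j \<le> k \<and> k\<^sup>2 \<le> length l. (-1) ^ Suc k * l ! (k\<^sup>2 - 1))"
  using assms
proof (induction "Suc (length l) - j" arbitrary: j rule: less_induct)
  case less
  show ?case
  proof (cases "j\<^sup>2 \<le> length l")
    case True
    have j: "j\<^sup>2 > 0" "j \<le> j\<^sup>2" using less.prems by (auto simp: power2_eq_square)
    have "drop (j\<^sup>2 - 1) l = l ! (j\<^sup>2 - 1) # drop (Suc (j\<^sup>2 - 1)) l"
      using True j by (intro Cons_nth_drop_Suc[symmetric]) auto
    then have d: "drop (j\<^sup>2 - 1) l = l ! (j\<^sup>2 - 1) # drop (j\<^sup>2) l" using j by simp
    have e: "2 * j + j\<^sup>2 = (Suc j)\<^sup>2 - 1" by (simp add: power2_eq_square)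
    have h: "alternating_squares (2 * j) 0 (drop (j\<^sup>2 - 1) l) = l ! (j\<^sup>2 - 1) - alternating_squares (2 * Suc j) 0 (drop ((Suc j)\<^sup>2 - 1) l)"
      unfolding d e[symmetric] using alternating_squares_drop[of "2 * Suc j" "2 * j" "drop (j\<^sup>2) l"] by simp
    have "(-1) ^ Suc j * alternating_squares (2 * j) 0 (drop (j\<^sup>2 - 1) l)
        = (-1) ^ Suc j * l ! (j\<^sup>2 - 1) + (-1) ^ Suc (Suc j) * alternating_squares (2 * Suc j) 0 (drop ((Suc j)\<^sup>2 - 1) l)"
      unfolding h by (simp add: right_diff_distrib)
    also have "(-1) ^ Suc (Suc j) * alternating_squares (2 * Suc j) 0 (drop ((Suc j)\<^sup>2 - 1) l)
        = (\<Sum>k | Suc j \<le> k \<and> k\<^sup>2 \<le> length l. (-1) ^ Suc k * l ! (k\<^sup>2 - 1))"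
      using True j less.prems by (intro less.hyps) linarith+
    also have "(-1) ^ Suc j * l ! (j\<^sup>2 - 1) + \<dots> = (\<Sum>k\<in>insert j {k. Suc j \<le> k \<and> k\<^sup>2 \<le> length l}. (-1) ^ Suc k * l ! (k\<^sup>2 - 1))"
    proof (rule sum.insert[symmetric])
      show "finite {k. Suc j \<le> k \<and> k\<^sup>2 \<le> length l}"
        by (rule finite_subset[of _ "{..length l}"]) (auto dest: power2_nat_le_imp_le)
    qed simp
    also have "insert j {k. Suc j \<le> k \<and> k\<^sup>2 \<le> length l} = {k. j \<le> k \<and> k\<^sup>2 \<le> length l}"
      using True by (auto simp: Suc_le_eq)
    finally show ?thesis .
  next
    case False
    have e: "{k. j \<le> k \<and> k\<^sup>2 \<le> length l} = {}"
    proof -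
      have "length l < k\<^sup>2" if "j \<le> k" for k
        using power_mono[OF that, of 2] False by linarith
      then show ?thesis by (auto simp: not_le[symmetric])
    qed
    have d: "drop (j\<^sup>2 - 1) l = []" using False by simp
    show ?thesis unfolding d e by simp
  qed
qed

text \<open>Latest value first, so that \<open>overpartitions (Suc n - k\<^sup>2)\<close> in the
  recurrence sits at position k^2 - 1 whatever n is, and a step only prepends an element.\<close>

definition history :: "nat \<Rightarrow> int list" where
  "history n = map (\<lambda>i. int (overpartitions (n - i))) [0..<Suc n]"

lemma history_Suc: "history (Suc n) = int (overpartitions (Suc n)) # history n"
proof -
  have "[0..<Suc (Suc n)] = 0 # map Suc [0..<Suc n]" by (simp only: map_Suc_upt) (simp add: upt_conv_Cons)
  then show ?thesis unfolding history_def by (simp only: list.map map_map) (simp add: o_def)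
qed

lemma history_nth: "i \<le> n \<Longrightarrow> history n ! i = int (overpartitions (n - i))"
  unfolding history_def by (subst nth_map) (auto simp del: upt_Suc)

lemma history_ne: "history n = int (overpartitions n) # tl (history n)"
  unfolding history_def by (simp add: upt_conv_Cons del: upt_Suc)

lemma alternating_squares_history:
  "2 * alternating_squares (Suc (Suc 0)) 0 (history n) = int (overpartitions (Suc n))"
proof -
  have "alternating_squares (Suc (Suc 0)) 0 (history n) = (\<Sum>k | 1 \<le> k \<and> k\<^sup>2 \<le> length (history n). (-1) ^ Suc k * history n ! (k\<^sup>2 - 1))"
    using alternating_squares_eq[of 1 "history n"] by (simp add: numeral_2_eq_2)
  also have "\<dots> = (\<Sum>k | 1 \<le> k \<and> k\<^sup>2 \<le> Suc n. (-1) ^ Suc k * int (overpartitions (Suc n - k\<^sup>2)))"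
  proof (rule sum.cong)
    fix k assume "k \<in> {k. 1 \<le> k \<and> k\<^sup>2 \<le> Suc n}"
    then have k: "1 \<le> k\<^sup>2" "k\<^sup>2 \<le> Suc n" by auto
    have "history n ! (k\<^sup>2 - 1) = int (overpartitions (n - (k\<^sup>2 - 1)))"
      by (rule history_nth) (use k in simp)
    moreover have "n - (k\<^sup>2 - 1) = Suc n - k\<^sup>2" using k by simp
    ultimately show "(-1) ^ Suc k * history n ! (k\<^sup>2 - 1) = (-1) ^ Suc k * int (overpartitions (Suc n - k\<^sup>2))"
      by simp
  qed (simp add: history_def)
  finally show ?thesis using overpartitions_recurrence[of "Suc n"] by simp
qed

definition history_invariant :: "bool \<times> int \<times> int list \<Rightarrow> bool" where
  "history_invariant s \<longleftrightarrow> (case s of (b, n, l) \<Rightarrow> \<exists>m. n = int m \<and> l = history m \<and>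
     (b \<longrightarrow> (\<forall>i<m. ratio_check (int i) (int (overpartitions i)) (int (overpartitions (Suc i)) - int (overpartitions i)))))"

lemma history_invariant_step: "history_invariant s \<Longrightarrow> history_invariant (history_step s)"
proof -
  assume s: "history_invariant s"
  obtain b n l where s': "s = (b, n, l)" by (cases s)
  from s obtain m where m: "n = int m" "l = history m"
    "b \<longrightarrow> (\<forall>i<m. ratio_check (int i) (int (overpartitions i)) (int (overpartitions (Suc i)) - int (overpartitions i)))"
    by (auto simp: history_invariant_def s')
  have "history_step s = (b \<and> ratio_check n (int (overpartitions m)) (int (overpartitions (Suc m)) - int (overpartitions m)), n + 1, history (Suc m))"
    unfolding s' history_step.simps m(2) alternating_squares_history history_Suc
    by (subst (1 2) history_ne) simp
  then show ?thesis
    using m by (auto simp: history_invariant_def less_Suc_eq intro!: exI[of _ "Suc m"])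
qed

lemma history_invariant_steps: "history_invariant s \<Longrightarrow> history_invariant (history_steps k s)"
  by (induction k arbitrary: s) (simp_all add: history_invariant_step)

text \<open>The argument is 400 = 16 * 25 in binary, least significant digit outermost. The
  computation starts from the list containing only the value at 0.\<close>

lemma history_steps_400: "case history_steps (num.Bit0 (num.Bit0 (num.Bit0 (num.Bit0 (num.Bit1 (num.Bit0 (num.Bit0 (num.Bit1 num.One)))))))) (True, 0, [1]) of (b, n, l) \<Rightarrow> b \<and> n = 400"
  by code_simp

lemma ratio_check_400:
  assumes "i < 400"
  shows "ratio_check (int i) (int (overpartitions i)) (int (overpartitions (Suc i)) - int (overpartitions i))"
proof -
  have "history_invariant (True, 0, [1])"
    by (simp add: history_invariant_def history_def overpartitions_0)
  define t where "t = history_steps (num.Bit0 (num.Bit0 (num.Bit0 (num.Bit0 (num.Bit1 (num.Bit0 (num.Bit0 (num.Bit1 num.One)))))))) (True, 0, [1])"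
  have "history_invariant t"
    unfolding t_def by (rule history_invariant_steps) fact
  moreover have "case t of (b, n, l) \<Rightarrow> b \<and> n = 400"
    unfolding t_def by (rule history_steps_400)
  ultimately show ?thesis using assms by (auto simp: history_invariant_def)
qed

section \<open>From the integer test to the real inequalities\<close>

lemma pi_squared_bounds: "9.8696 \<le> pi\<^sup>2" "pi\<^sup>2 \<le> 9.8697"
proof -
  have "3.14159265\<^sup>2 \<le> pi\<^sup>2" "pi\<^sup>2 \<le> 3.1415927\<^sup>2"
    using pi_approx by (intro power_mono; simp)+
  then show "9.8696 \<le> pi\<^sup>2" "pi\<^sup>2 \<le> 9.8697" by (simp_all add: power2_eq_square)
qed

lemma ratio_check_sound:
  fixes n p d :: int
  assumes c: "ratio_check n p d" and n: "n \<ge> 26" and p: "p > 0"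
  shows "pi / (2 * sqrt (real_of_int n)) < real_of_int d / real_of_int p"
    and "real_of_int d / real_of_int p < pi / (2 * sqrt (real_of_int n)) + pi\<^sup>2 / (40 * real_of_int n)"
proof -
  define N P D where "N = real_of_int n" and "P = real_of_int p" and "D = real_of_int d"
  define e where "e = 100000 * (n * d) - 24674 * p"
  have pos: "N > 0" "P > 0" using n p by (auto simp: N_def P_def)
  have "d > 0" "98697 * (p * p) < 40000 * (n * (d * d))" "40000 * (e * e) < 986960000000000 * (n * (p * p))"
    using c n by (auto simp: ratio_check_def ratio_lower_def ratio_upper_def e_def)
  then have "real_of_int d > 0" "real_of_int (98697 * (p * p)) < real_of_int (40000 * (n * (d * d)))"
    "real_of_int (40000 * (e * e)) < real_of_int (986960000000000 * (n * (p * p)))"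
    by (simp_all only: of_int_less_iff of_int_0_less_iff)
  then have D: "D > 0" and lo: "98697 * P\<^sup>2 < 40000 * (N * D\<^sup>2)"
    and up: "40000 * (real_of_int e)\<^sup>2 < 986960000000000 * (N * P\<^sup>2)"
    by (simp_all add: N_def P_def D_def power2_eq_square)
  have sq: "(pi / (2 * sqrt N))\<^sup>2 = pi\<^sup>2 / (4 * N)"
    using pos by (simp add: power_divide power_mult_distrib)
  have "pi\<^sup>2 / (4 * N) \<le> 9.8697 / (4 * N)"
    using pi_squared_bounds pos by (intro divide_right_mono) auto
  also have "\<dots> < (D / P)\<^sup>2"
    using lo pos by (simp add: power_divide field_simps)
  finally have "(pi / (2 * sqrt N))\<^sup>2 < (D / P)\<^sup>2" unfolding sq .
  then show "pi / (2 * sqrt (real_of_int n)) < real_of_int d / real_of_int p"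
    unfolding N_def[symmetric] P_def[symmetric] D_def[symmetric]
    by (rule power2_less_imp_less) (use D pos in auto)
  \<comment> \<open>y is d/p - 0.24674/n. As 0.24674 / n <= pi^2 / (40 n), it suffices to bound y by
    pi / (2 sqrt n), which follows from the comparison of squares even if e is negative.\<close>
  define y where "y = real_of_int e / (100000 * (N * P))"
  have "y\<^sup>2 = (real_of_int e)\<^sup>2 / (100000 * (N * P))\<^sup>2" by (simp add: y_def power_divide)
  also have "\<dots> < 24674000000 * (N * P\<^sup>2) / (100000 * (N * P))\<^sup>2"
    using up pos by (intro divide_strict_right_mono) auto
  also have "\<dots> = 9.8696 / (4 * N)"
    using pos by (simp add: power2_eq_square)
  also have "\<dots> \<le> pi\<^sup>2 / (4 * N)"
    using pi_squared_bounds pos by (intro divide_right_mono) auto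
  finally have "y\<^sup>2 < (pi / (2 * sqrt N))\<^sup>2" unfolding sq .
  then have "y < pi / (2 * sqrt N)" by (rule power2_less_imp_less) (use pos in simp)
  moreover have "D / P = y + 0.24674 / N"
    using pos by (simp add: y_def e_def N_def P_def D_def field_simps)
  moreover have "0.24674 / N \<le> pi\<^sup>2 / (40 * N)"
    using pi_squared_bounds pos by (simp add: field_simps)
  ultimately show "real_of_int d / real_of_int p < pi / (2 * sqrt (real_of_int n)) + pi\<^sup>2 / (40 * real_of_int n)"
    unfolding N_def[symmetric] P_def[symmetric] D_def[symmetric] by linarith
qed

lemma overpartitions_pos: "overpartitions n > 0"
proof -
  have "is_overpartition n (replicate n (1, False))"
    by (auto simp: is_overpartition_def sum_list_replicate sorted_wrt_iff_nth_less)
  then show ?thesis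
    unfolding overpartitions_def by (subst card_gt_0_iff) (use finite_overpartitions in auto)
qed

lemma ratio_small:
  assumes "26 \<le> n" "n < 400"
  defines "r \<equiv> (real (overpartitions (Suc n)) - real (overpartitions n)) / real (overpartitions n)"
  shows "pi / (2 * sqrt (real n)) < r" and "r < pi / (2 * sqrt (real n)) + pi\<^sup>2 / (40 * real n)"
  using ratio_check_sound[OF ratio_check_400[OF assms(2)]] assms(1) overpartitions_pos[of n]
  by (simp_all add: r_def)

theorem theorem1p4:
  fixes n :: nat
  assumes "n \<ge> 26"
  shows "ln (1 + pi / (2 * sqrt (real n))) < forward_diff (\<lambda>k. ln (real (overpartitions k))) n \<and>
         forward_diff (\<lambda>k. ln (real (overpartitions k))) n
           < ln (1 + pi / (2 * sqrt (real n)) + pi\<^sup>2 / (40 * real n))"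
proof -
  define r where "r = (real (overpartitions (Suc n)) - real (overpartitions n)) / real (overpartitions n)"
  have "pi / (2 * sqrt (real n)) < r \<and> r < pi / (2 * sqrt (real n)) + pi\<^sup>2 / (40 * real n)"
    using assms ratio_small[of n] ratio_large[of n] unfolding r_def by (cases "n < 400") auto
  moreover have "forward_diff (\<lambda>k. ln (real (overpartitions k))) n = ln (1 + r)"
  proof -
    have "1 + r = real (overpartitions (Suc n)) / real (overpartitions n)"
      using overpartitions_pos[of n] by (simp add: r_def field_simps)
    then show ?thesis
      using overpartitions_pos[of n] overpartitions_pos[of "Suc n"] by (simp add: forward_diff_def ln_div)
  qed
  moreover have "0 < 1 + pi / (2 * sqrt (real n))"
    by (intro add_pos_nonneg) auto
  ultimately show ?thesis by (simp add: add.assoc)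
qed

end
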